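(* Let $n\ge2$, $\mathcal{G}=\widetilde{\mathrm{Sp}(2n,\mathbb{R})}$, and let $\mathcal{E}=\mathcal{G}\times_{Z(\mathcal{G})}\mathcal{H}\mathcal{R}/\mathcal{H}$. The exact sequence $$0\to\mathbb{R}\to\mathcal{G}\times_{Z(\mathcal{G})}\mathcal{H}\mathcal{R}/\mathcal{H}\xrightarrow{\ \eta\ }\mathcal{G}/Z(\mathcal{G})\to0$$ (where $\mathbb{R}\cong\mathcal{H}\mathcal{R}/\mathcal{H}$ embeds by $r\mathcal{H}\mapsto(\mathrm{id},r\mathcal{H})$ and $\eta(g,r\mathcal{H})=gZ(\mathcal{G})$) is a topological group extension with a cross section.
   Context: Groups. $\mathrm{Sp}(2n,\mathbb{R})=\{M\in M_{2n}(\mathbb{R}): M^T\Omega M=\Omega\}$, $\Omega=\begin{pmatrix} 0 & I_n \\ -I_n & 0 \end{pmatrix}$. $\mathrm{U}(n)$ is embedded in $\mathrm{Sp}(2n,\mathbb{R})$ by $A+iB\mapsto\begin{pmatrix} A & -B \\ B & A \end{pmatrix}$ ($A,B$ real). Let $\pi:\widetilde{\mathrm{Sp}(2n,\mathbb{R})}\to\mathrm{Sp}(2n,\mathbb{R})$ be the universal covering and $\widetilde{\mathrm{U}(n)}=\pi^{-1}(\mathrm{U}(n))$. Put $\mathcal{G}=\widetilde{\mathrm{Sp}(2n,\mathbb{R})}$; $\mathcal{H}=\mathrm{SU}(n)\subset\mathcal{G}$, the identity component of $\pi^{-1}(\mathrm{SU}(n))$; $\mathcal{R}\cong\mathbb{R}$,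 the identity component of $\pi^{-1}(\{e^{ia}\mathrm{id}:a\in\mathbb{R}\})$. Then $\mathcal{H}\mathcal{R}=\widetilde{\mathrm{U}(n)}$ is a direct product and contains the center $Z(\mathcal{G})=\pi^{-1}(\{\pm\mathrm{id}\})$. Let $i:Z(\mathcal{G})\to\mathcal{G}$ be the inclusion and $\iota:Z(\mathcal{G})\to\mathcal{H}\mathcal{R}/\mathcal{H}\cong\mathbb{R}$ the restriction of the quotient map $\mathcal{H}\mathcal{R}\to\mathcal{H}\mathcal{R}/\mathcal{H}$. Elements of $\mathcal{H}\mathcal{R}/\mathcal{H}$ are written $r\mathcal{H}$, $r\in\mathcal{R}$. Define $$\mathcal{E}=\mathcal{G}\times_{Z(\mathcal{G})}\mathcal{H}\mathcal{R}/\mathcal{H}:=\frac{\mathcal{G}\times\mathcal{H}\mathcal{R}/\mathcal{H}}{\{(i(z),\iota(z)^{-1}):z\in Z(\mathcal{G})\}}.$$ Topological group extension. A topological group extension of $G$ by $Q$ is a pair $(E,\phi)$ where $E$ is a topological group containing $Q$ as a closed normal subgroup and $\phi:E\to G$ is an open continuous homomorphism onto $G$ with kernel $Q$; it is encoded by $0\to Q\to E\xrightarrow{\phi}G\to0$. A cross section is a continuous map $u:G\to E$ with $\phi(u(x))=x$ for all $x\in G$. *)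

theory Defs
  imports "HOL-Analysis.Analysis" "HOL-Algebra.Coset"
begin

section \<open>Topological groups and their extensions\<close>

text \<open>
  A topological group is a group record together with a topology on its carrier.  Hausdorffness is
  not part of the notion; all groups occurring below are Hausdorff anyway.
\<close>

definition topological_group :: "('a, 'm) monoid_scheme \<Rightarrow> 'a topology \<Rightarrow> bool" where
  "topological_group G T \<longleftrightarrow>
     group G \<and> topspace T = carrier G \<and>
     continuous_map (prod_topology T T) T (\<lambda>(x, y). x \<otimes>\<^bsub>G\<^esub> y) \<and>
     continuous_map T T (\<lambda>x. inv\<^bsub>G\<^esub> x)"

definition topological_group_iso ::
  "('a, 'm) monoid_scheme \<Rightarrow> 'a topology \<Rightarrow> ('b, 'k) monoid_scheme \<Rightarrow> 'b topology \<Rightarrow> ('a \<Rightarrow> 'b) \<Rightarrow> bool"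
where
  "topological_group_iso G T G' T' f \<longleftrightarrow>
     topological_group G T \<and> topological_group G' T' \<and> f \<in> iso G G' \<and> homeomorphic_map T T' f"

text \<open>
  The sequence \<open>0 \<rightarrow> Q \<rightarrow> E \<rightarrow> G \<rightarrow> 0\<close> with first map \<open>j\<close> and second map \<open>\<phi>\<close>.  That \<open>E\<close> contains \<open>Q\<close> as
  a closed normal subgroup means that \<open>j\<close> is an isomorphism of topological groups from \<open>Q\<close> onto a
  closed normal subgroup of \<open>E\<close> (with the subspace topology).
\<close>

definition topological_group_extension ::
  "('q, 'm) monoid_scheme \<Rightarrow> 'q topology \<Rightarrow> ('q \<Rightarrow> 'e) \<Rightarrow>
   ('e, 'k) monoid_scheme \<Rightarrow> 'e topology \<Rightarrow> ('e \<Rightarrow> 'g) \<Rightarrow>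
   ('g, 'l) monoid_scheme \<Rightarrow> 'g topology \<Rightarrow> bool"
where
  "topological_group_extension Q TQ j E TE \<phi> G TG \<longleftrightarrow>
     topological_group Q TQ \<and> topological_group E TE \<and> topological_group G TG \<and>
     j \<in> hom Q E \<and> embedding_map TQ TE j \<and>
     j ` carrier Q \<lhd> E \<and> closedin TE (j ` carrier Q) \<and>
     \<phi> \<in> hom E G \<and> continuous_map TE TG \<phi> \<and> open_map TE TG \<phi> \<and>
     \<phi> ` carrier E = carrier G \<and> kernel E G \<phi> = j ` carrier Q"

definition cross_section ::
  "'e topology \<Rightarrow> ('e \<Rightarrow> 'g) \<Rightarrow> 'g topology \<Rightarrow> ('g \<Rightarrow> 'e) \<Rightarrow> bool"
where
  "cross_section TE \<phi> TG u \<longleftrightarrow>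
     continuous_map TG TE u \<and> (\<forall>x \<in> topspace TG. \<phi> (u x) = x)"

definition quotient_topology :: "'a topology \<Rightarrow> ('a \<Rightarrow> 'b) \<Rightarrow> 'b topology" where
  "quotient_topology X f =
     topology (\<lambda>U. U \<subseteq> f ` topspace X \<and> openin X {x \<in> topspace X. f x \<in> U})"

lemma openin_quotient_topology:
  "openin (quotient_topology X f) U \<longleftrightarrow>
     U \<subseteq> f ` topspace X \<and> openin X {x \<in> topspace X. f x \<in> U}"
proof -
  have "istopology (\<lambda>U. U \<subseteq> f ` topspace X \<and> openin X {x \<in> topspace X. f x \<in> U})"
    (is "istopology ?P")
    unfolding istopology_def
  proof (intro conjI allI impI)
    fix S T assume S: "?P S" and T: "?P T"
    have "{x \<in> topspace X. f x \<in> S \<inter> T} =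
        {x \<in> topspace X. f x \<in> S} \<inter> {x \<in> topspace X. f x \<in> T}" by auto
    then show "openin X {x \<in> topspace X. f x \<in> S \<inter> T}"
      using openin_Int[of X, OF conjunct2[OF S] conjunct2[OF T]] by simp
    show "S \<inter> T \<subseteq> f ` topspace X" using S by blast
  next
    fix K assume K: "\<forall>S\<in>K. ?P S"
    have "{x \<in> topspace X. f x \<in> \<Union>K} = (\<Union>S\<in>K. {x \<in> topspace X. f x \<in> S})" by auto
    moreover have "openin X (\<Union>S\<in>K. {x \<in> topspace X. f x \<in> S})"
      using K by (intro openin_Union) blast
    ultimately show "openin X {x \<in> topspace X. f x \<in> \<Union>K}" by simp
    show "\<Union>K \<subseteq> f ` topspace X" using K by blast
  qed
  then show ?thesis
    by (simp add: quotient_topology_def topology_inverse')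
qed

lemma topspace_quotient_topology [simp]:
  "topspace (quotient_topology X f) = f ` topspace X"
proof
  show "topspace (quotient_topology X f) \<subseteq> f ` topspace X"
    using openin_topspace[of "quotient_topology X f"]
    unfolding openin_quotient_topology by (rule conjunct1)
  have "{x \<in> topspace X. f x \<in> f ` topspace X} = topspace X" by auto
  then have "openin (quotient_topology X f) (f ` topspace X)"
    by (simp add: openin_quotient_topology)
  then show "f ` topspace X \<subseteq> topspace (quotient_topology X f)"
    by (rule openin_subset)
qed

lemma quotient_map_quotient_topology: "quotient_map X (quotient_topology X f) f"
  unfolding quotient_map_def topspace_quotient_topology openin_quotient_topology by simp

text \<open>The topology of a quotient group \<^term>\<open>G Mod N\<close>; for normal \<open>N\<close>, left and right cosets agree.\<close>

definition coset_topology :: "('a, 'm) monoid_scheme \<Rightarrow> 'a topology \<Rightarrow> 'a set \<Rightarrow> 'a set topology" where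
  "coset_topology G T N = quotient_topology T (\<lambda>g. N #>\<^bsub>G\<^esub> g)"

definition group_center :: "('a, 'm) monoid_scheme \<Rightarrow> 'a set" where
  "group_center G = {z \<in> carrier G. \<forall>g \<in> carrier G. z \<otimes>\<^bsub>G\<^esub> g = g \<otimes>\<^bsub>G\<^esub> z}"

definition real_group :: "real monoid" where
  "real_group = \<lparr>carrier = UNIV, mult = (+), one = 0\<rparr>"


section \<open>Universal covering groups\<close>

text \<open>
  The next two notions are \<^const>\<open>covering_space\<close> and \<^const>\<open>simply_connected\<close>, restated for
  topologies that need not come from a type class.
\<close>

definition covering_map :: "'a topology \<Rightarrow> 'b topology \<Rightarrow> ('a \<Rightarrow> 'b) \<Rightarrow> bool" where
  "covering_map X Y p \<longleftrightarrow>
     continuous_map X Y p \<and> p ` topspace X = topspace Y \<and>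
     (\<forall>y \<in> topspace Y. \<exists>V. y \<in> V \<and> openin Y V \<and>
        (\<exists>\<U>. \<Union>\<U> = {x \<in> topspace X. p x \<in> V} \<and>
             (\<forall>U \<in> \<U>. openin X U) \<and> pairwise disjnt \<U> \<and>
             (\<forall>U \<in> \<U>. homeomorphic_map (subtopology X U) (subtopology Y V) p)))"

definition simply_connected_space :: "'a topology \<Rightarrow> bool" where
  "simply_connected_space X \<longleftrightarrow>
     (\<forall>p q. pathin X p \<and> p 1 = p 0 \<and> pathin X q \<and> q 1 = q 0 \<longrightarrow>
        homotopic_with (\<lambda>r. r 1 = r 0) (top_of_set {0..1}) X p q)"

text \<open>
  The universal covering group is characterised rather than constructed: it is unique up to a
  unique isomorphism over \<open>G\<close>.
\<close>

definition universal_covering_group ::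
  "('a, 'm) monoid_scheme \<Rightarrow> 'a topology \<Rightarrow> ('b, 'k) monoid_scheme \<Rightarrow> 'b topology \<Rightarrow> ('a \<Rightarrow> 'b) \<Rightarrow> bool"
where
  "universal_covering_group C TC G TG \<pi> \<longleftrightarrow>
     topological_group C TC \<and> topological_group G TG \<and> \<pi> \<in> hom C G \<and>
     covering_map TC TG \<pi> \<and> simply_connected_space TC"


section \<open>The symplectic group and unitary matrices\<close>

text \<open>
  A \<open>2n \<times> 2n\<close> matrix is indexed by \<^typ>\<open>'n + 'n\<close> with \<open>n = CARD('n)\<close>: indices \<open>Inl\<close> belong to the
  first block and \<open>Inr\<close> to the second one.
\<close>

definition block_matrix ::
  "'a^'n^'n \<Rightarrow> 'a^'n^'n \<Rightarrow> 'a^'n^'n \<Rightarrow> 'a^'n^'n \<Rightarrow> 'a^('n + 'n)^('n::finite + 'n)"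
where
  "block_matrix A B C D = (\<chi> i j.
     case i of
       Inl a \<Rightarrow> (case j of Inl b \<Rightarrow> A $ a $ b | Inr b \<Rightarrow> B $ a $ b)
     | Inr a \<Rightarrow> (case j of Inl b \<Rightarrow> C $ a $ b | Inr b \<Rightarrow> D $ a $ b))"

definition Omega :: "real^('n + 'n)^('n::finite + 'n)" where
  "Omega = block_matrix 0 (mat 1) (- mat 1) 0"

definition Sp :: "(real^('n + 'n)^('n::finite + 'n)) set" where
  "Sp = {M. transpose M ** Omega ** M = Omega}"

definition Sp_group :: "(real^('n + 'n)^('n::finite + 'n)) monoid" where
  "Sp_group = \<lparr>carrier = Sp, mult = (**), one = mat 1\<rparr>"

definition special_unitary :: "(complex^'n^'n::finite) set" where
  "special_unitary = {U. transpose (map_matrix cnj U) ** U = mat 1 \<and> det U = 1}"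

definition unit_scalars :: "(complex^'n^'n::finite) set" where
  "unit_scalars = range (\<lambda>a. mat (cis a))"

text \<open>The embedding \<open>A + \<i>B \<mapsto> (A, -B; B, A)\<close>.\<close>

definition unitary_embed :: "complex^'n^'n \<Rightarrow> real^('n + 'n)^('n::finite + 'n)" where
  "unitary_embed U =
     block_matrix (map_matrix Re U) (- map_matrix Im U) (map_matrix Im U) (map_matrix Re U)"


section \<open>The group \<open>\<E>\<close>\<close>

text \<open>
  In this section \<open>G\<close>, \<open>T\<close>, \<open>\<pi>\<close> are to be thought of as a universal covering group of
  \<^const>\<open>Sp_group\<close>, its topology and the covering projection.
\<close>

definition lifted_identity_component ::
  "('g, 'm) monoid_scheme \<Rightarrow> 'g topology \<Rightarrow> ('g \<Rightarrow> 'b) \<Rightarrow> 'b set \<Rightarrow> 'g set"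
where
  "lifted_identity_component G T \<pi> S =
     connected_component_of_set (subtopology T {g \<in> carrier G. \<pi> g \<in> S}) \<one>\<^bsub>G\<^esub>"

definition lift_SU ::
  "('g, 'm) monoid_scheme \<Rightarrow> 'g topology \<Rightarrow> ('g \<Rightarrow> real^('n + 'n)^('n::finite + 'n)) \<Rightarrow> 'g set"
where
  "lift_SU G T \<pi> = lifted_identity_component G T \<pi> (unitary_embed ` special_unitary)"

definition lift_scalars ::
  "('g, 'm) monoid_scheme \<Rightarrow> 'g topology \<Rightarrow> ('g \<Rightarrow> real^('n + 'n)^('n::finite + 'n)) \<Rightarrow> 'g set"
where
  "lift_scalars G T \<pi> = lifted_identity_component G T \<pi> (unitary_embed ` unit_scalars)"

definition HR ::
  "('g, 'm) monoid_scheme \<Rightarrow> 'g topology \<Rightarrow> ('g \<Rightarrow> real^('n + 'n)^('n::finite + 'n)) \<Rightarrow> 'g set"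
where
  "HR G T \<pi> = lift_SU G T \<pi> <#>\<^bsub>G\<^esub> lift_scalars G T \<pi>"

definition HR_mod_H ::
  "('g, 'm) monoid_scheme \<Rightarrow> 'g topology \<Rightarrow> ('g \<Rightarrow> real^('n + 'n)^('n::finite + 'n)) \<Rightarrow> 'g set monoid"
where
  "HR_mod_H G T \<pi> = (G\<lparr>carrier := HR G T \<pi>\<rparr>) Mod lift_SU G T \<pi>"

definition HR_mod_H_topology ::
  "('g, 'm) monoid_scheme \<Rightarrow> 'g topology \<Rightarrow> ('g \<Rightarrow> real^('n + 'n)^('n::finite + 'n)) \<Rightarrow> 'g set topology"
where
  "HR_mod_H_topology G T \<pi> =
     coset_topology (G\<lparr>carrier := HR G T \<pi>\<rparr>) (subtopology T (HR G T \<pi>)) (lift_SU G T \<pi>)"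

text \<open>\<open>{(i(z), \<iota>(z)\<inverse>) | z \<in> Z(G)}\<close>, where \<open>\<iota>(z)\<close> is the coset of \<open>z\<close>.\<close>

definition antidiagonal_center ::
  "('g, 'm) monoid_scheme \<Rightarrow> 'g topology \<Rightarrow> ('g \<Rightarrow> real^('n + 'n)^('n::finite + 'n)) \<Rightarrow> ('g \<times> 'g set) set"
where
  "antidiagonal_center G T \<pi> =
     (\<lambda>z. (z, inv\<^bsub>HR_mod_H G T \<pi>\<^esub> (lift_SU G T \<pi> #>\<^bsub>G\<^esub> z))) ` group_center G"

definition E_group ::
  "('g, 'm) monoid_scheme \<Rightarrow> 'g topology \<Rightarrow> ('g \<Rightarrow> real^('n + 'n)^('n::finite + 'n)) \<Rightarrow>
   ('g \<times> 'g set) set monoid"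
where
  "E_group G T \<pi> = (G \<times>\<times> HR_mod_H G T \<pi>) Mod antidiagonal_center G T \<pi>"

definition E_topology ::
  "('g, 'm) monoid_scheme \<Rightarrow> 'g topology \<Rightarrow> ('g \<Rightarrow> real^('n + 'n)^('n::finite + 'n)) \<Rightarrow>
   ('g \<times> 'g set) set topology"
where
  "E_topology G T \<pi> =
     coset_topology (G \<times>\<times> HR_mod_H G T \<pi>) (prod_topology T (HR_mod_H_topology G T \<pi>))
       (antidiagonal_center G T \<pi>)"

definition E_class ::
  "('g, 'm) monoid_scheme \<Rightarrow> 'g topology \<Rightarrow> ('g \<Rightarrow> real^('n + 'n)^('n::finite + 'n)) \<Rightarrow>
   'g \<Rightarrow> 'g set \<Rightarrow> ('g \<times> 'g set) set"
where
  "E_class G T \<pi> g q = antidiagonal_center G T \<pi> #>\<^bsub>G \<times>\<times> HR_mod_H G T \<pi>\<^esub> (g, q)"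

text \<open>
  The map \<open>\<eta>\<close> induced on classes by \<open>(g, q) \<mapsto> g Z(G)\<close>: the latter maps each class to a singleton.
\<close>

definition eta :: "('g, 'm) monoid_scheme \<Rightarrow> ('g \<times> 'g set) set \<Rightarrow> 'g set" where
  "eta G X = the_elem ((\<lambda>(g, q). group_center G #>\<^bsub>G\<^esub> g) ` X)"

end

theory Submission
  imports Defs
begin

text \<open>
  Every symplectic matrix is a unitary matrix times a block triangular one: apply Gram--Schmidt to its
  first \<open>n\<close> columns, which span a Lagrangian subspace.  Contracting the triangular factor deforms the
  symplectic group into \<open>U(n)\<close>, and the determinant of the unitary factor lifts to a continuous
  function \<open>\<theta>\<close> from the universal covering group \<open>G\<close> to the reals.  Because Gram--Schmidt commutes with
  unitary matrices, \<open>\<theta> (x y) = \<theta> x + \<theta> y\<close> whenever \<open>x\<close> lies over \<open>U(n)\<close>.  Lifting a deformed path shows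
  that the preimage of \<open>U(n)\<close>, which contains the center, is the group \<open>HR\<close>; and \<open>H\<close> is the kernel of \<open>\<theta>\<close>
  on it.  So \<open>\<theta>\<close> identifies \<open>HR / H\<close> with the reals, \<open>(g, q) \<mapsto> \<theta> g + \<theta> q\<close> is a retraction of the extension
  onto its kernel, and \<open>g \<mapsto> (g, -\<theta> g)\<close> induces the cross section.
\<close>

section \<open>Topological groups and quotients\<close>

text \<open>The covering group is known only through its axioms, so path connectedness, local path
  connectedness, discreteness of the kernel and closedness of points all have to be extracted from
  the covering map and the group law. Pointwise products of paths and quotients of lifts replace the
  general theory of covering spaces. The universal covering group of Sp(2n,R) is perfect, so
  \<open>\<theta>\<close> cannot be a nonzero homomorphism on all of \<open>G\<close>. Additivity
  with the left factor over U(n) suffices, because the cosets in question arise by left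
  multiplication with central elements. The unitary factor of the polar decomposition is equivariant
  as well. Gram--Schmidt has the advantage that its continuity is visible from the recursion, and
  that its triangular factor has a positive diagonal and can be contracted along a straight line. A
  retraction onto U(n) alone would not identify HR. Since HR is built from identity components, the
  full preimage of U(n) could be larger; a deformation that keeps U(n) fixed excludes this.\<close>

lemma continuous_map_locally:
  assumes "\<And>x. x \<in> topspace X \<Longrightarrow> \<exists>U. openin X U \<and> x \<in> U \<and> continuous_map (subtopology X U) Y f"
  shows "continuous_map X Y f"
  unfolding continuous_map_def
proof (intro conjI allI impI)
  show "f \<in> topspace X \<rightarrow> topspace Y"
  proof
    fix x assume x: "x \<in> topspace X"
    then obtain U where "x \<in> U" "continuous_map (subtopology X U) Y f" using assms by blast
    then show "f x \<in> topspace Y"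
      using x continuous_map_image_subset_topspace[of "subtopology X U" Y f] by auto
  qed
  fix V assume V: "openin Y V"
  show "openin X {x \<in> topspace X. f x \<in> V}"
  proof (subst openin_subopen, intro ballI)
    fix x assume x: "x \<in> {x \<in> topspace X. f x \<in> V}"
    then obtain U where U: "openin X U" "x \<in> U" "continuous_map (subtopology X U) Y f"
      using assms[of x] by auto
    let ?W = "{y \<in> topspace (subtopology X U). f y \<in> V}"
    have "openin (subtopology X U) ?W" by (rule openin_continuous_map_preimage[OF U(3) V])
    then have "openin X ?W" using U(1) openin_trans_full by blast
    then show "\<exists>W. openin X W \<and> x \<in> W \<and> W \<subseteq> {x \<in> topspace X. f x \<in> V}"
      using x U by (intro exI[of _ ?W]) auto
  qed
qed

text \<open>A product of quotient maps need not be a quotient map, but a product of open maps is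
  open. This is what makes the multiplication of a quotient group continuous.\<close>

lemma open_map_prod:
  assumes "open_map X X' f" "open_map Y Y' g"
  shows "open_map (prod_topology X Y) (prod_topology X' Y') (\<lambda>(x, y). (f x, g y))"
  unfolding open_map_def
proof (intro allI impI)
  fix W assume W: "openin (prod_topology X Y) W"
  show "openin (prod_topology X' Y') ((\<lambda>(x, y). (f x, g y)) ` W)"
    unfolding openin_prod_topology_alt
  proof (intro allI impI)
    fix a b assume "(a, b) \<in> (\<lambda>(x, y). (f x, g y)) ` W"
    then obtain x y where xy: "(x, y) \<in> W" "a = f x" "b = g y" by auto
    then obtain U V where "openin X U" "openin Y V" "x \<in> U" "y \<in> V" "U \<times> V \<subseteq> W"
      using W unfolding openin_prod_topology_alt by meson
    moreover have "f ` U \<times> g ` V \<subseteq> (\<lambda>(x, y). (f x, g y)) ` W"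
      using \<open>U \<times> V \<subseteq> W\<close> by force
    ultimately show "\<exists>U V. openin X' U \<and> openin Y' V \<and> a \<in> U \<and> b \<in> V \<and>
        U \<times> V \<subseteq> (\<lambda>(x, y). (f x, g y)) ` W"
      using assms xy unfolding open_map_def by (metis image_eqI)
  qed
qed

locale top_group = group G for G :: "('a, 'm) monoid_scheme" (structure) +
  fixes T :: "'a topology"
  assumes topspace_eq [simp]: "topspace T = carrier G"
    and mult_continuous: "continuous_map (prod_topology T T) T (\<lambda>(x, y). x \<otimes> y)"
    and inv_continuous: "continuous_map T T (\<lambda>x. inv x)"

lemma top_group_iff: "top_group G T \<longleftrightarrow> topological_group G T"
  by (auto simp: top_group_def top_group_axioms_def topological_group_def)

context top_group
begin

lemma continuous_map_mult:
  assumes "continuous_map X T f" "continuous_map X T g"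
  shows "continuous_map X T (\<lambda>x. f x \<otimes> g x)"
proof -
  have "continuous_map X (prod_topology T T) (\<lambda>x. (f x, g x))"
    using assms by (simp add: continuous_map_pairwise o_def)
  from continuous_map_compose[OF this mult_continuous] show ?thesis by (simp add: o_def)
qed

lemma continuous_map_inv:
  assumes "continuous_map X T f"
  shows "continuous_map X T (\<lambda>x. inv (f x))"
  using continuous_map_compose[OF assms inv_continuous] by (simp add: o_def)

lemma continuous_map_const_carrier [simp]:
  "a \<in> carrier G \<Longrightarrow> continuous_map X T (\<lambda>_. a)"
  by simp

lemma continuous_map_in_carrier:
  "continuous_map X T f \<Longrightarrow> x \<in> topspace X \<Longrightarrow> f x \<in> carrier G"
  using continuous_map_image_subset_topspace by fastforce

lemma openin_translate:
  assumes "openin T U" "a \<in> carrier G"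
  shows "openin T {x \<in> carrier G. a \<otimes> x \<in> U}"
  using openin_continuous_map_preimage[OF continuous_map_mult[OF continuous_map_const_carrier[OF assms(2)] continuous_map_id] assms(1)]
  by (simp add: id_def)

lemma continuous_map_coset:
  "continuous_map T (coset_topology G T N) (\<lambda>g. N #> g)"
  unfolding coset_topology_def
  by (rule quotient_imp_continuous_map[OF quotient_map_quotient_topology])

lemma quotient_map_coset:
  "quotient_map T (coset_topology G T N) (\<lambda>g. N #> g)"
  unfolding coset_topology_def by (rule quotient_map_quotient_topology)

lemma topspace_coset: "topspace (coset_topology G T N) = carrier (G Mod N)"
  by (simp add: coset_topology_def carrier_FactGroup)

lemma coset_eq_iff:
  assumes "subgroup N G" "x \<in> carrier G" "y \<in> carrier G"
  shows "N #> x = N #> y \<longleftrightarrow> x \<otimes> inv y \<in> N"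
proof
  assume "N #> x = N #> y"
  then have "x \<in> N #> y" using rcos_self[OF assms(2,1)] by simp
  then obtain n where "n \<in> N" "x = n \<otimes> y" by (auto simp: r_coset_def)
  then show "x \<otimes> inv y \<in> N"
    using assms subgroup.mem_carrier[OF assms(1)] by (simp add: m_assoc)
next
  assume n: "x \<otimes> inv y \<in> N"
  have "x = (x \<otimes> inv y) \<otimes> y" using assms by (simp add: m_assoc)
  then have "x \<in> N #> y" using n unfolding r_coset_def by blast
  then show "N #> x = N #> y" using repr_independence[OF _ assms(3,1)] by simp
qed

lemma coset_mult_left:
  assumes "subgroup N G" "n \<in> N" "x \<in> carrier G"
  shows "N #> (n \<otimes> x) = N #> x"
proof -
  have n: "n \<in> carrier G" by (rule subgroup.mem_carrier[OF assms(1,2)])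
  have "n \<otimes> x \<otimes> inv x = n" using n assms(3) by (simp add: m_assoc)
  then show ?thesis
    using assms(2) n coset_eq_iff[OF assms(1) m_closed[OF n assms(3)] assms(3)] assms(3) by simp
qed

text \<open>The preimage of the image of \<open>U\<close> is the union of the translates of
  \<open>U\<close> by elements of \<open>N\<close>.\<close>

lemma open_map_coset:
  assumes N: "subgroup N G"
  shows "open_map T (coset_topology G T N) (\<lambda>g. N #> g)"
  unfolding open_map_def coset_topology_def openin_quotient_topology topspace_eq
proof (intro allI impI conjI)
  fix U assume U: "openin T U"
  have UG: "U \<subseteq> carrier G" using openin_subset[OF U] by simp
  show "(#>) N ` U \<subseteq> (#>) N ` carrier G" using UG by auto
  have *: "{x \<in> carrier G. N #> x \<in> (#>) N ` U} = (\<Union>n\<in>N. {x \<in> carrier G. n \<otimes> x \<in> U})"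
  proof (intro equalityI subsetI)
    fix x assume "x \<in> {x \<in> carrier G. N #> x \<in> (#>) N ` U}"
    then obtain u where x: "x \<in> carrier G" and u: "u \<in> U" and eq: "N #> u = N #> x" by auto
    have uG: "u \<in> carrier G" using u UG by blast
    have "u \<otimes> inv x \<in> N" using eq coset_eq_iff[OF N uG x] by simp
    moreover have "(u \<otimes> inv x) \<otimes> x = u" using uG x by (simp add: m_assoc)
    ultimately show "x \<in> (\<Union>n\<in>N. {x \<in> carrier G. n \<otimes> x \<in> U})"
      using x u by fastforce
  next
    fix x assume "x \<in> (\<Union>n\<in>N. {x \<in> carrier G. n \<otimes> x \<in> U})"
    then obtain n where "n \<in> N" "x \<in> carrier G" "n \<otimes> x \<in> U" by auto
    then show "x \<in> {x \<in> carrier G. N #> x \<in> (#>) N ` U}"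
      using coset_mult_left[OF N] by (metis (mono_tags, lifting) image_eqI mem_Collect_eq)
  qed
  show "openin T {x \<in> carrier G. N #> x \<in> (#>) N ` U}"
    unfolding * using N U
    by (intro openin_Union) (auto intro!: openin_translate simp: subgroup.mem_carrier)
qed

text \<open>Every map induced on cosets below, \<open>eta\<close> among them, is encoded as
  \<open>the_elem\<close> of the image of a coset; invariance under \<open>N\<close> makes that
  image a singleton.\<close>

lemma the_elem_coset:
  assumes N: "subgroup N G" and x: "x \<in> carrier G"
    and f: "\<And>n. n \<in> N \<Longrightarrow> f (n \<otimes> x) = f x"
  shows "the_elem (f ` (N #> x)) = f x"
proof -
  have "f ` (N #> x) = (\<lambda>n. f (n \<otimes> x)) ` N" by (auto simp: r_coset_def)
  also have "\<dots> = (\<lambda>n. f x) ` N" using f by (rule image_cong[OF refl])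
  also have "\<dots> = {f x}" using subgroup.one_closed[OF N] by blast
  finally have "f ` (N #> x) = {f x}" .
  then show ?thesis by simp
qed

lemma continuous_map_the_elem_coset:
  assumes N: "subgroup N G" and f: "continuous_map T Y f"
    and inv: "\<And>n x. n \<in> N \<Longrightarrow> x \<in> carrier G \<Longrightarrow> f (n \<otimes> x) = f x"
  shows "continuous_map (coset_topology G T N) Y (\<lambda>X. the_elem (f ` X))"
proof (rule continuous_compose_quotient_map[OF quotient_map_coset])
  show "continuous_map T Y ((\<lambda>X. the_elem (f ` X)) \<circ> (#>) N)"
    using f by (rule continuous_map_eq) (simp add: the_elem_coset[OF N] inv)
qed

lemma top_group_Mod:
  assumes N: "N \<lhd> G"
  shows "top_group (G Mod N) (coset_topology G T N)"
proof -
  interpret N: normal N G by (rule N)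
  interpret Q: group "G Mod N" by (rule N.factorgroup_is_group)
  let ?Q = "coset_topology G T N"
  let ?q = "\<lambda>g. N #> g"
  have sub: "subgroup N G" by (rule N.is_subgroup)
  show ?thesis
  proof
    show "topspace ?Q = carrier (G Mod N)" by (rule topspace_coset)
  next
    have qq: "quotient_map (prod_topology T T) (prod_topology ?Q ?Q) (\<lambda>(x, y). (?q x, ?q y))"
    proof (rule continuous_open_imp_quotient_map)
      show "continuous_map (prod_topology T T) (prod_topology ?Q ?Q) (\<lambda>(x, y). (?q x, ?q y))"
        unfolding case_prod_unfold continuous_map_pairwise o_def fst_conv snd_conv
        by (intro conjI continuous_map_compose[OF continuous_map_fst continuous_map_coset, unfolded o_def]
          continuous_map_compose[OF continuous_map_snd continuous_map_coset, unfolded o_def])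
      show "open_map (prod_topology T T) (prod_topology ?Q ?Q) (\<lambda>(x, y). (?q x, ?q y))"
        by (intro open_map_prod open_map_coset sub)
      show "(\<lambda>(x, y). (?q x, ?q y)) ` topspace (prod_topology T T) = topspace (prod_topology ?Q ?Q)"
        by (auto simp: topspace_coset carrier_FactGroup image_iff)
    qed
    show "continuous_map (prod_topology ?Q ?Q) ?Q (\<lambda>(x, y). x \<otimes>\<^bsub>G Mod N\<^esub> y)"
    proof (rule continuous_compose_quotient_map[OF qq])
      show "continuous_map (prod_topology T T) ?Q
          ((\<lambda>(x, y). x \<otimes>\<^bsub>G Mod N\<^esub> y) \<circ> (\<lambda>(x, y). (?q x, ?q y)))"
        using continuous_map_compose[OF mult_continuous continuous_map_coset]
        by (rule continuous_map_eq) (auto simp: N.rcos_sum)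
    qed
  next
    show "continuous_map ?Q ?Q (\<lambda>x. inv\<^bsub>G Mod N\<^esub> x)"
    proof (rule continuous_compose_quotient_map[OF quotient_map_coset])
      show "continuous_map T ?Q ((\<lambda>x. inv\<^bsub>G Mod N\<^esub> x) \<circ> ?q)"
        using continuous_map_compose[OF inv_continuous continuous_map_coset]
        by (rule continuous_map_eq)
          (auto simp: N.inv_FactGroup carrier_FactGroup N.rcos_inv)
    qed
  qed
qed

lemma top_group_subgroup:
  assumes K: "subgroup K G"
  shows "top_group (G\<lparr>carrier := K\<rparr>) (subtopology T K)"
proof -
  interpret K: group "G\<lparr>carrier := K\<rparr>" by (rule subgroup.subgroup_is_group[OF K is_group])
  have KG: "K \<subseteq> carrier G" by (rule subgroup.subset[OF K])
  show ?thesis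
  proof
    show "topspace (subtopology T K) = carrier (G\<lparr>carrier := K\<rparr>)" using KG by auto
    have "continuous_map (prod_topology (subtopology T K) (subtopology T K)) T (\<lambda>(x, y). x \<otimes> y)"
      using continuous_map_from_subtopology[OF mult_continuous, of "K \<times> K"]
      by (simp add: subtopology_Times)
    then show "continuous_map (prod_topology (subtopology T K) (subtopology T K)) (subtopology T K)
        (\<lambda>(x, y). x \<otimes>\<^bsub>G\<lparr>carrier := K\<rparr>\<^esub> y)"
      using subgroup.m_closed[OF K] by (auto simp: continuous_map_in_subtopology)
    have "continuous_map (subtopology T K) (subtopology T K) (\<lambda>x. inv x)"
      using continuous_map_from_subtopology[OF inv_continuous, of K] subgroup.m_inv_closed[OF K]
      by (auto simp: continuous_map_in_subtopology)
    then show "continuous_map (subtopology T K) (subtopology T K) (\<lambda>x. inv\<^bsub>G\<lparr>carrier := K\<rparr>\<^esub> x)"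
      by (rule continuous_map_eq) (use K in simp)
  qed
qed

end

section \<open>Identity components of subgroups\<close>

context top_group
begin

abbreviation "identity_component S \<equiv> connected_component_of_set (subtopology T S) \<one>"

lemma identity_component_maximal:
  assumes "connectedin T C" "\<one> \<in> C" "C \<subseteq> S"
  shows "C \<subseteq> identity_component S"
  using assms by (intro connected_component_of_maximal) (simp_all add: connectedin_subtopology)

lemma identity_component_subset: "identity_component S \<subseteq> carrier G \<inter> S"
  using connected_component_of_subset_topspace[of "subtopology T S" \<one>] by simp

lemma connectedin_identity_component: "connectedin T (identity_component S)"
  using connectedin_connected_component_of[of "subtopology T S" \<one>] by (simp add: connectedin_subtopology)

lemma one_in_identity_component: "\<one> \<in> S \<Longrightarrow> \<one> \<in> identity_component S"
  by (simp add: connected_component_of_refl)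

text \<open>Translating the component by the inverse of one of its points gives a connected subset
  of \<open>S\<close> that contains \<open>\<one>\<close>.\<close>

lemma identity_component_subgroup:
  assumes S: "subgroup S G"
  shows "subgroup (identity_component S) G"
proof -
  let ?H = "identity_component S"
  have HS: "x \<in> S" if "x \<in> ?H" for x using identity_component_subset[of S] that by blast
  have one: "\<one> \<in> ?H" by (rule one_in_identity_component[OF subgroup.one_closed[OF S]])
  \<comment> \<open>This one closure property yields inverses with \<open>y = \<one>\<close>, and
    then products by inserting \<open>inv x\<close> for \<open>x\<close>.\<close>
  have translate: "inv x \<otimes> y \<in> ?H" if x: "x \<in> ?H" and y: "y \<in> ?H" for x y
  proof -
    have xG: "x \<in> carrier G" using subgroup.mem_carrier[OF S HS[OF x]] .
    have "continuous_map T T (\<lambda>y. inv x \<otimes> y)"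
      using continuous_map_mult[OF continuous_map_const_carrier continuous_map_id, of "inv x"] xG
      by (simp add: id_def)
    then have "connectedin T ((\<lambda>y. inv x \<otimes> y) ` ?H)"
      by (rule connectedin_continuous_map_image[OF _ connectedin_identity_component])
    moreover have "\<one> \<in> (\<lambda>y. inv x \<otimes> y) ` ?H" using x xG by (intro image_eqI[of _ _ x]) simp_all
    moreover have "(\<lambda>y. inv x \<otimes> y) ` ?H \<subseteq> S"
      using HS[OF x] HS subgroup.m_closed[OF S] subgroup.m_inv_closed[OF S] by blast
    ultimately have "(\<lambda>y. inv x \<otimes> y) ` ?H \<subseteq> ?H" by (rule identity_component_maximal)
    then show ?thesis using y by blast
  qed
  show ?thesis
  proof
    show "?H \<subseteq> carrier G" using identity_component_subset[of S] by blast
    show inv: "inv x \<in> ?H" if "x \<in> ?H" for x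
      using translate[OF that one] subgroup.mem_carrier[OF S HS[OF that]] by simp
    show "x \<otimes> y \<in> ?H" if "x \<in> ?H" "y \<in> ?H" for x y
      using translate[OF inv[OF that(1)] that(2)] subgroup.mem_carrier[OF S HS[OF that(1)]] by simp
  qed (rule one)
qed

text \<open>Stated for a single \<open>x\<close> that maps \<open>S\<close> into itself by
  conjugation, because it will be applied to the preimage of SU(n), which is handled only under
  conjugation by elements over unit scalars.\<close>

lemma identity_component_conjugate:
  assumes x: "x \<in> carrier G" and S: "\<And>y. y \<in> S \<Longrightarrow> x \<otimes> y \<otimes> inv x \<in> S"
    and one: "\<one> \<in> S" and y: "y \<in> identity_component S"
  shows "x \<otimes> y \<otimes> inv x \<in> identity_component S"
proof -
  let ?H = "identity_component S" and ?c = "\<lambda>y. x \<otimes> y \<otimes> inv x"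
  have "continuous_map T T (\<lambda>y. y)" using continuous_map_id[of T] by (simp add: id_def)
  then have "continuous_map T T ?c"
    using x by (intro continuous_map_mult) auto
  then have "connectedin T (?c ` ?H)"
    by (rule connectedin_continuous_map_image[OF _ connectedin_identity_component])
  moreover have "\<one> \<in> ?c ` ?H"
    using x one_in_identity_component[OF one] by (intro image_eqI[of _ _ \<one>]) simp_all
  moreover have "?c ` ?H \<subseteq> S" using identity_component_subset[of S] S by blast
  ultimately have "?c ` ?H \<subseteq> ?H" by (rule identity_component_maximal)
  then show ?thesis using y by blast
qed

end

lemma top_group_DirProd:
  assumes "top_group G T" "top_group H S"
  shows "top_group (G \<times>\<times> H) (prod_topology T S)"
proof -
  interpret G: top_group G T by fact
  interpret H: top_group H S by fact
  interpret P: group "G \<times>\<times> H" by (rule DirProd_group) (rule G.is_group H.is_group)+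
  let ?P = "prod_topology T S"
  show ?thesis
  proof
    show "topspace ?P = carrier (G \<times>\<times> H)" by simp
    have 1: "continuous_map (prod_topology ?P ?P) T (\<lambda>x. fst (fst x) \<otimes>\<^bsub>G\<^esub> fst (snd x))"
      by (intro G.continuous_map_mult continuous_map_fst_of[unfolded o_def, OF continuous_map_fst]
        continuous_map_fst_of[unfolded o_def, OF continuous_map_snd])
    have 2: "continuous_map (prod_topology ?P ?P) S (\<lambda>x. snd (fst x) \<otimes>\<^bsub>H\<^esub> snd (snd x))"
      by (intro H.continuous_map_mult continuous_map_snd_of[unfolded o_def, OF continuous_map_fst]
        continuous_map_snd_of[unfolded o_def, OF continuous_map_snd])
    show "continuous_map (prod_topology ?P ?P) ?P (\<lambda>(x, y). x \<otimes>\<^bsub>G \<times>\<times> H\<^esub> y)"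
      using 1 2 by (simp add: case_prod_unfold mult_DirProd' continuous_map_pairwise o_def)
    have "continuous_map ?P ?P (\<lambda>x. (inv\<^bsub>G\<^esub> (fst x), inv\<^bsub>H\<^esub> (snd x)))"
      by (simp add: continuous_map_pairwise o_def G.continuous_map_inv H.continuous_map_inv
        continuous_map_fst continuous_map_snd)
    then show "continuous_map ?P ?P (\<lambda>x. inv\<^bsub>G \<times>\<times> H\<^esub> x)"
      by (rule continuous_map_eq) (auto simp: inv_DirProd G.is_group H.is_group)
  qed
qed

lemma top_group_real: "top_group real_group euclideanreal"
proof -
  interpret group real_group
    by (rule groupI) (auto simp: real_group_def intro: exI[of _ "- x" for x])
  have inv: "inv\<^bsub>real_group\<^esub> x = - x" for x
    by (rule inv_equality) (auto simp: real_group_def)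
  show ?thesis
  proof
    show "topspace euclideanreal = carrier real_group" by (simp add: real_group_def)
    show "continuous_map (prod_topology euclideanreal euclideanreal) euclideanreal
        (\<lambda>(x, y). x \<otimes>\<^bsub>real_group\<^esub> y)"
      by (auto simp: real_group_def case_prod_unfold intro!: continuous_intros)
    show "continuous_map euclideanreal euclideanreal (\<lambda>x. inv\<^bsub>real_group\<^esub> x)"
      by (auto simp: inv intro!: continuous_intros)
  qed
qed

section \<open>The extension obtained from a real-valued function\<close>

lemma group_centerI:
  assumes "z \<in> carrier G" "\<And>g. g \<in> carrier G \<Longrightarrow> z \<otimes>\<^bsub>G\<^esub> g = g \<otimes>\<^bsub>G\<^esub> z"
  shows "z \<in> group_center G"
  unfolding group_center_def using assms by blast

lemma group_centerD:
  assumes "z \<in> group_center G"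
  shows group_center_carrier: "z \<in> carrier G"
    and group_center_comm: "g \<in> carrier G \<Longrightarrow> z \<otimes>\<^bsub>G\<^esub> g = g \<otimes>\<^bsub>G\<^esub> z"
  using assms unfolding group_center_def by blast+

lemma group_center_subgroup:
  assumes "group G"
  shows "subgroup (group_center G) G"
proof -
  interpret group G by fact
  show ?thesis
  proof
    show "group_center G \<subseteq> carrier G" by (auto dest: group_centerD)
    show "\<one>\<^bsub>G\<^esub> \<in> group_center G" by (rule group_centerI) simp_all
  next
    fix x y assume x: "x \<in> group_center G" and y: "y \<in> group_center G"
    have "x \<otimes>\<^bsub>G\<^esub> y \<otimes>\<^bsub>G\<^esub> g = g \<otimes>\<^bsub>G\<^esub> (x \<otimes>\<^bsub>G\<^esub> y)" if g: "g \<in> carrier G" for g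
    proof -
      have xG: "x \<in> carrier G" and yG: "y \<in> carrier G" and xg: "x \<otimes>\<^bsub>G\<^esub> g = g \<otimes>\<^bsub>G\<^esub> x"
        and yg: "y \<otimes>\<^bsub>G\<^esub> g = g \<otimes>\<^bsub>G\<^esub> y" using group_centerD[OF x] group_centerD[OF y] g by blast+
      have "x \<otimes>\<^bsub>G\<^esub> y \<otimes>\<^bsub>G\<^esub> g = x \<otimes>\<^bsub>G\<^esub> g \<otimes>\<^bsub>G\<^esub> y"
        using xG yG g yg by (simp add: m_assoc)
      also have "\<dots> = g \<otimes>\<^bsub>G\<^esub> (x \<otimes>\<^bsub>G\<^esub> y)" unfolding xg using xG yG g by (rule_tac m_assoc)
      finally show ?thesis .
    qed
    then show "x \<otimes>\<^bsub>G\<^esub> y \<in> group_center G"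
      by (intro group_centerI m_closed group_centerD(1)[OF x] group_centerD(1)[OF y])
  next
    fix x assume x: "x \<in> group_center G"
    have "inv\<^bsub>G\<^esub> x \<otimes>\<^bsub>G\<^esub> g = g \<otimes>\<^bsub>G\<^esub> inv\<^bsub>G\<^esub> x" if g: "g \<in> carrier G" for g
    proof -
      have xG: "x \<in> carrier G" and xg: "x \<otimes>\<^bsub>G\<^esub> g = g \<otimes>\<^bsub>G\<^esub> x"
        using group_centerD[OF x] g by blast+
      have "inv\<^bsub>G\<^esub> x \<otimes>\<^bsub>G\<^esub> g = inv\<^bsub>G\<^esub> x \<otimes>\<^bsub>G\<^esub> (g \<otimes>\<^bsub>G\<^esub> x) \<otimes>\<^bsub>G\<^esub> inv\<^bsub>G\<^esub> x"
        using xG g by (simp add: m_assoc)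
      also have "\<dots> = g \<otimes>\<^bsub>G\<^esub> inv\<^bsub>G\<^esub> x"
        unfolding xg[symmetric] using xG g by (simp add: m_assoc[symmetric])
      finally show ?thesis .
    qed
    then show "inv\<^bsub>G\<^esub> x \<in> group_center G"
      by (intro group_centerI inv_closed group_centerD(1)[OF x])
  qed
qed

lemma (in group) normalI_central:
  assumes "subgroup N G" "N \<subseteq> group_center G"
  shows "N \<lhd> G"
  unfolding normal_inv_iff
proof (intro conjI ballI assms(1))
  fix x h assume x: "x \<in> carrier G" and h: "h \<in> N"
  have hG: "h \<in> carrier G" and comm: "h \<otimes> x = x \<otimes> h"
    using group_centerD[of h G] h assms(2) x by blast+
  have "x \<otimes> h \<otimes> inv x = h" unfolding comm[symmetric] using x hG by (simp add: m_assoc)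
  then show "x \<otimes> h \<otimes> inv x \<in> N" using h by simp
qed

text \<open>The center is the intersection, over all \<open>g\<close>, of the preimages of the
  closed point \<open>\<one>\<close> under the continuous maps sending \<open>z\<close> to
  \<open>z \<otimes> g \<otimes> inv (g \<otimes> z)\<close>.\<close>

lemma (in top_group) closedin_center:
  assumes "closedin T {\<one>}"
  shows "closedin T (group_center G)"
proof -
  let ?C = "\<lambda>g. {z \<in> carrier G. z \<otimes> g \<otimes> inv (g \<otimes> z) \<in> {\<one>}}"
  have "closedin T (?C g)" if "g \<in> carrier G" for g
  proof -
    have "continuous_map T T (\<lambda>z. z \<otimes> g \<otimes> inv (g \<otimes> z))"
      using that continuous_map_id
      by (intro continuous_map_mult continuous_map_inv) (auto simp: id_def)
    from closedin_continuous_map_preimage[OF this assms] show ?thesis by simp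
  qed
  then have "closedin T (\<Inter>g\<in>carrier G. ?C g)"
    by (intro closedin_Inter) auto
  also have "(\<Inter>g\<in>carrier G. ?C g) = group_center G"
  proof -
    have "z \<otimes> g \<otimes> inv (g \<otimes> z) = \<one> \<longleftrightarrow> z \<otimes> g = g \<otimes> z"
      if "z \<in> carrier G" "g \<in> carrier G" for z g
      using inv_solve_right'[of "\<one>" "z \<otimes> g" "g \<otimes> z"] that by simp
    then have "(\<Inter>g\<in>carrier G. ?C g) = {z \<in> carrier G. \<forall>g\<in>carrier G. z \<otimes> g = g \<otimes> z}"
      using one_closed by blast
    then show ?thesis unfolding group_center_def .
  qed
  finally show ?thesis .
qed

text \<open>The part of the argument that does not see matrices. It will be used with HR for
  \<open>K\<close>, the lifted SU(n) for \<open>H\<close>, and for \<open>r\<close> the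
  one-parameter group over the unit scalars, rescaled to be a section of \<open>\<theta>\<close>. In
  \<open>\<theta>_mult\<close> only the left factor is restricted to \<open>K\<close>: that is all
  the additivity available, and by \<open>center_sub\<close> it covers left multiplication by
  central elements.\<close>

locale real_valued_on_subgroup = top_group G T
  for G :: "('a, 'm) monoid_scheme" (structure) and T +
  fixes K H :: "'a set" and \<theta> :: "'a \<Rightarrow> real" and r :: "real \<Rightarrow> 'a"
  assumes K: "subgroup K G"
    and H_eq: "H = {x \<in> K. \<theta> x = 0}"
    and \<theta>_cont: "continuous_map T euclideanreal \<theta>"
    and \<theta>_mult: "\<And>x y. x \<in> K \<Longrightarrow> y \<in> carrier G \<Longrightarrow> \<theta> (x \<otimes> y) = \<theta> x + \<theta> y"
    and r_cont: "continuous_map euclideanreal T r"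
    and r_in: "\<And>t. r t \<in> K"
    and \<theta>_r: "\<And>t. \<theta> (r t) = t"
    and center_sub: "group_center G \<subseteq> K"
    and closed_one: "closedin T {\<one>}"
begin

text \<open>These terms are written as the definitions of \<open>HR_mod_H\<close>,
  \<open>E_group\<close> and their topologies unfold, with \<open>K\<close> for HR and
  \<open>H\<close> for the lifted SU(n), so that the results carry over by unfolding.\<close>

abbreviation "GK \<equiv> G\<lparr>carrier := K\<rparr>"
abbreviation "Q \<equiv> GK Mod H"
abbreviation "TQ \<equiv> coset_topology GK (subtopology T K) H"
abbreviation "D \<equiv> (\<lambda>z. (z, inv\<^bsub>Q\<^esub> (H #> z))) ` group_center G"
abbreviation "E \<equiv> (G \<times>\<times> Q) Mod D"
abbreviation "TE \<equiv> coset_topology (G \<times>\<times> Q) (prod_topology T TQ) D"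
abbreviation "GZ \<equiv> G Mod group_center G"
abbreviation "TGZ \<equiv> coset_topology G T (group_center G)"
abbreviation "cls g q \<equiv> D #>\<^bsub>G \<times>\<times> Q\<^esub> (g, q)"

text \<open>\<open>\<psi>\<close> and \<open>\<theta>q\<close> will be mutually inverse
  identifications of the reals with \<open>Q\<close>; \<open>\<tau>\<close> will be a left inverse
  of the embedding of the reals into \<open>E\<close>.\<close>

definition "\<psi> t = H #> r t"
definition "\<theta>q X = the_elem (\<theta> ` X)"
definition "\<tau> X = the_elem ((\<lambda>(g, q). \<theta> g + \<theta>q q) ` X)"

lemma KG: "x \<in> K \<Longrightarrow> x \<in> carrier G" by (rule subgroup.mem_carrier[OF K])

sublocale GK: top_group GK "subtopology T K" by (rule top_group_subgroup[OF K])

sublocale \<theta>: group_hom GK real_group \<theta>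
  using top_group_real
  by (auto simp: group_hom_def group_hom_axioms_def hom_def GK.is_group top_group_def KG \<theta>_mult)
    (simp_all add: real_group_def)

lemma H_kernel: "H = kernel GK real_group \<theta>"
  by (simp add: H_eq kernel_def real_group_def)

lemma H_normal: "H \<lhd> GK" unfolding H_kernel by (rule \<theta>.normal_kernel)

sublocale Q: top_group Q TQ by (rule GK.top_group_Mod[OF H_normal])

lemma \<theta>q_coset: "x \<in> K \<Longrightarrow> \<theta>q (H #> x) = \<theta> x"
  unfolding \<theta>q_def using GK.the_elem_coset[OF normal_imp_subgroup[OF H_normal], of x \<theta>]
  by (simp add: H_eq \<theta>_mult KG)

lemma coset_eq: "x \<in> K \<Longrightarrow> y \<in> K \<Longrightarrow> \<theta> x = \<theta> y \<Longrightarrow> H #> x = H #> y"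
  using \<theta>.FactGroup_subset[of x y] \<theta>.FactGroup_subset[of y x] unfolding H_kernel by auto

lemma \<psi>_in: "\<psi> t \<in> carrier Q" using r_in by (auto simp: \<psi>_def carrier_FactGroup)

lemma \<theta>q_\<psi>: "\<theta>q (\<psi> t) = t" by (simp add: \<psi>_def \<theta>q_coset r_in \<theta>_r)

lemma \<psi>_\<theta>q: "X \<in> carrier Q \<Longrightarrow> \<psi> (\<theta>q X) = X"
proof -
  assume "X \<in> carrier Q"
  then obtain x where "x \<in> K" "X = H #> x" by (auto simp: carrier_FactGroup)
  then show ?thesis using coset_eq[OF r_in, of x "\<theta> x"] by (simp add: \<psi>_def \<theta>q_coset \<theta>_r)
qed

lemma \<theta>q_iso: "\<theta>q \<in> iso Q real_group"
proof -
  have "\<theta> ` carrier GK = carrier real_group"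
    using surjI[of \<theta> r, OF \<theta>_r] r_in \<theta>_r by (auto simp: real_group_def) (metis image_eqI)
  from \<theta>.FactGroup_iso_set[OF this] show ?thesis by (simp add: H_kernel \<theta>q_def[abs_def])
qed

lemma \<theta>q_mult: "X \<in> carrier Q \<Longrightarrow> Y \<in> carrier Q \<Longrightarrow> \<theta>q (X <#> Y) = \<theta>q X + \<theta>q Y"
  using \<theta>q_iso by (auto simp: iso_def hom_def real_group_def)

text \<open>The map \<open>r\<close> is given only as a continuous section of
  \<open>\<theta>\<close>, so additivity of \<open>\<psi>\<close> is transported from its inverse
  \<open>\<theta>q\<close>.\<close>

lemma \<psi>_iso: "\<psi> \<in> iso real_group Q"
proof (rule isoI)
  show "bij_betw \<psi> (carrier real_group) (carrier Q)"
    by (rule bij_betw_byWitness[where f' = \<theta>q]) (auto simp: \<theta>q_\<psi> \<psi>_\<theta>q \<psi>_in real_group_def)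
  show "\<psi> \<in> hom real_group Q"
  proof (rule homI)
    fix s t
    have "\<psi> (s + t) = \<psi> (\<theta>q (\<psi> s <#> \<psi> t))" by (simp add: \<theta>q_mult \<psi>_in \<theta>q_\<psi>)
    also have "\<dots> = \<psi> s <#> \<psi> t" using Q.m_closed[OF \<psi>_in[of s] \<psi>_in[of t]] by (simp add: \<psi>_\<theta>q)
    finally show "\<psi> (s \<otimes>\<^bsub>real_group\<^esub> t) = \<psi> s \<otimes>\<^bsub>Q\<^esub> \<psi> t" by (simp add: real_group_def)
  qed (rule \<psi>_in)
qed

lemma \<psi>_add: "\<psi> (s + t) = \<psi> s <#> \<psi> t"
  using \<psi>_iso by (auto simp: iso_def hom_def real_group_def)

lemma \<psi>_cont: "continuous_map euclideanreal TQ \<psi>"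
proof -
  have "continuous_map euclideanreal (subtopology T K) r"
    using r_cont r_in by (auto simp: continuous_map_in_subtopology)
  from continuous_map_compose[OF this GK.continuous_map_coset] show ?thesis
    by (simp add: o_def \<psi>_def[abs_def])
qed

lemma \<theta>q_cont: "continuous_map TQ euclideanreal \<theta>q"
proof (rule continuous_compose_quotient_map[OF GK.quotient_map_coset])
  show "continuous_map (subtopology T K) euclideanreal (\<theta>q \<circ> (#>\<^bsub>GK\<^esub>) H)"
    using continuous_map_from_subtopology[OF \<theta>_cont, of K]
    by (rule continuous_map_eq) (simp add: \<theta>q_coset)
qed

lemma \<psi>_topological_group_iso: "topological_group_iso real_group euclideanreal Q TQ \<psi>"
proof -
  have "homeomorphic_maps euclideanreal TQ \<psi> \<theta>q"
    by (simp add: homeomorphic_maps_def \<psi>_cont \<theta>q_cont \<theta>q_\<psi> \<psi>_\<theta>q)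
  then show ?thesis
    using \<psi>_iso top_group_real Q.top_group_axioms
    by (auto simp: topological_group_iso_def top_group_iff[symmetric] homeomorphic_maps_map
      top_group_def Q.is_group)
qed

section \<open>The product modulo the antidiagonal center, and the maps on it\<close>

sublocale P: top_group "G \<times>\<times> Q" "prod_topology T TQ"
  by (rule top_group_DirProd) (rule top_group_axioms Q.top_group_axioms)+

sublocale Z: subgroup "group_center G" G by (rule group_center_subgroup[OF is_group])

lemma Q_comm: "X \<in> carrier Q \<Longrightarrow> Y \<in> carrier Q \<Longrightarrow> X <#> Y = Y <#> X"
  by (metis \<psi>_\<theta>q \<psi>_add add.commute)

lemma center_coset_in: "z \<in> group_center G \<Longrightarrow> H #> z \<in> carrier Q"
  using center_sub by (auto simp: carrier_FactGroup)

lemma coset_mult: "x \<in> K \<Longrightarrow> y \<in> K \<Longrightarrow> H #> (x \<otimes> y) = (H #> x) <#> (H #> y)"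
  using normal.rcos_sum[OF H_normal, of x y] by simp

text \<open>Since \<open>Q\<close> is commutative, inverting the coset of \<open>z\<close> is
  multiplicative in \<open>z\<close>; hence \<open>D\<close> is the image of the center under a
  homomorphism.\<close>

lemma D_subgroup: "subgroup D (G \<times>\<times> Q)"
proof
  show "D \<subseteq> carrier (G \<times>\<times> Q)" using center_coset_in Z.subset by auto
  have "\<one> \<in> K" using subgroup.one_closed[OF K] .
  then have "H #> \<one> = \<one>\<^bsub>Q\<^esub>" using H_normal subgroup.subset[OF normal_imp_subgroup[OF H_normal]] KG
    by (simp add: coset_mult_one subset_iff)
  then show "\<one>\<^bsub>G \<times>\<times> Q\<^esub> \<in> D" using Z.one_closed Q.inv_one by (force simp: image_iff)
next
  fix x y assume "x \<in> D" "y \<in> D"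
  then obtain z w where z: "z \<in> group_center G" "x = (z, inv\<^bsub>Q\<^esub> (H #> z))"
    and w: "w \<in> group_center G" "y = (w, inv\<^bsub>Q\<^esub> (H #> w))" by auto
  have "inv\<^bsub>Q\<^esub> (H #> (z \<otimes> w)) = inv\<^bsub>Q\<^esub> (H #> z) <#> inv\<^bsub>Q\<^esub> (H #> w)"
    using z w center_sub Q_comm[OF center_coset_in[OF z(1)] center_coset_in[OF w(1)]]
      Q.inv_mult_group[OF center_coset_in[OF w(1)] center_coset_in[OF z(1)]]
    by (simp add: coset_mult subset_iff)
  then show "x \<otimes>\<^bsub>G \<times>\<times> Q\<^esub> y \<in> D" using z w by (auto intro!: image_eqI[of _ _ "z \<otimes> w"])
next
  fix x assume "x \<in> D"
  then obtain z where z: "z \<in> group_center G" "x = (z, inv\<^bsub>Q\<^esub> (H #> z))" by auto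
  have zK: "z \<in> K" and izK: "inv z \<in> K" using z center_sub subgroup.m_inv_closed[OF K] by auto
  have "(H #> inv z) <#> (H #> z) = \<one>\<^bsub>Q\<^esub>"
    using coset_mult[OF izK zK] KG[OF zK] subgroup.subset[OF normal_imp_subgroup[OF H_normal]] KG
    by (simp add: coset_mult_one subset_iff)
  then have "inv\<^bsub>Q\<^esub> (H #> z) = H #> inv z"
    using Q.inv_equality center_coset_in z Z.m_inv_closed by simp
  then show "inv\<^bsub>G \<times>\<times> Q\<^esub> x \<in> D"
    using z center_coset_in Z.mem_carrier
    by (auto simp: inv_DirProd[OF is_group Q.is_group] intro!: image_eqI[of _ _ "inv z"])
qed

text \<open>Both coordinates of an element of \<open>D\<close> are central, the second because
  \<open>Q\<close> is commutative.\<close>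

lemma D_normal: "D \<lhd> G \<times>\<times> Q"
proof (rule P.normalI_central[OF D_subgroup])
  show "D \<subseteq> group_center (G \<times>\<times> Q)"
  proof
    fix d assume "d \<in> D"
    then obtain z where "z \<in> group_center G" "d = (z, inv\<^bsub>Q\<^esub> (H #> z))" by auto
    then show "d \<in> group_center (G \<times>\<times> Q)"
      using group_centerD[of z G] center_coset_in[of z] Q_comm by (intro group_centerI) auto
  qed
qed

sublocale E: top_group E TE by (rule P.top_group_Mod[OF D_normal])

sublocale GZ: top_group GZ TGZ
  by (rule top_group_Mod[OF normalI_central[OF Z.subgroup_axioms subset_refl]])

lemma \<theta>_D: "z \<in> group_center G \<Longrightarrow> \<theta>q (inv\<^bsub>Q\<^esub> (H #> z)) = - \<theta> z"
proof -
  assume z: "z \<in> group_center G"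
  have "\<theta>q (inv\<^bsub>Q\<^esub> (H #> z) <#> (H #> z)) = \<theta>q (\<psi> 0)"
  proof -
    have "\<psi> 0 = \<one>\<^bsub>Q\<^esub>" using hom_one[of \<psi> real_group Q] \<psi>_iso top_group_real
      by (simp add: iso_def top_group_def Q.is_group) (simp add: real_group_def)
    then show ?thesis using Q.l_inv[OF center_coset_in[OF z]] by simp
  qed
  then have "\<theta>q (inv\<^bsub>Q\<^esub> (H #> z)) + \<theta>q (H #> z) = 0"
    using center_coset_in[OF z] by (simp add: \<theta>q_mult \<theta>q_\<psi>)
  moreover have "\<theta>q (H #> z) = \<theta> z" using z center_sub by (auto intro: \<theta>q_coset)
  ultimately show ?thesis by simp
qed

lemma carrier_E: "carrier E = {cls g q | g q. g \<in> carrier G \<and> q \<in> carrier Q}"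
  by (auto simp: carrier_FactGroup)

lemma cls_in: "g \<in> carrier G \<Longrightarrow> q \<in> carrier Q \<Longrightarrow> cls g q \<in> carrier E"
  by (auto simp: carrier_FactGroup)

lemma cls_mult:
  assumes "g \<in> carrier G" "q \<in> carrier Q" "g' \<in> carrier G" "q' \<in> carrier Q"
  shows "cls g q \<otimes>\<^bsub>E\<^esub> cls g' q' = cls (g \<otimes> g') (q <#> q')"
  using normal.rcos_sum[OF D_normal, of "(g, q)" "(g', q')"] assms by simp

lemma cls_shift:
  assumes "z \<in> group_center G" "g \<in> carrier G" "q \<in> carrier Q"
  shows "cls (z \<otimes> g) (inv\<^bsub>Q\<^esub> (H #> z) <#> q) = cls g q"
  using P.coset_mult_left[OF D_subgroup, of "(z, inv\<^bsub>Q\<^esub> (H #> z))" "(g, q)"] assms by simp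

text \<open>A central factor \<open>z\<close> adds \<open>\<theta> z\<close> in the first coordinate
  and subtracts it in the second.\<close>

lemma \<tau>_D:
  assumes "d \<in> D" "x \<in> carrier (G \<times>\<times> Q)"
  shows "(\<lambda>(g, q). \<theta> g + \<theta>q q) (d \<otimes>\<^bsub>G \<times>\<times> Q\<^esub> x) = (\<lambda>(g, q). \<theta> g + \<theta>q q) x"
proof -
  obtain z where z: "z \<in> group_center G" "d = (z, inv\<^bsub>Q\<^esub> (H #> z))" using assms by auto
  obtain g q where x: "x = (g, q)" "g \<in> carrier G" "q \<in> carrier Q" using assms by auto
  show ?thesis using z x center_sub center_coset_in[OF z(1)]
    by (auto simp: \<theta>_mult \<theta>q_mult \<theta>_D)
qed

lemma \<tau>_cls:
  assumes "g \<in> carrier G" "q \<in> carrier Q"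
  shows "\<tau> (cls g q) = \<theta> g + \<theta>q q"
  unfolding \<tau>_def using P.the_elem_coset[OF D_subgroup, of "(g, q)", OF _ \<tau>_D] assms by simp

lemma \<tau>_cont: "continuous_map TE euclideanreal \<tau>"
  unfolding \<tau>_def[abs_def]
proof (rule P.continuous_map_the_elem_coset[OF D_subgroup _ \<tau>_D])
  show "continuous_map (prod_topology T TQ) euclideanreal (\<lambda>(g, q). \<theta> g + \<theta>q q)"
    using continuous_map_compose[OF continuous_map_fst \<theta>_cont, of TQ]
      continuous_map_compose[OF continuous_map_snd \<theta>q_cont, of T]
    by (auto simp: case_prod_unfold o_def intro!: continuous_map_add)
qed auto

lemma eta_D:
  assumes "d \<in> D" "x \<in> carrier (G \<times>\<times> Q)"
  shows "(\<lambda>(g, q). group_center G #> g) (d \<otimes>\<^bsub>G \<times>\<times> Q\<^esub> x) = (\<lambda>(g, q). group_center G #> g) x"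
  using assms coset_mult_left[OF Z.subgroup_axioms] by auto

lemma eta_cls:
  assumes "g \<in> carrier G" "q \<in> carrier Q"
  shows "eta G (cls g q) = group_center G #> g"
  unfolding eta_def using P.the_elem_coset[OF D_subgroup, of "(g, q)", OF _ eta_D] assms by simp

lemma coset_fst_cont: "continuous_map (prod_topology T TQ) TGZ (\<lambda>(g, q). group_center G #> g)"
  using continuous_map_compose[OF continuous_map_fst continuous_map_coset]
  by (simp add: case_prod_unfold o_def)

lemma eta_cont: "continuous_map TE TGZ (eta G)"
  unfolding eta_def[abs_def]
  by (rule P.continuous_map_the_elem_coset[OF D_subgroup coset_fst_cont eta_D]) auto

text \<open>Composed with the continuous surjection from the product onto \<open>E\<close>, the map
  becomes the first projection followed by the coset map of the center, and both of these are
  open.\<close>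

lemma eta_open: "open_map TE TGZ (eta G)"
proof (rule open_map_from_composition_left[OF _ P.continuous_map_coset])
  have om: "open_map (prod_topology T TQ) TGZ ((\<lambda>g. group_center G #> g) \<circ> fst)"
    by (rule open_map_compose[OF open_map_fst open_map_coset[OF Z.subgroup_axioms]])
  have eq: "(eta G \<circ> (#>\<^bsub>G \<times>\<times> Q\<^esub>) D) ` U = ((\<lambda>g. group_center G #> g) \<circ> fst) ` U"
    if "openin (prod_topology T TQ) U" for U
  proof (rule image_cong[OF refl])
    fix x assume "x \<in> U"
    then have "x \<in> carrier (G \<times>\<times> Q)" using openin_subset[OF that] by auto
    then show "(eta G \<circ> (#>\<^bsub>G \<times>\<times> Q\<^esub>) D) x = ((\<lambda>g. group_center G #> g) \<circ> fst) x"
      using eta_cls[of "fst x" "snd x"] by (simp add: mem_Times_iff)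
  qed
  show "open_map (prod_topology T TQ) TGZ (eta G \<circ> (#>\<^bsub>G \<times>\<times> Q\<^esub>) D)"
    unfolding open_map_def
  proof (intro allI impI)
    fix U assume U: "openin (prod_topology T TQ) U"
    show "openin TGZ ((eta G \<circ> (#>\<^bsub>G \<times>\<times> Q\<^esub>) D) ` U)"
      unfolding eq[OF U] using om U unfolding open_map_def by blast
  qed
  show "(#>\<^bsub>G \<times>\<times> Q\<^esub>) D ` topspace (prod_topology T TQ) = topspace TE"
    by (simp add: P.topspace_coset carrier_FactGroup)
qed

lemma eta_hom: "eta G \<in> hom E GZ"
proof (rule homI)
  fix X assume "X \<in> carrier E"
  then show "eta G X \<in> carrier GZ" by (auto simp: carrier_E eta_cls carrier_FactGroup)
next
  fix X Y assume "X \<in> carrier E" "Y \<in> carrier E"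
  then obtain g q g' q' where "X = cls g q" "Y = cls g' q'"
    and in_carrier: "g \<in> carrier G" "q \<in> carrier Q" "g' \<in> carrier G" "q' \<in> carrier Q"
    unfolding carrier_E by blast
  then show "eta G (X \<otimes>\<^bsub>E\<^esub> Y) = eta G X \<otimes>\<^bsub>GZ\<^esub> eta G Y"
    using cls_mult[of g q g' q'] Q.m_closed[of q q']
      normal.rcos_sum[OF normalI_central[OF Z.subgroup_axioms subset_refl], of g g']
    by (simp add: eta_cls)
qed

section \<open>The embedded real line as the kernel of eta\<close>

definition "j t = cls \<one> (\<psi> t)"

lemma j_hom: "j \<in> hom real_group E"
proof (rule homI)
  show "j t \<in> carrier E" for t by (simp add: j_def cls_in \<psi>_in)
  show "j (s \<otimes>\<^bsub>real_group\<^esub> t) = j s \<otimes>\<^bsub>E\<^esub> j t" for s t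
    using cls_mult[of \<one> "\<psi> s" \<one> "\<psi> t"] by (simp add: j_def \<psi>_in \<psi>_add real_group_def)
qed

lemma j_image: "j ` carrier real_group = kernel E GZ (eta G)"
proof (intro equalityI subsetI)
  fix X assume "X \<in> j ` carrier real_group"
  then show "X \<in> kernel E GZ (eta G)"
    using j_hom by (auto simp: kernel_def j_def cls_in \<psi>_in eta_cls coset_mult_one Z.subset)
next
  fix X assume "X \<in> kernel E GZ (eta G)"
  then obtain g q where X: "X = cls g q" and g: "g \<in> carrier G" and q: "q \<in> carrier Q"
    and "group_center G #> g = group_center G" by (auto simp: kernel_def carrier_E eta_cls)
  then have gZ: "g \<in> group_center G" using rcos_self[OF g Z.subgroup_axioms] by simp
  \<comment> \<open>A central \<open>g\<close> can be moved from the first coordinate to the second,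
    where it becomes its coset.\<close>
  let ?q = "(H #> g) <#> q"
  have q': "?q \<in> carrier Q" using Q.m_closed[OF center_coset_in[OF gZ] q] by simp
  have "inv\<^bsub>Q\<^esub> (H #> g) <#> ?q = q"
    using Q.m_assoc[OF Q.inv_closed[OF center_coset_in[OF gZ]] center_coset_in[OF gZ] q]
      Q.l_inv[OF center_coset_in[OF gZ]] Q.l_one[OF q] by simp
  then have "X = cls \<one> ?q" using cls_shift[OF gZ one_closed q'] X g by simp
  then have "X = j (\<theta>q ?q)" by (simp add: j_def \<psi>_\<theta>q q')
  then show "X \<in> j ` carrier real_group" by (simp add: real_group_def)
qed

text \<open>A continuous map with the continuous left inverse \<open>\<tau>\<close> is an
  embedding.\<close>

lemma j_embedding: "embedding_map euclideanreal TE j"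
proof (rule section_imp_embedding_map)
  have "continuous_map euclideanreal (prod_topology T TQ) (\<lambda>t. (\<one>, \<psi> t))"
    by (simp add: continuous_map_pairwise o_def \<psi>_cont)
  from continuous_map_compose[OF this P.continuous_map_coset, of D]
  have "continuous_map euclideanreal TE j" by (simp add: o_def j_def[abs_def])
  moreover have "\<tau> (j t) = t" for t
  proof -
    have "\<theta> \<one> = 0" using \<theta>_mult[OF subgroup.one_closed[OF K] one_closed] by simp
    then show ?thesis by (simp add: j_def \<tau>_cls \<psi>_in \<theta>q_\<psi>)
  qed
  ultimately show "section_map euclideanreal TE j"
    unfolding section_map_def retraction_maps_def using \<tau>_cont by blast
qed

text \<open>The kernel is the preimage of the trivial coset, and this point of the quotient is
  closed because the center is closed in \<open>G\<close>.\<close>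

lemma kernel_closed: "closedin TE (kernel E GZ (eta G))"
proof -
  have "closedin TGZ {group_center G}"
  proof -
    have "{x \<in> carrier G. group_center G #> x \<in> {group_center G}} = group_center G"
      using rcos_self[OF _ Z.subgroup_axioms] Z.mem_carrier coset_join2[OF _ Z.subgroup_axioms] by auto
    then have "closedin T {x \<in> topspace T. group_center G #> x \<in> {group_center G}}"
      using closedin_center[OF closed_one] by simp
    moreover have "{group_center G} \<subseteq> topspace TGZ"
      using GZ.one_closed by (simp add: topspace_coset)
    ultimately show ?thesis
      using quotient_map_coset[of "group_center G"] unfolding quotient_map_closedin by blast
  qed
  from closedin_continuous_map_preimage[OF eta_cont this]
  show ?thesis by (simp add: kernel_def P.topspace_coset)
qed

lemma extension:
  "topological_group_extension real_group euclideanreal j E TE (eta G) GZ TGZ"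
proof -
  interpret eta: group_hom E GZ "eta G"
    by (simp add: group_hom_def group_hom_axioms_def E.is_group GZ.is_group eta_hom)
  have "eta G ` carrier E = carrier GZ"
  proof
    show "eta G ` carrier E \<subseteq> carrier GZ" using eta_hom by (auto simp: hom_def)
    show "carrier GZ \<subseteq> eta G ` carrier E"
    proof
      fix X assume "X \<in> carrier GZ"
      then obtain g where g: "g \<in> carrier G" "X = group_center G #> g"
        unfolding carrier_FactGroup by blast
      then have "X = eta G (cls g (\<psi> 0))" using eta_cls[OF g(1) \<psi>_in] by simp
      then show "X \<in> eta G ` carrier E" using cls_in[OF g(1) \<psi>_in] by (rule image_eqI)
    qed
  qed
  then show ?thesis
    unfolding topological_group_extension_def j_image top_group_iff[symmetric]
    using top_group_real E.top_group_axioms GZ.top_group_axioms j_hom j_embedding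
      eta.normal_kernel kernel_closed eta_hom eta_cont eta_open by blast
qed

text \<open>\<open>g \<mapsto> (g, -\<theta> g)\<close> is constant modulo \<open>D\<close> on the cosets of the center.\<close>

lemma cross_section_exists: "\<exists>u. cross_section TE (eta G) TGZ u"
proof
  let ?f = "\<lambda>g. cls g (\<psi> (- \<theta> g))"
  let ?u = "\<lambda>X. the_elem (?f ` X)"
  have inv: "?f (z \<otimes> g) = ?f g" if "z \<in> group_center G" "g \<in> carrier G" for z g
  proof -
    have zK: "z \<in> K" using that center_sub by auto
    have "\<psi> (- \<theta> (z \<otimes> g)) = \<psi> (\<theta>q (inv\<^bsub>Q\<^esub> (H #> z))) <#> \<psi> (- \<theta> g)"
      using that by (simp add: \<theta>_mult[OF zK] \<theta>_D \<psi>_add[symmetric])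
    also have "\<dots> = inv\<^bsub>Q\<^esub> (H #> z) <#> \<psi> (- \<theta> g)"
      using center_coset_in[OF that(1)] by (simp add: \<psi>_\<theta>q)
    finally show ?thesis using cls_shift[OF that \<psi>_in] by simp
  qed
  have "continuous_map T (prod_topology T TQ) (\<lambda>g. (g, \<psi> (- \<theta> g)))"
    using continuous_map_compose[OF continuous_map_minus[OF \<theta>_cont] \<psi>_cont] continuous_map_id[of T]
    by (simp add: continuous_map_pairwise o_def id_def)
  from continuous_map_compose[OF this P.continuous_map_coset, of D]
  have "continuous_map T TE ?f" by (simp add: o_def)
  then have "continuous_map TGZ TE ?u"
    using inv by (intro continuous_map_the_elem_coset[OF Z.subgroup_axioms, where f = ?f]) blast+
  moreover have "eta G (?u X) = X" if "X \<in> topspace TGZ" for X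
  proof -
    have "X \<in> (\<lambda>g. group_center G #> g) ` carrier G"
      using that by (simp only: topspace_coset carrier_FactGroup)
    then obtain g where g: "g \<in> carrier G" "X = group_center G #> g" by (elim imageE)
    have "?u X = ?f g"
      unfolding g(2) 
      by (rule the_elem_coset[OF Z.subgroup_axioms g(1), where f = ?f]) (rule inv[OF _ g(1)])
    then show ?thesis using eta_cls[OF g(1) \<psi>_in] g(2) by simp
  qed
  ultimately show "cross_section TE (eta G) TGZ ?u" unfolding cross_section_def by blast
qed

end

section \<open>Lifting angles on simply connected topological groups\<close>

lemma countable_cis_eq_1: "countable {x. cis x = 1}"
proof -
  have "{x. cis x = 1} \<subseteq> range (\<lambda>n::int. 2 * pi * of_int n)"
  proof
    fix x assume "x \<in> {x. cis x = 1}"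
    then have "cos x = 1" by (simp add: complex_eq_iff)
    then obtain n :: int where "x = of_int n * 2 * pi" using cos_one_2pi_int by blast
    then show "x \<in> range (\<lambda>n::int. 2 * pi * of_int n)" by auto
  qed
  then show ?thesis by (rule countable_subset) simp
qed

text \<open>A connected subset of a metric space with more than one point is uncountable. This
  covers both angles that are multiples of \<open>2 * pi\<close> and matrices that are scalar roots
  of unity.\<close>

lemma connected_countable_range_constant:
  fixes f :: "'a \<Rightarrow> 'b::metric_space"
  assumes "connected_space X" "continuous_map X euclidean f" "countable C"
    and "\<And>x. x \<in> topspace X \<Longrightarrow> f x \<in> C"
    and "x \<in> topspace X" "y \<in> topspace X"
  shows "f x = f y"
proof (rule ccontr)
  assume "f x \<noteq> f y"
  have "connectedin euclidean (f ` topspace X)"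
    using assms(1,2) by (intro connectedin_continuous_map_image[of X]) (auto simp: connectedin_topspace)
  then have "uncountable (f ` topspace X)"
    using assms \<open>f x \<noteq> f y\<close> by (intro connected_uncountable[of _ "f x" "f y"]) auto
  moreover have "f ` topspace X \<subseteq> C" using assms(4) by auto
  ultimately show False using assms(3) countable_subset by blast
qed

lemma cis_one_imp_constant:
  assumes "connected_space X" "continuous_map X euclideanreal a"
    and "\<And>x. x \<in> topspace X \<Longrightarrow> cis (a x) = 1"
    and "x0 \<in> topspace X" "a x0 = 0" "x \<in> topspace X"
  shows "a x = 0"
  using connected_countable_range_constant[OF assms(1,2) countable_cis_eq_1 _ assms(6,4)] assms(3,5)
  by simp

lemma cis_eq_imp_constant_difference:
  assumes "connected_space X" "continuous_map X euclideanreal a" "continuous_map X euclideanreal b"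
    and "\<And>x. x \<in> topspace X \<Longrightarrow> cis (a x) = cis (b x)"
    and "x0 \<in> topspace X" "a x0 = b x0" "x \<in> topspace X"
  shows "a x = b x"
proof -
  have "cis (a y - b y) = 1" if "y \<in> topspace X" for y
    using assms(4)[OF that] by (simp flip: cis_divide)
  from cis_one_imp_constant[OF assms(1) continuous_map_diff[OF assms(2,3)] this assms(5) _ assms(7)]
  show ?thesis using assms(6) by simp
qed

lemma connected_space_convex:
  "convex (S :: 'a::real_normed_vector set) \<Longrightarrow> connected_space (top_of_set S)"
  using convex_connected by (simp add: connectedin_def flip: connectedin_iff_connected)

lemma convex_angle_lift:
  fixes F :: "'a::real_normed_vector \<Rightarrow> complex"
  assumes "convex S" "continuous_on S F" "\<And>x. x \<in> S \<Longrightarrow> norm (F x) = 1" "x0 \<in> S" "F x0 = 1"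
  obtains a where "continuous_on S a" "\<And>x. x \<in> S \<Longrightarrow> cis (a x) = F x" "a x0 = 0"
proof -
  obtain g where g: "continuous_on S g" "\<And>x. x \<in> S \<Longrightarrow> F x = exp (g x)"
    using continuous_logarithm_on_contractible[OF assms(2) convex_imp_contractible[OF assms(1)]] assms(3)
    by (metis norm_zero zero_neq_one)
  have im: "cis (Im (g x)) = F x" if "x \<in> S" for x
  proof -
    have "Re (g x) = 0" using assms(3)[OF that] g(2)[OF that] by simp
    then show ?thesis using g(2)[OF that] by (simp add: exp_eq_polar)
  qed
  show thesis
  proof
    \<comment> \<open>Since \<open>F x0 = 1\<close>, the subtracted constant is a multiple of
      \<open>2 * pi\<close>; it normalises the angle at \<open>x0\<close>.\<close>
    show "continuous_on S (\<lambda>x. Im (g x) - Im (g x0))" using g(1) by (intro continuous_intros)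
    show "cis (Im (g x) - Im (g x0)) = F x" if "x \<in> S" for x
      using im[OF that] im[OF assms(4)] assms(5) by (simp flip: cis_divide)
  qed simp
qed

locale simply_connected_top_group = top_group G T for G :: "('a, 'm) monoid_scheme" (structure) and T +
  assumes simply_connected: "simply_connected_space T"
begin

text \<open>\<open>simply_connected_space\<close> compares arbitrary loops by free homotopies,
  constant loops at different points included. The track of the base point under a homotopy between
  two constant loops is a path.\<close>

lemma path_from_one:
  assumes g: "g \<in> carrier G"
  obtains q where "pathin T q" "q 0 = \<one>" "q 1 = g"
proof -
  have "homotopic_with (\<lambda>r. r 1 = r 0) (top_of_set {0..1::real}) T (\<lambda>_. \<one>) (\<lambda>_. g)"
    using simply_connected[unfolded simply_connected_space_def, rule_format, of "\<lambda>_. \<one>" "\<lambda>_. g"] g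
    by simp
  then obtain h where h: "continuous_map (prod_topology (top_of_set {0..1::real}) (top_of_set {0..1::real})) T h"
      "\<forall>x. h (0, x) = \<one>" "\<forall>x. h (1, x) = g"
    unfolding homotopic_with_def by blast
  have "continuous_map (top_of_set {0..1}) (prod_topology (top_of_set {0..1::real}) (top_of_set {0..1::real}))
      (\<lambda>t. (t, 0))"
    by (simp del: prod_topology_subtopology_eu add: continuous_map_pairwise o_def)
  from continuous_map_compose[OF this h(1)] have "pathin T (\<lambda>t. h (t, 0))"
    by (simp add: pathin_def o_def)
  then show thesis using that[of "\<lambda>t. h (t, 0)"] h(2,3) by simp
qed

lemma connected: "connected_space T"
proof -
  have "connected_component_of T \<one> g" if g: "g \<in> carrier G" for g
  proof -
    obtain q where q: "pathin T q" "q 0 = \<one>" "q 1 = g" by (rule path_from_one[OF g])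
    have "connectedin T (q ` {0..1})" by (rule connectedin_path_image[OF q(1)])
    moreover have "\<one> \<in> q ` {0..1}" "g \<in> q ` {0..1}"
      using q by (auto intro: rev_image_eqI[of 0] rev_image_eqI[of 1])
    ultimately show ?thesis unfolding connected_component_of_def by blast
  qed
  then show ?thesis
    unfolding connected_space_iff_connected_component topspace_eq
    by (meson connected_component_of_sym connected_component_of_trans)
qed

text \<open>The pointwise quotient of the two paths is a loop at \<open>\<one>\<close>, hence freely
  contractible; multiplying a contraction by \<open>q\<close> gives a homotopy from \<open>p\<close>
  to \<open>q\<close>, after a correction that keeps the endpoints in place.\<close>

lemma homotopy_between_paths:
  assumes p: "pathin T p" "p 0 = \<one>" and q: "pathin T q" "q 0 = \<one>" and pq: "p 1 = q 1"
  obtains h where "continuous_map (top_of_set ({0..1::real} \<times> {0..1::real})) T h"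
    "\<And>t. t \<in> {0..1} \<Longrightarrow> h (0, t) = p t" "\<And>t. t \<in> {0..1} \<Longrightarrow> h (1, t) = q t"
    "\<And>s. s \<in> {0..1} \<Longrightarrow> h (s, 0) = \<one>" "\<And>s. s \<in> {0..1} \<Longrightarrow> h (s, 1) = q 1"
proof -
  let ?I = "top_of_set {0..1::real}"
  have pc: "continuous_map ?I T p" and qc: "continuous_map ?I T q" using p q by (auto simp: pathin_def)
  have pG: "p t \<in> carrier G" and qG: "q t \<in> carrier G" if "t \<in> {0..1}" for t
    using continuous_map_in_carrier[OF pc] continuous_map_in_carrier[OF qc] that by auto
  have "pathin T (\<lambda>t. p t \<otimes> inv (q t))"
    unfolding pathin_def by (intro continuous_map_mult continuous_map_inv pc qc)
  moreover have "p 0 \<otimes> inv (q 0) = \<one>" "p 1 \<otimes> inv (q 1) = \<one>" using p q pq qG by auto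
  ultimately have "homotopic_with (\<lambda>r. r 1 = r 0) ?I T (\<lambda>t. p t \<otimes> inv (q t)) (\<lambda>_. \<one>)"
    using simply_connected[unfolded simply_connected_space_def, rule_format,
        of "\<lambda>t. p t \<otimes> inv (q t)" "\<lambda>_. \<one>"] by simp
  then obtain k where k: "continuous_map (prod_topology ?I ?I) T k"
      "\<forall>t. k (0, t) = p t \<otimes> inv (q t)" "\<forall>t. k (1, t) = \<one>"
      "\<forall>s\<in>{0..1}. k (s, 1) = k (s, 0)"
    unfolding homotopic_with_def by blast
  have kG: "k (s, t) \<in> carrier G" if "s \<in> {0..1}" "t \<in> {0..1}" for s t
    using continuous_map_in_carrier[OF k(1), of "(s, t)"] that by simp
  \<comment> \<open>The free homotopy \<open>k\<close> may move the base point. Dividing by its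
    value at time 0 stops this, and because each stage is a loop the same division also fixes the
    other end.\<close>
  define h where "h = (\<lambda>x. inv (k (fst x, 0)) \<otimes> k x \<otimes> q (snd x))"
  show thesis
  proof
    have "continuous_map (prod_topology ?I ?I) (prod_topology ?I ?I) (\<lambda>x. (fst x, 0))"
      by (simp del: prod_topology_subtopology_eu add: continuous_map_pairwise o_def continuous_map_fst)
    from continuous_map_compose[OF this k(1)]
    have "continuous_map (prod_topology ?I ?I) T (\<lambda>x. k (fst x, 0))"
      by (simp del: prod_topology_subtopology_eu add: o_def)
    moreover have "continuous_map (prod_topology ?I ?I) T (\<lambda>x. q (snd x))"
      using continuous_map_compose[OF continuous_map_snd qc, of ?I]
      by (simp del: prod_topology_subtopology_eu add: o_def)
    ultimately have "continuous_map (prod_topology ?I ?I) T h"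
      unfolding h_def by (intro continuous_map_mult continuous_map_inv k(1))
    then show "continuous_map (top_of_set ({0..1} \<times> {0..1})) T h" by simp
    fix t :: real assume t: "t \<in> {0..1}"
    show "h (0, t) = p t" using p q k(2) pG[OF t] qG[OF t] by (simp add: h_def m_assoc)
    show "h (1, t) = q t" using k(3) qG[OF t] by (simp add: h_def)
    show "h (t, 0) = \<one>" using kG[OF t, of 0] q by (simp add: h_def)
    show "h (t, 1) = q 1" using kG[OF t, of 0] k(4) t qG[of 1] by (simp add: h_def)
  qed
qed

text \<open>
  Existence of continuous logarithms on a simply connected space needs some form of local path
  connectedness.  The value of the logarithm at \<open>g\<close> is obtained by lifting along an arbitrary path
  from \<open>\<one>\<close> to \<open>g\<close>; multiplying such a path pointwise by a short path from \<open>\<one>\<close> to \<open>k\<close> yields a path to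
  \<open>g \<otimes> k\<close>.
\<close>

lemma angle_lift:
  assumes locally_path_connected: "\<And>N. openin T N \<Longrightarrow> \<one> \<in> N \<Longrightarrow>
      \<exists>N'. openin T N' \<and> \<one> \<in> N' \<and> (\<forall>k\<in>N'. \<exists>q. pathin T q \<and> q 0 = \<one> \<and> q 1 = k \<and> q ` {0..1} \<subseteq> N)"
    and f: "continuous_map T euclidean f" and f1: "f \<one> = 1"
    and norm_f: "\<And>g. g \<in> carrier G \<Longrightarrow> norm (f g) = 1"
  obtains \<theta> where "continuous_map T euclideanreal \<theta>" "\<And>g. g \<in> carrier G \<Longrightarrow> cis (\<theta> g) = f g" "\<theta> \<one> = 0"
proof -
  let ?I = "top_of_set {0..1::real}"
  define lift where "lift q a \<longleftrightarrow> pathin T q \<and> q 0 = \<one> \<and> continuous_on {0..1} a \<and> a 0 = (0::real) \<and>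
    (\<forall>t\<in>{0..1}. cis (a t) = f (q t))" for q a
  have f_path: "continuous_on {0..1} (\<lambda>t. f (q t))" if "pathin T q" for q
    using continuous_map_compose[OF _ f, of ?I q] that by (simp add: pathin_def o_def)
  have in_carrier: "q t \<in> carrier G" if "pathin T q" "t \<in> {0..1}" for q t
    using that continuous_map_in_carrier unfolding pathin_def by fastforce
  have lift_exists: "\<exists>a. lift q a" if q: "pathin T q" "q 0 = \<one>" for q
  proof -
    obtain a where "continuous_on {0..1} a" "\<And>t. t \<in> {0..1} \<Longrightarrow> cis (a t) = f (q t)" "a 0 = 0"
      by (rule convex_angle_lift[of "{0..1}" "\<lambda>t. f (q t)" 0])
        (use q f1 norm_f in_carrier f_path in auto)
    then show ?thesis using q unfolding lift_def by blast
  qed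
  have lift_unique: "a 1 = b 1" if "lift p a" "lift q b" "p 1 = q 1" for p q a b
  proof -
    have p: "pathin T p" "p 0 = \<one>" "continuous_on {0..1} a" "a 0 = 0" "\<And>t. t \<in> {0..1} \<Longrightarrow> cis (a t) = f (p t)"
      and q: "pathin T q" "q 0 = \<one>" "continuous_on {0..1} b" "b 0 = 0" "\<And>t. t \<in> {0..1} \<Longrightarrow> cis (b t) = f (q t)"
      and pq: "p 1 = q 1"
      using that unfolding lift_def by auto
    obtain h where h: "continuous_map (top_of_set ({0..1::real} \<times> {0..1::real})) T h"
      "\<And>t. t \<in> {0..1} \<Longrightarrow> h (0, t) = p t" "\<And>t. t \<in> {0..1} \<Longrightarrow> h (1, t) = q t"
      "\<And>s. s \<in> {0..1} \<Longrightarrow> h (s, 0) = \<one>" "\<And>s. s \<in> {0..1} \<Longrightarrow> h (s, 1) = q 1"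
      by (rule homotopy_between_paths[OF p(1,2) q(1,2) pq]) blast
    let ?J = "{0..1::real} \<times> {0..1::real}"
    have hG: "h x \<in> carrier G" if "x \<in> ?J" for x
      using continuous_map_in_carrier[OF h(1)] that by simp
    \<comment> \<open>\<open>L\<close> is the angle over the whole square. By uniqueness it vanishes
      on the edge \<open>t = 0\<close>, is constant on the edge \<open>t = 1\<close>, and restricts
      to \<open>a\<close> and \<open>b\<close> on the two remaining edges, so the final values of
      \<open>a\<close> and \<open>b\<close> agree.\<close>
    obtain L where L: "continuous_on ?J L" "\<And>x. x \<in> ?J \<Longrightarrow> cis (L x) = f (h x)" "L (0, 0) = 0"
    proof (rule convex_angle_lift[of ?J "\<lambda>x. f (h x)" "(0, 0)"])
      show "convex ?J" by (intro convex_Times) auto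
      show "continuous_on ?J (\<lambda>x. f (h x))"
        using continuous_map_compose[OF h(1) f] by (simp add: o_def)
    qed (use norm_f hG h f1 in auto)
    have conn: "connected_space ?I" by (rule connected_space_convex) simp
    have L_comp: "continuous_map ?I euclideanreal (\<lambda>t. L (c t))"
      if "continuous_on {0..1} c" "c ` {0..1} \<subseteq> ?J" for c
      using continuous_on_compose2[OF L(1) that] by simp
    have bottom: "L (s, 0) = 0" if "s \<in> {0..1}" for s
    proof (rule cis_one_imp_constant[OF conn, of "\<lambda>s. L (s, 0)" 0])
      show "continuous_map ?I euclideanreal (\<lambda>s. L (s, 0))"
        by (rule L_comp) (auto intro!: continuous_intros)
    qed (use L h f1 that in auto)
    have top: "L (s, 1) = L (0, 1)" if "s \<in> {0..1}" for s
    proof (rule cis_eq_imp_constant_difference[OF conn, of "\<lambda>s. L (s, 1)" "\<lambda>s. L (0, 1)" 0])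
      show "continuous_map ?I euclideanreal (\<lambda>s. L (s, 1))"
        by (rule L_comp) (auto intro!: continuous_intros)
    qed (use L h that in auto)
    have "L (0, 1) = a 1"
    proof (rule cis_eq_imp_constant_difference[OF conn, of "\<lambda>t. L (0, t)" a 0])
      show "continuous_map ?I euclideanreal (\<lambda>t. L (0, t))"
        by (rule L_comp) (auto intro!: continuous_intros)
    qed (use L h p in auto)
    moreover have "L (1, 1) = b 1"
    proof (rule cis_eq_imp_constant_difference[OF conn, of "\<lambda>t. L (1, t)" b 0])
      show "continuous_map ?I euclideanreal (\<lambda>t. L (1, t))"
        by (rule L_comp) (auto intro!: continuous_intros)
    qed (use L h q bottom[of 1] in auto)
    ultimately show ?thesis using top[of 1] by simp
  qed
  \<comment> \<open>By \<open>lift_unique\<close> the chosen value does not depend on the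
    path.\<close>
  define \<theta> where "\<theta> g = (SOME x. \<exists>q a. lift q a \<and> q 1 = g \<and> a 1 = x)" for g
  have \<theta>_eq: "\<theta> (q 1) = a 1" if "lift q a" for q a
  proof -
    have "\<exists>q' a'. lift q' a' \<and> q' 1 = q 1 \<and> a' 1 = \<theta> (q 1)"
      unfolding \<theta>_def by (rule someI_ex) (use that in blast)
    then obtain q' a' where "lift q' a'" "q' 1 = q 1" and \<theta>: "a' 1 = \<theta> (q 1)" by blast
    from lift_unique[OF this(1) that this(2)] show ?thesis by (simp flip: \<theta>)
  qed
  have lift_to: "\<exists>q a. lift q a \<and> q 1 = g" if "g \<in> carrier G" for g
    using path_from_one[OF that] lift_exists by metis
  have \<theta>_near: "\<exists>N. openin T N \<and> g \<in> N \<and> continuous_map (subtopology T N) euclideanreal \<theta>"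
    if g: "g \<in> carrier G" for g
  proof -
    obtain q a where la: "lift q a" and q1: "q 1 = g" using lift_to[OF g] by blast
    have q: "pathin T q" "q 0 = \<one>" "continuous_on {0..1} a" "a 0 = 0" "\<And>t. t \<in> {0..1} \<Longrightarrow> cis (a t) = f (q t)"
      using la unfolding lift_def by auto
    have qG: "q t \<in> carrier G" if "t \<in> {0..1}" for t by (rule in_carrier[OF q(1) that])
    let ?ratio = "\<lambda>x k. f (x \<otimes> k) / f x"
    let ?R = "\<lambda>y. (f (q (fst y) \<otimes> snd y) * inverse (f (q (fst y))))"
    \<comment> \<open>In \<open>W\<close> the factor \<open>k\<close> turns the value of
      \<open>f\<close> at \<open>q t\<close> by less than a right angle. The tube lemma gives a
      neighbourhood \<open>N\<close> of \<open>\<one>\<close> on which this holds for all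
      \<open>t\<close> at once.\<close>
    define W where "W = {y \<in> topspace (prod_topology ?I T). ?R y \<in> {z. Re z > 0}}"
    have fq: "continuous_map (prod_topology ?I T) T (\<lambda>y. q (fst y))"
      using continuous_map_compose[OF continuous_map_fst, of ?I T q] q(1) by (simp add: pathin_def o_def)
    have 1: "continuous_map (prod_topology ?I T) euclidean (\<lambda>y. f (q (fst y) \<otimes> snd y))"
      using continuous_map_compose[OF continuous_map_mult[OF fq continuous_map_snd] f] by (simp add: o_def)
    have 2: "continuous_map (prod_topology ?I T) euclidean (\<lambda>y. inverse (f (q (fst y))))"
    proof -
      have a: "continuous_map (prod_topology ?I T) (subtopology euclidean (- {0})) (\<lambda>y. f (q (fst y)))"
        using continuous_map_compose[OF fq f] norm_f qG
        by (fastforce simp: continuous_map_in_subtopology o_def)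
      have b: "continuous_map (subtopology euclidean (- {0})) euclidean (inverse :: complex \<Rightarrow> complex)"
        by (auto intro!: continuous_intros)
      from continuous_map_compose[OF a b] show ?thesis by (simp add: o_def)
    qed
    have "continuous_map (prod_topology ?I T) euclidean ?R"
    proof -
      have a: "continuous_map (prod_topology ?I T) (prod_topology euclidean euclidean)
          (\<lambda>y. (f (q (fst y) \<otimes> snd y), inverse (f (q (fst y)))))"
        using 1 2 by (simp only: continuous_map_pairwise o_def fst_conv snd_conv simp_thms)
      have b: "continuous_map (prod_topology euclidean euclidean) euclidean (\<lambda>z::complex \<times> complex. fst z * snd z)"
        by (auto intro!: continuous_intros)
      from continuous_map_compose[OF a b] show ?thesis by (simp add: o_def)
    qed
    then have "openin (prod_topology ?I T) W"
      unfolding W_def by (rule openin_continuous_map_preimage) (simp add: open_halfspace_Re_gt)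
    moreover have "{0..1} \<times> {\<one>} \<subseteq> W"
    proof
      fix y assume "y \<in> {0..1::real} \<times> {\<one>}"
      then obtain t where t: "t \<in> {0..1}" "y = (t, \<one>)" by auto
      have "f (q t) \<noteq> 0" using norm_f[OF qG[OF t(1)]] by auto
      then have "f (q t \<otimes> \<one>) * inverse (f (q t)) = 1" using qG[OF t(1)] by simp
      then have "Re (?R y) > 0" unfolding t(2) by (simp del: inverse_complex.simps times_complex.simps)
      then show "y \<in> W" using t by (simp add: W_def)
    qed
    moreover have "compactin ?I {0..1}" by (simp add: compactin_subtopology)
    ultimately obtain N where N: "openin T N" "\<one> \<in> N" "{0..1} \<times> N \<subseteq> W"
      using tube_lemma_left[of ?I T W "{0..1}" \<one>] by (auto simp: subset_iff)
    then obtain N' where N': "openin T N'" "\<one> \<in> N'"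
        "\<And>k. k \<in> N' \<Longrightarrow> \<exists>q. pathin T q \<and> q 0 = \<one> \<and> q 1 = k \<and> q ` {0..1} \<subseteq> N"
      using locally_path_connected[OF N(1,2)] by blast
    have \<theta>_mult: "\<theta> (g \<otimes> k) = \<theta> g + Im (Ln (?ratio g k)) \<and> Re (?ratio g k) > 0" if kN': "k \<in> N'" for k
    proof -
      obtain p where p: "pathin T p" "p 0 = \<one>" "p 1 = k" "p ` {0..1} \<subseteq> N" using N'(3)[OF kN'] by blast
      \<comment> \<open>The ratio has positive real part along the whole product path, so the
        principal logarithm is continuous there and its imaginary part is the additional
        angle.\<close>
      define b where "b t = a t + Im (Ln (?ratio (q t) (p t)))" for t
      have pG: "p t \<in> carrier G" if "t \<in> {0..1}" for t by (rule in_carrier[OF p(1) that])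
      have pos: "Re (?ratio (q t) (p t)) > 0" if "t \<in> {0..1}" for t
      proof -
        have "(t, p t) \<in> W" using p(4) N(3) that by blast
        then show ?thesis by (simp add: W_def divide_inverse)
      qed
      have path: "pathin T (\<lambda>t. q t \<otimes> p t)"
        using q(1) p(1) unfolding pathin_def by (rule continuous_map_mult)
      have "lift (\<lambda>t. q t \<otimes> p t) b"
        unfolding lift_def
      proof (intro conjI ballI path)
        show "q 0 \<otimes> p 0 = \<one>" using q p by simp
        have "continuous_on {0..1} (\<lambda>t. Ln (?ratio (q t) (p t)))"
        proof (intro continuous_intros f_path path q(1))
          show "?ratio (q t) (p t) \<notin> \<real>\<^sub>\<le>\<^sub>0" if "t \<in> {0..1}" for t
            using pos[OF that] complex_nonpos_Reals_iff by force
          show "\<forall>t\<in>{0..1}. f (q t) \<noteq> 0" using norm_f[OF qG] by force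
        qed
        from continuous_on_add[OF q(3) continuous_on_Im[OF this]]
        show "continuous_on {0..1} b" by (simp only: b_def[abs_def])
        show "b 0 = 0" using q p f1 by (simp add: b_def)
        fix t :: real assume t: "t \<in> {0..1}"
        have nz: "f (q t) \<noteq> 0" using norm_f[OF qG[OF t]] by auto
        have "norm (?ratio (q t) (p t)) = 1"
          using norm_f qG[OF t] pG[OF t] by (simp add: norm_divide)
        then have "cis (Im (Ln (?ratio (q t) (p t)))) = ?ratio (q t) (p t)"
          by (metis Re_Ln cis_conv_exp exp_Ln exp_eq_polar exp_zero ln_one mult_1 norm_zero of_real_1 zero_neq_one)
        then show "cis (b t) = f (q t \<otimes> p t)"
          using q(5)[OF t] nz by (simp add: b_def flip: cis_mult)
      qed
      then have "\<theta> (q 1 \<otimes> p 1) = b 1" by (rule \<theta>_eq)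
      then show ?thesis using pos[of 1] \<theta>_eq[OF la] q1 p(3) by (simp add: b_def)
    qed
    \<comment> \<open>On this translate of the neighbourhood \<open>\<theta>\<close> is given by the
      formula in \<open>eq\<close>, which depends on \<open>x\<close> only through
      \<open>f x\<close> and is therefore continuous.\<close>
    let ?N = "{x \<in> carrier G. inv g \<otimes> x \<in> N'}"
    have N'G: "N' \<subseteq> carrier G" using openin_subset[OF N'(1)] by simp
    have eq: "\<theta> x = \<theta> g + Im (Ln (f x / f g)) \<and> Re (f x / f g) > 0" if "x \<in> ?N" for x
    proof -
      have "x \<in> carrier G" "inv g \<otimes> x \<in> N'" using that by auto
      then show ?thesis using \<theta>_mult[of "inv g \<otimes> x"] g by (simp add: m_assoc[symmetric])
    qed
    show ?thesis
    proof (intro exI conjI)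
      show "openin T ?N" by (rule openin_translate) (use N' g in auto)
      show "g \<in> ?N" using g N' by simp
      have "continuous_map (subtopology T ?N) (top_of_set {z. Re (z / f g) > 0}) f"
        using f eq by (auto simp: continuous_map_in_subtopology continuous_map_from_subtopology)
      moreover have "continuous_on {z. Re (z / f g) > 0} (\<lambda>z. \<theta> g + Im (Ln (z / f g)))"
      proof (intro continuous_intros)
        show "\<forall>z\<in>{z. Re (z / f g) > 0}. f g \<noteq> 0" using norm_f[OF g] by auto
        show "z / f g \<notin> \<real>\<^sub>\<le>\<^sub>0" if "z \<in> {z. Re (z / f g) > 0}" for z
          using that complex_nonpos_Reals_iff by force
      qed
      ultimately have "continuous_map (subtopology T ?N) euclideanreal ((\<lambda>z. \<theta> g + Im (Ln (z / f g))) \<circ> f)"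
        by (intro continuous_map_compose) auto
      then show "continuous_map (subtopology T ?N) euclideanreal \<theta>"
        by (rule continuous_map_eq) (use eq in auto)
    qed
  qed
  show thesis
  proof
    show "continuous_map T euclideanreal \<theta>"
      by (rule continuous_map_locally) (simp add: \<theta>_near)
    show "cis (\<theta> g) = f g" if g: "g \<in> carrier G" for g
    proof -
      obtain q a where "lift q a" "q 1 = g" using lift_to[OF g] by blast
      then show ?thesis using \<theta>_eq[of q a] unfolding lift_def by fastforce
    qed
    have "lift (\<lambda>_. \<one>) (\<lambda>_. 0)" using f1 by (simp add: lift_def)
    from \<theta>_eq[OF this] show "\<theta> \<one> = 0" by simp
  qed
qed

end

section \<open>Covering homomorphisms\<close>

text \<open>The base group carries the topology of a subset of a metric space, so that uniform
  continuity can be used in lifting maps on compact sets.\<close>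

locale covering_hom = top_group G T + B: top_group B "top_of_set S"
  for G :: "('a, 'm) monoid_scheme" (structure) and T
    and B :: "('b::metric_space, 'k) monoid_scheme" and S :: "'b set" +
  fixes p :: "'a \<Rightarrow> 'b"
  assumes p_hom: "p \<in> hom G B" and covering: "covering_map T (top_of_set S) p"
begin

sublocale p: group_hom G B p
  by unfold_locales (rule p_hom)

lemma carrier_B: "carrier B = S" using B.topspace_eq by simp

lemma p_cont: "continuous_map T (top_of_set S) p" using covering by (simp add: covering_map_def)

lemma p_surj: "p ` carrier G = S" using covering by (simp add: covering_map_def)

text \<open>An evenly covered neighbourhood \<open>V\<close> of the identity, the sheet
  \<open>U\<close> over it through \<open>\<one>\<close>, and the local inverse \<open>s\<close> of
  \<open>p\<close>. Translations carry this one sheet to every other point.\<close>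

definition sheet where
  "sheet U V s \<longleftrightarrow> openin T U \<and> \<one> \<in> U \<and> openin (top_of_set S) V \<and> \<one>\<^bsub>B\<^esub> \<in> V \<and>
     continuous_map (top_of_set V) (subtopology T U) s \<and>
     (\<forall>v\<in>V. p (s v) = v) \<and> (\<forall>u\<in>U. p u \<in> V \<and> s (p u) = u)"

lemma sheet_exists: obtains U V s where "sheet U V s"
proof -
  have "\<one>\<^bsub>B\<^esub> \<in> topspace (top_of_set S)" using B.one_closed by (simp add: carrier_B)
  then obtain V \<U> where V: "\<one>\<^bsub>B\<^esub> \<in> V" "openin (top_of_set S) V"
    and \<U>: "\<Union>\<U> = {x \<in> topspace T. p x \<in> V}" "\<forall>U \<in> \<U>. openin T U"
      "\<forall>U \<in> \<U>. homeomorphic_map (subtopology T U) (subtopology (top_of_set S) V) p"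
    using covering unfolding covering_map_def by meson
  have "\<one> \<in> \<Union>\<U>" using V by (simp add: \<U>(1))
  then obtain U where U: "U \<in> \<U>" "\<one> \<in> U" by blast
  have VS: "V \<subseteq> S" using V(2) openin_imp_subset by blast
  have UG: "U \<subseteq> carrier G" using \<U>(2) U(1) openin_subset by fastforce
  have top: "subtopology (top_of_set S) V = top_of_set V"
    using VS by (simp add: subtopology_subtopology inf.absorb2)
  obtain s where "homeomorphic_maps (subtopology T U) (top_of_set V) p s"
    using \<U>(3) U(1) unfolding top homeomorphic_map_maps by blast
  moreover have "topspace (subtopology T U) = U" using UG by auto
  ultimately have "sheet U V s"
    using U V \<U>(2) unfolding sheet_def homeomorphic_maps_def
    by (auto simp: continuous_map_in_subtopology)
  then show thesis by (rule that)
qed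

lemma sheetD:
  assumes "sheet U V s"
  shows "openin T U" "\<one> \<in> U" "openin (top_of_set S) V" "\<one>\<^bsub>B\<^esub> \<in> V"
    "continuous_map (top_of_set V) T s" "\<And>v. v \<in> V \<Longrightarrow> s v \<in> U" "\<And>v. v \<in> V \<Longrightarrow> p (s v) = v"
    "\<And>u. u \<in> U \<Longrightarrow> p u \<in> V" "\<And>u. u \<in> U \<Longrightarrow> s (p u) = u"
  using assms unfolding sheet_def by (auto simp: continuous_map_in_subtopology)

lemma sheet_one: "sheet U V s \<Longrightarrow> s \<one>\<^bsub>B\<^esub> = \<one>"
  using sheetD(2,9)[of U V s] p.hom_one by metis

lemma kernel_discrete:
  obtains U where "openin T U" "\<one> \<in> U" "\<And>u. u \<in> U \<Longrightarrow> p u = \<one>\<^bsub>B\<^esub> \<Longrightarrow> u = \<one>"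
proof -
  obtain U V s where *: "sheet U V s" by (rule sheet_exists)
  show thesis
  proof (rule that[of U])
    show "u = \<one>" if "u \<in> U" "p u = \<one>\<^bsub>B\<^esub>" for u
      using sheetD(9)[OF * that(1)] that(2) sheet_one[OF *] by simp
  qed (use sheetD[OF *] in auto)
qed

text \<open>The kernel is discrete, so all fibres of \<open>h\<close> are open. The fibre over
  \<open>\<one>\<close> is then also closed, its complement being a union of the other
  fibres.\<close>

lemma kernel_valued_constant:
  assumes X: "connected_space X" and h: "continuous_map X T h"
    and ph: "\<And>x. x \<in> topspace X \<Longrightarrow> p (h x) = \<one>\<^bsub>B\<^esub>"
    and x0: "x0 \<in> topspace X" "h x0 = \<one>" and x: "x \<in> topspace X"
  shows "h x = \<one>"
proof -
  obtain U where U: "openin T U" "\<one> \<in> U" "\<And>u. u \<in> U \<Longrightarrow> p u = \<one>\<^bsub>B\<^esub> \<Longrightarrow> u = \<one>"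
    by (rule kernel_discrete) blast
  have hG: "h x \<in> carrier G" if "x \<in> topspace X" for x using continuous_map_in_carrier[OF h that] .
  let ?P = "\<lambda>k. {x \<in> topspace X. h x = k}"
  have opn: "openin X (?P k)" if k: "k \<in> carrier G" "p k = \<one>\<^bsub>B\<^esub>" for k
  proof -
    have "continuous_map X T (\<lambda>x. inv k \<otimes> h x)"
      using k h by (intro continuous_map_mult) auto
    from openin_continuous_map_preimage[OF this U(1)]
    have opn: "openin X {x \<in> topspace X. inv k \<otimes> h x \<in> U}" .
    have iff: "inv k \<otimes> h x \<in> U \<longleftrightarrow> h x = k" if "x \<in> topspace X" for x
    proof
      assume "inv k \<otimes> h x \<in> U"
      then have "inv k \<otimes> h x = \<one>" by (rule U(3)) (use k ph hG that in simp)
      then show "h x = k" using k hG[OF that] inv_solve_left[of \<one> k "h x"] by simp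
    qed (use k U(2) in simp)
    have "{x \<in> topspace X. inv k \<otimes> h x \<in> U} = ?P k" by (intro Collect_cong conj_cong refl iff)
    then show ?thesis using opn by (simp only:)
  qed
  have "openin X (?P \<one>)" by (rule opn) simp_all
  moreover have "closedin X (?P \<one>)"
  proof -
    have "topspace X - ?P \<one> = (\<Union>k\<in>{k \<in> carrier G. p k = \<one>\<^bsub>B\<^esub> \<and> k \<noteq> \<one>}. ?P k)"
      using ph hG by auto
    moreover have "openin X (\<Union>k\<in>{k \<in> carrier G. p k = \<one>\<^bsub>B\<^esub> \<and> k \<noteq> \<one>}. ?P k)"
      by (rule openin_Union) (use opn in auto)
    ultimately show ?thesis by (simp add: closedin_def)
  qed
  ultimately have "?P \<one> = {} \<or> ?P \<one> = topspace X" using X unfolding connected_space_clopen_in by blast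
  then show ?thesis using x0 x by blast
qed

text \<open>The pointwise quotient of two lifts takes values in the kernel.\<close>

lemma lift_unique:
  assumes X: "connected_space X" and f: "continuous_map X T f" and g: "continuous_map X T g"
    and eq: "\<And>x. x \<in> topspace X \<Longrightarrow> p (f x) = p (g x)"
    and x0: "x0 \<in> topspace X" "f x0 = g x0" and x: "x \<in> topspace X"
  shows "f x = g x"
proof -
  have fG: "f x \<in> carrier G" and gG: "g x \<in> carrier G" if "x \<in> topspace X" for x
    using continuous_map_in_carrier[OF f that] continuous_map_in_carrier[OF g that] by auto
  have "f x \<otimes> inv (g x) = \<one>"
    by (rule kernel_valued_constant[OF X, of "\<lambda>x. f x \<otimes> inv (g x)" x0])
      (use f g x0 x eq fG gG in \<open>auto intro!: continuous_map_mult continuous_map_inv\<close>)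
  then show ?thesis using fG[OF x] gG[OF x] inv_solve_right'[of \<one> "f x" "g x"] by simp
qed

text \<open>\<open>topological_group\<close> does not include Hausdorffness, so this comes from the
  base: the kernel is a closed preimage, and translates of \<open>U\<close> cut away its other
  points.\<close>

lemma closedin_one: "closedin T {\<one>}"
proof -
  obtain U where U: "openin T U" "\<one> \<in> U" "\<And>u. u \<in> U \<Longrightarrow> p u = \<one>\<^bsub>B\<^esub> \<Longrightarrow> u = \<one>"
    by (rule kernel_discrete) blast
  have "closedin (top_of_set S) {\<one>\<^bsub>B\<^esub>}" using B.one_closed by (simp add: carrier_B)
  from closedin_continuous_map_preimage[OF p_cont this]
  have K: "closedin T {x \<in> carrier G. p x = \<one>\<^bsub>B\<^esub>}" by simp
  let ?W = "\<Union>k\<in>{k \<in> carrier G. p k = \<one>\<^bsub>B\<^esub> \<and> k \<noteq> \<one>}. {x \<in> carrier G. inv k \<otimes> x \<in> U}"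
  have W: "openin T ?W" by (intro openin_Union) (auto intro: openin_translate[OF U(1)])
  have "{x \<in> carrier G. p x = \<one>\<^bsub>B\<^esub>} - ?W = {\<one>}"
  proof -
    have "\<one> \<notin> ?W"
    proof
      assume "\<one> \<in> ?W"
      then obtain k where k: "k \<in> carrier G" "p k = \<one>\<^bsub>B\<^esub>" "k \<noteq> \<one>" "inv k \<in> U" by auto
      then show False using U(3)[of "inv k"] by simp
    qed
    moreover have "x \<in> ?W" if "x \<in> carrier G" "p x = \<one>\<^bsub>B\<^esub>" "x \<noteq> \<one>" for x
      using that U(2) by (auto intro!: exI[of _ x])
    ultimately show ?thesis by auto
  qed
  then show ?thesis using closedin_diff[OF K W] by simp
qed

text \<open>
  With \<open>V\<close> evenly covered near \<open>\<one>\<close>, the lift is the telescoping product over \<open>i < N\<close> of the lifts of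
  \<open>F (i x / N)\<^sup>-\<^sup>1 F ((i + 1) x / N) \<in> V\<close>, so that no gluing of local lifts is needed.
\<close>

lemma lift_exists:
  fixes F :: "'c::real_normed_vector \<Rightarrow> 'b"
  assumes K: "compact K" "convex K" "0 \<in> K"
    and F: "continuous_on K F" "F ` K \<subseteq> S" and g0: "g0 \<in> carrier G" "p g0 = F 0"
  obtains \<Phi> where "continuous_map (top_of_set K) T \<Phi>" "\<And>x. x \<in> K \<Longrightarrow> p (\<Phi> x) = F x" "\<Phi> 0 = g0"
proof -
  obtain U V s where s: "sheet U V s" by (rule sheet_exists)
  obtain O1 where O1: "open O1" "V = S \<inter> O1" using sheetD(3)[OF s] by (auto simp: openin_open)
  then obtain \<delta> where \<delta>: "\<delta> > 0" "\<And>y. dist y \<one>\<^bsub>B\<^esub> < \<delta> \<Longrightarrow> y \<in> O1"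
    using sheetD(4)[OF s] open_dist[of O1] by (metis IntD2)
  define E where "E = (\<lambda>(x, y). inv\<^bsub>B\<^esub> (F x) \<otimes>\<^bsub>B\<^esub> F y)"
  have FS: "F x \<in> S" if "x \<in> K" for x using F(2) that by blast
  have FK: "continuous_map (top_of_set K) (top_of_set S) F" using F by auto
  have "continuous_map (prod_topology (top_of_set K) (top_of_set K)) (top_of_set S)
      (\<lambda>y. inv\<^bsub>B\<^esub> (F (fst y)) \<otimes>\<^bsub>B\<^esub> F (snd y))"
    using continuous_map_compose[OF continuous_map_fst FK, of "top_of_set K"]
      continuous_map_compose[OF continuous_map_snd FK, of "top_of_set K"]
    by (intro B.continuous_map_mult B.continuous_map_inv) (simp_all only: o_def)
  then have E_cont: "continuous_on (K \<times> K) E" by (simp add: E_def case_prod_unfold)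
  \<comment> \<open>On the diagonal \<open>E\<close> is the identity, so uniform continuity brings
    all sufficiently close pairs into \<open>V\<close>.\<close>
  have "uniformly_continuous_on (K \<times> K) E"
    by (rule compact_uniformly_continuous[OF E_cont compact_Times[OF K(1) K(1)]])
  then obtain \<epsilon> where \<epsilon>: "\<epsilon> > 0"
      "\<And>y z. y \<in> K \<times> K \<Longrightarrow> z \<in> K \<times> K \<Longrightarrow> dist z y < \<epsilon> \<Longrightarrow> dist (E z) (E y) < \<delta>"
    unfolding uniformly_continuous_on_def using \<delta>(1) by metis
  have E_in: "E (x, y) \<in> V" if "x \<in> K" "y \<in> K" "dist x y < \<epsilon>" for x y
  proof -
    have "dist (x, y) (x, x) < \<epsilon>" using that by (simp add: dist_Pair_Pair dist_commute)
    then have "dist (E (x, y)) (E (x, x)) < \<delta>" using \<epsilon>(2) that by blast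
    moreover have "E (x, x) = \<one>\<^bsub>B\<^esub>" using FS[OF that(1)] by (simp add: E_def carrier_B[symmetric])
    moreover have "E (x, y) \<in> S"
      using FS that by (simp add: E_def carrier_B[symmetric])
    ultimately show ?thesis using \<delta>(2) O1(2) by simp
  qed
  obtain b where b: "\<And>x. x \<in> K \<Longrightarrow> norm x \<le> b" using compact_imp_bounded[OF K(1)] bounded_iff by blast
  obtain N :: nat where N: "N > 0" "b / N < \<epsilon>"
  proof -
    obtain n :: nat where "b / \<epsilon> < n" using reals_Archimedean2 by blast
    \<comment> \<open>The successor keeps the number of subdivisions positive.\<close>
    then have "b / \<epsilon> < Suc n" by simp
    then have "b / Suc n < \<epsilon>" using \<epsilon>(1) by (simp add: field_simps)
    then show thesis using that[of "Suc n"] by simp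
  qed
  define c where "c i x = (real i / real N) *\<^sub>R x" for i and x :: 'c
  have cK: "c i x \<in> K" if "i \<le> N" "x \<in> K" for i x
  proof -
    have "c i x = (1 - real i / real N) *\<^sub>R 0 + (real i / real N) *\<^sub>R x" by (simp add: c_def)
    also have "\<dots> \<in> K"
      by (rule convexD_alt[OF K(2,3) that(2)]) (use that N(1) in auto)
    finally show ?thesis .
  qed
  have "\<exists>\<Phi>. continuous_map (top_of_set K) T \<Phi> \<and> (\<forall>x\<in>K. p (\<Phi> x) = F (c i x)) \<and> \<Phi> 0 = g0"
    if "i \<le> N" for i
    using that
  proof (induction i)
    case 0
    show ?case by (rule exI[of _ "\<lambda>_. g0"]) (use g0 in \<open>simp add: c_def\<close>)
  next
    case (Suc i)
    then obtain \<Phi> where \<Phi>: "continuous_map (top_of_set K) T \<Phi>" "\<And>x. x \<in> K \<Longrightarrow> p (\<Phi> x) = F (c i x)"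
      "\<Phi> 0 = g0" by auto
    let ?e = "\<lambda>x. E (c i x, c (Suc i) x)"
    have e: "?e x \<in> V" if "x \<in> K" for x
    proof (rule E_in)
      show "c i x \<in> K" "c (Suc i) x \<in> K" using Suc.prems that cK by auto
      have "c (Suc i) x - c i x = (1 / real N) *\<^sub>R x"
        unfolding c_def scaleR_left_diff_distrib[symmetric] by (simp add: diff_divide_distrib[symmetric])
      then have "dist (c i x) (c (Suc i) x) = norm x / N"
        by (simp add: dist_norm norm_minus_commute[of "c i x"])
      also have "\<dots> \<le> b / N" using b[OF that] N(1) by (simp add: divide_right_mono)
      finally show "dist (c i x) (c (Suc i) x) < \<epsilon>" using N(2) by simp
    qed
    have "continuous_on K ?e"
    proof (rule continuous_on_compose2[OF E_cont])
      show "continuous_on K (\<lambda>x. (c i x, c (Suc i) x))"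
        unfolding c_def by (intro continuous_intros)
      show "(\<lambda>x. (c i x, c (Suc i) x)) ` K \<subseteq> K \<times> K"
        using cK[of i] cK[OF Suc.prems] Suc.prems by auto
    qed
    then have "continuous_map (top_of_set K) (top_of_set V) ?e" using e by auto
    from continuous_map_compose[OF this sheetD(5)[OF s]]
    have cont: "continuous_map (top_of_set K) T (\<lambda>x. \<Phi> x \<otimes> s (?e x))"
      by (intro continuous_map_mult \<Phi>(1)) (simp add: o_def)
    show ?case
    proof (intro exI[of _ "\<lambda>x. \<Phi> x \<otimes> s (?e x)"] conjI ballI cont)
      fix x assume x: "x \<in> K"
      have "\<Phi> x \<in> carrier G" using continuous_map_in_carrier[OF \<Phi>(1)] x by simp
      moreover have "s (?e x) \<in> carrier G"
        using sheetD(6)[OF s e[OF x]] openin_subset[OF sheetD(1)[OF s]] by auto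
      ultimately have "p (\<Phi> x \<otimes> s (?e x)) = F (c i x) \<otimes>\<^bsub>B\<^esub> ?e x"
        using \<Phi>(2)[OF x] sheetD(7)[OF s e[OF x]] by simp
      also have "\<dots> = F (c (Suc i) x)"
      proof -
        have "F (c i x) \<in> carrier B" "F (c (Suc i) x) \<in> carrier B" using FS cK Suc.prems x by (auto simp: carrier_B)
        then show ?thesis by (simp add: E_def B.m_assoc[symmetric])
      qed
      finally show "p (\<Phi> x \<otimes> s (?e x)) = F (c (Suc i) x)" .
    next
      have "F 0 \<in> carrier B" using FS[OF K(3)] by (simp add: carrier_B)
      then have "?e 0 = \<one>\<^bsub>B\<^esub>" by (simp add: E_def c_def)
      then show "\<Phi> 0 \<otimes> s (?e 0) = g0" using \<Phi>(3) g0 sheet_one[OF s] by simp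
    qed
  qed
  from this[of N] obtain \<Phi> where \<Phi>: "continuous_map (top_of_set K) T \<Phi>"
    "\<forall>x\<in>K. p (\<Phi> x) = F (c N x)" "\<Phi> 0 = g0" by auto
  show thesis by (rule that[OF \<Phi>(1) _ \<Phi>(3)]) (use \<Phi>(2) N(1) in \<open>simp add: c_def\<close>)
qed

text \<open>The local section \<open>s\<close> carries short paths in the base group to short paths
  from \<open>\<one>\<close> in \<open>G\<close>.\<close>

lemma locally_path_connected_lift:
  assumes base: "\<And>N. openin (top_of_set S) N \<Longrightarrow> \<one>\<^bsub>B\<^esub> \<in> N \<Longrightarrow> \<exists>N'. openin (top_of_set S) N' \<and> \<one>\<^bsub>B\<^esub> \<in> N' \<and>
      (\<forall>k\<in>N'. \<exists>q. pathin (top_of_set S) q \<and> q 0 = \<one>\<^bsub>B\<^esub> \<and> q 1 = k \<and> q ` {0..1} \<subseteq> N)"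
    and N: "openin T N" "\<one> \<in> N"
  shows "\<exists>N'. openin T N' \<and> \<one> \<in> N' \<and> (\<forall>k\<in>N'. \<exists>q. pathin T q \<and> q 0 = \<one> \<and> q 1 = k \<and> q ` {0..1} \<subseteq> N)"
proof -
  obtain U V s where s: "sheet U V s" by (rule sheet_exists)
  let ?M = "{v \<in> V. s v \<in> N}"
  have "openin (top_of_set V) ?M"
    using openin_continuous_map_preimage[OF sheetD(5)[OF s] N(1)] by simp
  then have "openin (top_of_set S) ?M"
    by (rule openin_trans) (rule sheetD(3)[OF s])
  moreover have "\<one>\<^bsub>B\<^esub> \<in> ?M" using sheetD(4)[OF s] sheet_one[OF s] N(2) by simp
  ultimately obtain M' where M': "openin (top_of_set S) M'" "\<one>\<^bsub>B\<^esub> \<in> M'"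
      "\<And>k. k \<in> M' \<Longrightarrow> \<exists>q. pathin (top_of_set S) q \<and> q 0 = \<one>\<^bsub>B\<^esub> \<and> q 1 = k \<and> q ` {0..1} \<subseteq> ?M"
    using base[of ?M] by blast
  \<comment> \<open>Intersecting with the sheet \<open>U\<close> ensures that the lifted path ends
    at \<open>k\<close> itself and not at another point with the same image.\<close>
  let ?N' = "U \<inter> {x \<in> topspace T. p x \<in> M'}"
  show ?thesis
  proof (intro exI[of _ ?N'] conjI ballI)
    show "openin T ?N'"
      by (intro openin_Int sheetD(1)[OF s] openin_continuous_map_preimage[OF p_cont M'(1)])
    show "\<one> \<in> ?N'" using sheetD(2)[OF s] M'(2) by simp
    fix k assume k: "k \<in> ?N'"
    then obtain q where q: "pathin (top_of_set S) q" "q 0 = \<one>\<^bsub>B\<^esub>" "q 1 = p k" "q ` {0..1} \<subseteq> ?M"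
      using M'(3)[of "p k"] by auto
    have "continuous_map (top_of_set {0..1}) (top_of_set V) q"
      using q(1,4) by (auto simp: pathin_def continuous_map_in_subtopology)
    from continuous_map_compose[OF this sheetD(5)[OF s]]
    have "pathin T (s \<circ> q)" by (simp add: pathin_def)
    moreover have "(s \<circ> q) 0 = \<one>" using q(2) sheet_one[OF s] by simp
    moreover have "(s \<circ> q) 1 = k" using q(3) sheetD(9)[OF s] k by simp
    moreover have "(s \<circ> q) ` {0..1} \<subseteq> N" using q(4) by auto
    ultimately show "\<exists>q. pathin T q \<and> q 0 = \<one> \<and> q 1 = k \<and> q ` {0..1} \<subseteq> N" by blast
  qed
qed

end

section \<open>Gram--Schmidt orthonormalization\<close>

text \<open>The inner product is the real one, even when the vectors are complex: the change of
  basis has to be real to preserve the span of a Lagrangian frame. \<open>sgn\<close> normalises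
  nonzero vectors and sends 0 to 0, which keeps the recursion total.\<close>

function gram_schmidt :: "(nat \<Rightarrow> 'v::real_inner) \<Rightarrow> nat \<Rightarrow> 'v" where
  "gram_schmidt v k = sgn (v k - (\<Sum>j<k. (v k \<bullet> gram_schmidt v j) *\<^sub>R gram_schmidt v j))"
  by auto
termination by (relation "inv_image less_than snd") auto

declare gram_schmidt.simps [simp del]

text \<open>Linear independence in incremental form, for families rather than sets; it says exactly
  that no residue in the Gram--Schmidt recursion vanishes.\<close>

definition independent_family :: "(nat \<Rightarrow> 'v::real_vector) \<Rightarrow> nat \<Rightarrow> bool" where
  "independent_family v n \<longleftrightarrow> (\<forall>k<n. v k \<notin> span (v ` {..<k}))"

lemma independent_family_mono: "independent_family v n \<Longrightarrow> m \<le> n \<Longrightarrow> independent_family v m"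
  by (auto simp: independent_family_def)

lemma independent_family_sum_zero:
  assumes "independent_family v n" "(\<Sum>k<n. x k *\<^sub>R v k) = 0" "k < n"
  shows "x k = 0"
  using assms
proof (induction n)
  case (Suc n)
  have "x n = 0"
  proof (rule ccontr)
    assume "x n \<noteq> 0"
    have "x n *\<^sub>R v n = - (\<Sum>k<n. x k *\<^sub>R v k)"
      using Suc.prems(2) by (simp add: eq_neg_iff_add_eq_0 add.commute)
    moreover have "v n = (1 / x n) *\<^sub>R (x n *\<^sub>R v n)" using \<open>x n \<noteq> 0\<close> by simp
    ultimately have "v n = (1 / x n) *\<^sub>R - (\<Sum>k<n. x k *\<^sub>R v k)" by (simp only:)
    also have "\<dots> \<in> span (v ` {..<n})"
      by (intro span_scale span_neg span_sum span_base) auto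
    finally show False using Suc.prems(1) by (auto simp: independent_family_def)
  qed
  then have "(\<Sum>k<n. x k *\<^sub>R v k) = 0" using Suc.prems(2) by simp
  then show ?case
    using Suc.IH independent_family_mono[OF Suc.prems(1), of n] Suc.prems(3) \<open>x n = 0\<close>
    by (cases "k = n") auto
qed simp

lemma span_image_lessThan:
  "span (v ` {..<k}) \<subseteq> range (\<lambda>x. \<Sum>j<k::nat. x j *\<^sub>R (v j :: 'v::real_vector))"
proof (rule span_minimal)
  show "v ` {..<k} \<subseteq> range (\<lambda>x. \<Sum>j<k. x j *\<^sub>R v j)"
  proof clarify
    fix i assume "i < k"
    then have "v i = (\<Sum>j<k. (if j = i then 1 else 0) *\<^sub>R v j)"
      by (simp add: if_distrib[of "\<lambda>c. c *\<^sub>R _"] cong: if_cong)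
    then show "v i \<in> range (\<lambda>x. \<Sum>j<k. x j *\<^sub>R v j)"
      by (rule range_eqI[of _ "\<lambda>x. \<Sum>j<k. x j *\<^sub>R v j" "\<lambda>j. if j = i then 1 else 0"])
  qed
  show "subspace (range (\<lambda>x. \<Sum>j<k. x j *\<^sub>R v j))"
  proof (rule subspaceI)
    show "0 \<in> range (\<lambda>x. \<Sum>j<k. x j *\<^sub>R v j)" by (rule range_eqI[of _ _ "\<lambda>_. 0"]) simp
  next
    fix a b assume "a \<in> range (\<lambda>x. \<Sum>j<k. x j *\<^sub>R v j)" "b \<in> range (\<lambda>x. \<Sum>j<k. x j *\<^sub>R v j)"
    then obtain x y where "a = (\<Sum>j<k. x j *\<^sub>R v j)" "b = (\<Sum>j<k. y j *\<^sub>R v j)" by auto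
    then show "a + b \<in> range (\<lambda>x. \<Sum>j<k. x j *\<^sub>R v j)"
      by (intro range_eqI[of _ _ "\<lambda>j. x j + y j"]) (simp add: scaleR_left_distrib sum.distrib)
  next
    fix c a assume "a \<in> range (\<lambda>x. \<Sum>j<k. x j *\<^sub>R v j)"
    then obtain x where "a = (\<Sum>j<k. x j *\<^sub>R v j)" by auto
    then show "c *\<^sub>R a \<in> range (\<lambda>x. \<Sum>j<k. x j *\<^sub>R v j)"
      by (intro range_eqI[of _ _ "\<lambda>j. c * x j"]) (simp add: scaleR_sum_right)
  qed
qed

lemma independent_familyI:
  assumes "\<And>x. (\<Sum>k<n. x k *\<^sub>R v k) = 0 \<Longrightarrow> \<forall>k<n. x k = 0"
  shows "independent_family v n"
  unfolding independent_family_def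
proof (intro allI impI notI)
  fix k assume k: "k < n" and "v k \<in> span (v ` {..<k})"
  then have "v k \<in> range (\<lambda>x. \<Sum>j<k. x j *\<^sub>R v j)" using span_image_lessThan by blast
  then obtain x where x: "v k = (\<Sum>j<k. x j *\<^sub>R v j)" by blast
  \<comment> \<open>The expression of \<open>v k\<close> by its predecessors, written as a relation
    with coefficient -1 at \<open>k\<close> and padded with zeros.\<close>
  define y where "y j = (if j < k then x j else if j = k then - 1 else 0)" for j
  have "(\<Sum>j<n. y j *\<^sub>R v j) = (\<Sum>j<Suc k. y j *\<^sub>R v j)"
    by (rule sum.mono_neutral_right) (use k in \<open>auto simp: y_def\<close>)
  also have "\<dots> = 0" using x by (simp add: y_def)
  finally show False using assms[of y] k by (auto simp: y_def)
qed

lemma gram_schmidt_in_span: "gram_schmidt v k \<in> span (v ` {..k})"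
proof (induction k rule: less_induct)
  case (less k)
  have "gram_schmidt v j \<in> span (v ` {..k})" if "j < k" for j
    using less[OF that] span_mono[of "v ` {..j}" "v ` {..k}"] that by fastforce
  then have "v k - (\<Sum>j<k. (v k \<bullet> gram_schmidt v j) *\<^sub>R gram_schmidt v j) \<in> span (v ` {..k})"
    by (intro span_diff span_sum span_scale) (auto intro: span_base)
  then show ?case by (subst gram_schmidt.simps) (simp add: sgn_div_norm span_scale)
qed

lemma gram_schmidt_sum_in_span: "(\<Sum>j<k. c j *\<^sub>R gram_schmidt v j) \<in> span (v ` {..<k})"
proof (intro span_sum span_scale)
  fix j assume "j \<in> {..<k}"
  then show "gram_schmidt v j \<in> span (v ` {..<k})"
    using gram_schmidt_in_span[of v j] span_mono[of "v ` {..j}" "v ` {..<k}"] by fastforce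
qed

lemma gram_schmidt_residue_nonzero:
  assumes "independent_family v n" "k < n"
  shows "v k - (\<Sum>j<k. (v k \<bullet> gram_schmidt v j) *\<^sub>R gram_schmidt v j) \<noteq> 0"
  using assms gram_schmidt_sum_in_span[of "\<lambda>j. v k \<bullet> gram_schmidt v j" v k] by (auto simp: independent_family_def)

lemma gram_schmidt_orthonormal:
  assumes "independent_family v n" "i < n" "j < n"
  shows "gram_schmidt v i \<bullet> gram_schmidt v j = (if i = j then 1 else 0)"
proof -
  have "\<forall>i<k. \<forall>j<k. gram_schmidt v i \<bullet> gram_schmidt v j = (if i = j then 1 else 0)" if "k \<le> n" for k
    using that
  proof (induction k)
    case (Suc k)
    let ?w = "v k - (\<Sum>j<k. (v k \<bullet> gram_schmidt v j) *\<^sub>R gram_schmidt v j)"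
    have w: "?w \<noteq> 0" using gram_schmidt_residue_nonzero[OF assms(1)] Suc.prems by simp
    have IH: "gram_schmidt v i \<bullet> gram_schmidt v j = (if i = j then 1 else 0)" if "i < k" "j < k" for i j
      using Suc that by simp
    have kk: "gram_schmidt v k \<bullet> gram_schmidt v k = 1"
      using w by (subst (1 2) gram_schmidt.simps) (simp add: norm_sgn flip: power2_norm_eq_inner)
    have kj: "gram_schmidt v k \<bullet> gram_schmidt v j = 0" if "j < k" for j
    proof -
      have "?w \<bullet> gram_schmidt v j = v k \<bullet> gram_schmidt v j - (\<Sum>i<k. (v k \<bullet> gram_schmidt v i) * (gram_schmidt v i \<bullet> gram_schmidt v j))"
        by (simp add: inner_diff_left inner_sum_left)
      also have "(\<Sum>i<k. (v k \<bullet> gram_schmidt v i) * (gram_schmidt v i \<bullet> gram_schmidt v j)) = (\<Sum>i<k. if i = j then v k \<bullet> gram_schmidt v j else 0)"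
        by (rule sum.cong) (use IH that in auto)
      also have "\<dots> = v k \<bullet> gram_schmidt v j" using that by simp
      finally have "?w \<bullet> gram_schmidt v j = 0" by simp
      then show ?thesis by (subst gram_schmidt.simps) (simp add: sgn_div_norm)
    qed
    show ?case using IH kk kj by (auto simp: less_Suc_eq inner_commute)
  qed simp
  from this[of n] show ?thesis using assms by simp
qed

lemma gram_schmidt_of_orthonormal:
  assumes "\<And>i j. i < n \<Longrightarrow> j < n \<Longrightarrow> v i \<bullet> v j = (if i = j then 1 else 0)" "k < n"
  shows "gram_schmidt v k = v k"
  using assms(2)
proof (induction k rule: less_induct)
  case (less k)
  have "(\<Sum>j<k. (v k \<bullet> gram_schmidt v j) *\<^sub>R gram_schmidt v j) = 0"
    by (rule sum.neutral) (use less assms(1) in auto)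
  moreover have "norm (v k) = 1" using assms(1)[of k k] less by (simp add: norm_eq_sqrt_inner)
  ultimately show ?case by (subst gram_schmidt.simps) (simp add: sgn_div_norm)
qed

text \<open>The recursion uses only linear combinations, inner products and norms. This is the
  source of the equivariance under unitary matrices.\<close>

lemma gram_schmidt_linear_isometry:
  assumes "linear f" "\<And>x y. f x \<bullet> f y = x \<bullet> y"
  shows "gram_schmidt (\<lambda>i. f (v i)) k = f (gram_schmidt v k)"
proof (induction k rule: less_induct)
  case (less k)
  have norm: "norm (f x) = norm x" for x using assms(2) by (simp add: norm_eq_sqrt_inner)
  have "(\<Sum>j<k. (f (v k) \<bullet> gram_schmidt (\<lambda>i. f (v i)) j) *\<^sub>R gram_schmidt (\<lambda>i. f (v i)) j) =
      f (\<Sum>j<k. (v k \<bullet> gram_schmidt v j) *\<^sub>R gram_schmidt v j)"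
    unfolding linear_sum[OF assms(1)]
    by (rule sum.cong) (use less assms in \<open>auto simp: linear_scale\<close>)
  then show ?case
    by (subst (1 2) gram_schmidt.simps) (simp add: sgn_div_norm norm linear_scale[OF assms(1)] linear_diff[OF assms(1), symmetric])
qed

text \<open>The positive sign of the diagonal coefficient is the point: it keeps the straight line
  from a frame to its orthonormalization free of degenerate frames.\<close>

lemma gram_schmidt_triangular:
  assumes "independent_family v n" "k < n"
  obtains c y where "c > 0" "y \<in> span (v ` {..<k})" "gram_schmidt v k = c *\<^sub>R v k + y"
proof
  let ?r = "\<Sum>j<k. (v k \<bullet> gram_schmidt v j) *\<^sub>R gram_schmidt v j"
  let ?c = "inverse (norm (v k - ?r))"
  show "?c > 0" using gram_schmidt_residue_nonzero[OF assms] by simp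
  show "- (?c *\<^sub>R ?r) \<in> span (v ` {..<k})"
    by (intro span_neg span_scale gram_schmidt_sum_in_span)
  show "gram_schmidt v k = ?c *\<^sub>R v k + - (?c *\<^sub>R ?r)"
    by (subst gram_schmidt.simps) (simp add: sgn_div_norm scaleR_diff_right)
qed

lemma independent_family_triangular:
  assumes v: "independent_family v n"
    and w: "\<And>k. k < n \<Longrightarrow> \<exists>c>0. \<exists>y\<in>span (v ` {..<k}). w k = c *\<^sub>R v k + y"
  shows "independent_family w n"
  unfolding independent_family_def
proof (intro allI impI notI)
  fix k assume k: "k < n" and wk: "w k \<in> span (w ` {..<k})"
  have "w ` {..<k} \<subseteq> span (v ` {..<k})"
  proof clarify
    fix j assume j: "j < k"
    then obtain c y where y: "y \<in> span (v ` {..<j})" and wj: "w j = c *\<^sub>R v j + y" using w[of j] k by auto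
    have "span (v ` {..<j}) \<subseteq> span (v ` {..<k})" by (rule span_mono) (use j in auto)
    then have "y \<in> span (v ` {..<k})" using y by blast
    moreover have "v j \<in> span (v ` {..<k})" by (rule span_base) (use j in simp)
    ultimately show "w j \<in> span (v ` {..<k})" unfolding wj by (intro span_add span_scale)
  qed
  then have "w k \<in> span (v ` {..<k})" using wk span_minimal[OF _ subspace_span] by blast
  moreover obtain c y where c: "c > 0" "y \<in> span (v ` {..<k})" "w k = c *\<^sub>R v k + y"
    using w[OF k] by auto
  ultimately have "(1 / c) *\<^sub>R (w k - y) \<in> span (v ` {..<k})" by (intro span_scale span_diff)
  then have "v k \<in> span (v ` {..<k})" using c by simp
  then show False using v k by (auto simp: independent_family_def)
qed

text \<open>The interpolated family is again triangular over \<open>v\<close>, with diagonal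
  coefficients that are convex combinations of 1 and a positive number.\<close>

lemma independent_family_interpolate:
  assumes v: "independent_family v n" and s: "0 \<le> s" "s \<le> (1::real)"
  shows "independent_family (\<lambda>k. (1 - s) *\<^sub>R v k + s *\<^sub>R gram_schmidt v k) n"
proof (rule independent_family_triangular[OF v])
  fix k assume "k < n"
  then obtain c y where c: "c > 0" "y \<in> span (v ` {..<k})" "gram_schmidt v k = c *\<^sub>R v k + y"
    by (rule gram_schmidt_triangular[OF v])
  show "\<exists>c>0. \<exists>y\<in>span (v ` {..<k}). (1 - s) *\<^sub>R v k + s *\<^sub>R gram_schmidt v k = c *\<^sub>R v k + y"
  proof (intro exI[of _ "1 - s + s * c"] conjI bexI[of _ "s *\<^sub>R y"])
    show "1 - s + s * c > 0"
    proof (cases "s = 1")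
      case False
      then have "1 - s > 0" "s * c \<ge> 0" using s c(1) by auto
      then show ?thesis by linarith
    qed (use c in simp)
    show "(1 - s) *\<^sub>R v k + s *\<^sub>R gram_schmidt v k = (1 - s + s * c) *\<^sub>R v k + s *\<^sub>R y"
      by (simp add: c(3) scaleR_right_distrib scaleR_left_distrib)
    show "s *\<^sub>R y \<in> span (v ` {..<k})" using c(2) by (rule span_scale)
  qed
qed

text \<open>Normalisation is continuous away from 0, and independence keeps every residue away from
  0.\<close>

lemma continuous_on_gram_schmidt:
  assumes "\<And>k. k < n \<Longrightarrow> continuous_on S (\<lambda>t. v t k)" "\<And>t. t \<in> S \<Longrightarrow> independent_family (v t) n" "k < n"
  shows "continuous_on S (\<lambda>t. gram_schmidt (v t) k)"
  using assms(3)
proof (induction k rule: less_induct)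
  case (less k)
  have "continuous_on S (\<lambda>t. sgn (v t k - (\<Sum>j<k. (v t k \<bullet> gram_schmidt (v t) j) *\<^sub>R gram_schmidt (v t) j)))"
    by (intro continuous_on_sgn continuous_intros assms(1) less ballI gram_schmidt_residue_nonzero[OF assms(2)])
      (use less in auto)
  then show ?case by (subst gram_schmidt.simps)
qed

section \<open>Block matrices and the symplectic group\<close>

lemma matrix_add_rdistrib:
  "(A + B) ** C = A ** C + B ** (C :: 'a::comm_ring_1^'n^'m)"
  by (simp add: vec_eq_iff matrix_matrix_mult_def sum.distrib distrib_right)

lemma matrix_diff_rdistrib:
  "(A - B) ** C = A ** C - B ** (C :: 'a::comm_ring_1^'n^'m)"
  by (simp add: vec_eq_iff matrix_matrix_mult_def sum_subtractf left_diff_distrib)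

lemma matrix_diff_ldistrib:
  "A ** (B - C) = A ** B - A ** (C :: 'a::comm_ring_1^'n^'m)"
  by (simp add: vec_eq_iff matrix_matrix_mult_def sum_subtractf right_diff_distrib)

lemma matrix_minus_left: "(- A) ** B = - (A ** (B :: 'a::comm_ring_1^'n^'m))"
  by (simp add: vec_eq_iff matrix_matrix_mult_def sum_negf)

lemma matrix_minus_right: "A ** (- B) = - (A ** (B :: 'a::comm_ring_1^'n^'m))"
  by (simp add: vec_eq_iff matrix_matrix_mult_def sum_negf)

lemma matrix_zero_left: "0 ** B = (0 :: 'a::comm_ring_1^'n^'m)"
  by (simp add: vec_eq_iff matrix_matrix_mult_def)

lemma matrix_zero_right: "A ** 0 = (0 :: 'a::comm_ring_1^'n^'m)"
  by (simp add: vec_eq_iff matrix_matrix_mult_def)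

lemma matrix_scaleR_left: "(c *\<^sub>R A) ** B = c *\<^sub>R (A ** (B :: real^'n^'m))"
  by (simp add: vec_eq_iff matrix_matrix_mult_def sum_distrib_left mult.assoc)

lemma matrix_scaleR_right: "A ** (c *\<^sub>R B) = c *\<^sub>R (A ** (B :: real^'n^'m))"
  by (simp add: vec_eq_iff matrix_matrix_mult_def sum_distrib_left mult.left_commute)

lemma transpose_diff: "transpose (A - B) = transpose A - transpose (B :: 'a::comm_ring_1^'n^'m)"
  by (simp add: vec_eq_iff transpose_def)

lemma transpose_add: "transpose (A + B) = transpose A + transpose (B :: 'a::comm_ring_1^'n^'m)"
  by (simp add: vec_eq_iff transpose_def)

lemma transpose_minus: "transpose (- A) = - transpose (A :: 'a::comm_ring_1^'n^'m)"
  by (simp add: vec_eq_iff transpose_def)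

lemma transpose_zero: "transpose 0 = (0 :: 'a::zero^'n^'m)"
  by (simp add: vec_eq_iff transpose_def)

lemmas matrix_algebra = matrix_add_rdistrib matrix_add_ldistrib matrix_diff_rdistrib
  matrix_diff_ldistrib matrix_minus_left matrix_minus_right matrix_zero_left matrix_zero_right
  matrix_scaleR_left matrix_scaleR_right transpose_diff transpose_add transpose_minus
  transpose_zero transpose_scalar matrix_transpose_mul

lemma continuous_on_matrix_mult [continuous_intros]:
  fixes f :: "'a::topological_space \<Rightarrow> 'b::real_normed_algebra_1^'n^'m"
  assumes "continuous_on S f" "continuous_on S g"
  shows "continuous_on S (\<lambda>x. f x ** g x)"
  unfolding matrix_matrix_mult_def using assms by (intro continuous_intros)

lemma continuous_on_transpose [continuous_intros]:
  fixes f :: "'a::topological_space \<Rightarrow> 'b::topological_space^'n^'m"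
  assumes "continuous_on S f"
  shows "continuous_on S (\<lambda>x. transpose (f x))"
  unfolding transpose_def using assms by (intro continuous_intros)

lemma continuous_on_det [continuous_intros]:
  fixes f :: "'a::topological_space \<Rightarrow> 'b::{real_normed_algebra_1, comm_ring_1}^'n^'n"
  assumes "continuous_on S f"
  shows "continuous_on S (\<lambda>x. det (f x))"
  unfolding det_def using assms by (intro continuous_intros)

lemma matrix_inv_eqI:
  fixes A :: "'a::field^'n^'n"
  assumes "A ** B = mat 1"
  shows "matrix_inv A = B"
proof -
  have BA: "B ** A = mat 1" using assms matrix_left_right_inverse by blast
  have "A ** matrix_inv A = mat 1 \<and> matrix_inv A ** A = mat 1"
    unfolding matrix_inv_def by (rule someI[of _ B]) (use assms BA in blast)
  then have "B ** (A ** matrix_inv A) = B" by simp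
  then show ?thesis by (simp add: matrix_mul_assoc BA)
qed

lemma matrix_inv_inverse:
  fixes A :: "'a::field^'n^'n"
  assumes "invertible A"
  shows "A ** matrix_inv A = mat 1" "matrix_inv A ** A = mat 1"
  using assms matrix_inv_eqI unfolding invertible_def by metis+

text \<open>By Cramer's rule each entry of the inverse is a quotient of determinants.\<close>

lemma continuous_on_matrix_inv [continuous_intros]:
  fixes f :: "'a::topological_space \<Rightarrow> real^'n^'n"
  assumes f: "continuous_on S f" and inv: "\<And>x. x \<in> S \<Longrightarrow> invertible (f x)"
  shows "continuous_on S (\<lambda>x. matrix_inv (f x))"
proof -
  have "matrix_inv A = (\<chi> k l. det (\<chi> i j. if j = k then axis l 1 $ i else A $ i $ j) / det A)"
    if "invertible A" for A :: "real^'n^'n"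
  proof -
    have "A *v (matrix_inv A *v axis l 1) = axis l 1" for l
      by (simp add: matrix_vector_mul_assoc matrix_inv_inverse[OF that] del: matrix_vector_mult_basis)
    then have "matrix_inv A *v axis l 1 = (\<chi> k. det (\<chi> i j. if j = k then axis l 1 $ i else A $ i $ j) / det A)" for l
      using cramer[of A] that invertible_det_nz[of A] by blast
    then have "column l (matrix_inv A) = (\<chi> k. det (\<chi> i j. if j = k then axis l 1 $ i else A $ i $ j) / det A)" for l
      by (simp add: matrix_vector_mult_basis)
    then show ?thesis by (simp add: vec_eq_iff column_def)
  qed
  moreover have "continuous_on S (\<lambda>x. \<chi> k l. det (\<chi> i j. if j = k then axis l 1 $ i else f x $ i $ j) / det (f x))"
  proof (intro continuous_on_vec_lambda continuous_on_divide continuous_on_det f ballI)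
    fix i j k l
    show "continuous_on S (\<lambda>x. if j = k then axis l 1 $ i else f x $ i $ j)"
      using f by (cases "j = k") (auto intro!: continuous_intros)
  next
    fix x assume "x \<in> S"
    then show "det (f x) \<noteq> 0" using inv invertible_det_nz by blast
  qed
  ultimately show ?thesis using inv by (simp cong: continuous_on_cong)
qed

section \<open>Block decompositions\<close>

lemma sum_UNIV_Plus:
  "(\<Sum>x\<in>(UNIV :: ('a::finite + 'b::finite) set). f x) = (\<Sum>a\<in>UNIV. f (Inl a)) + (\<Sum>b\<in>UNIV. f (Inr b))"
  using sum.Plus[of UNIV UNIV f] by (simp add: o_def)

lemma block_matrix_nth [simp]:
  "block_matrix A B C D $ Inl i $ Inl j = A $ i $ j"
  "block_matrix A B C D $ Inl i $ Inr j = B $ i $ j"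
  "block_matrix A B C D $ Inr i $ Inl j = C $ i $ j"
  "block_matrix A B C D $ Inr i $ Inr j = D $ i $ j"
  by (simp_all add: block_matrix_def)

lemma matrix_eq_Plus_iff:
  fixes M N :: "'a^('n::finite + 'n)^('n + 'n)"
  shows "M = N \<longleftrightarrow> (\<forall>i j. M $ Inl i $ Inl j = N $ Inl i $ Inl j \<and> M $ Inl i $ Inr j = N $ Inl i $ Inr j \<and>
    M $ Inr i $ Inl j = N $ Inr i $ Inl j \<and> M $ Inr i $ Inr j = N $ Inr i $ Inr j)"
  by (auto simp: vec_eq_iff split_sum_all)

lemma block_matrix_eq_iff:
  "block_matrix A B C D = block_matrix A' B' C' D' \<longleftrightarrow> A = A' \<and> B = B' \<and> C = C' \<and> D = D'"
  unfolding matrix_eq_Plus_iff by (auto simp: vec_eq_iff)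

lemma block_matrix_mult:
  "block_matrix A B C D ** block_matrix A' B' C' D' =
    block_matrix (A ** A' + B ** C') (A ** B' + B ** D') (C ** A' + D ** C') (C ** B' + D ** D')"
  unfolding matrix_eq_Plus_iff by (simp add: matrix_matrix_mult_def sum_UNIV_Plus)

lemma transpose_block_matrix:
  "transpose (block_matrix A B C D) = block_matrix (transpose A) (transpose C) (transpose B) (transpose D)"
  unfolding matrix_eq_Plus_iff by (simp add: transpose_def)

lemma block_matrix_one: "block_matrix (mat 1) 0 0 (mat 1) = mat 1"
  unfolding matrix_eq_Plus_iff by (simp add: mat_def)

definition "upper_left M = (\<chi> i j. M $ Inl i $ Inl j)"
definition "upper_right M = (\<chi> i j. M $ Inl i $ Inr j)"
definition "lower_left M = (\<chi> i j. M $ Inr i $ Inl j)"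
definition "lower_right M = (\<chi> i j. M $ Inr i $ Inr j)"

lemmas blocks_defs = upper_left_def upper_right_def lower_left_def lower_right_def

lemma blocks_block_matrix [simp]:
  "upper_left (block_matrix A B C D) = A" "upper_right (block_matrix A B C D) = B"
  "lower_left (block_matrix A B C D) = C" "lower_right (block_matrix A B C D) = D"
  by (simp_all add: blocks_defs vec_eq_iff)

lemma block_matrix_blocks: "block_matrix (upper_left M) (upper_right M) (lower_left M) (lower_right M) = M"
  unfolding matrix_eq_Plus_iff by (simp add: blocks_defs)

lemma continuous_on_blocks [continuous_intros]:
  fixes f :: "'a::topological_space \<Rightarrow> 'b::topological_space^('n::finite + 'n)^('n + 'n)"
  assumes "continuous_on S f"
  shows "continuous_on S (\<lambda>x. upper_left (f x))" "continuous_on S (\<lambda>x. upper_right (f x))"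
    "continuous_on S (\<lambda>x. lower_left (f x))" "continuous_on S (\<lambda>x. lower_right (f x))"
  unfolding blocks_defs by (intro continuous_intros assms)+

lemma continuous_on_block_matrix [continuous_intros]:
  fixes A B C D :: "'a::topological_space \<Rightarrow> 'b::topological_space^'n::finite^'n"
  assumes "continuous_on S A" "continuous_on S B" "continuous_on S C" "continuous_on S D"
  shows "continuous_on S (\<lambda>x. block_matrix (A x) (B x) (C x) (D x))"
  unfolding block_matrix_def
proof (intro continuous_on_vec_lambda)
  fix i j
  show "continuous_on S (\<lambda>x. case i of
      Inl a \<Rightarrow> (case j of Inl b \<Rightarrow> A x $ a $ b | Inr b \<Rightarrow> B x $ a $ b)
    | Inr a \<Rightarrow> (case j of Inl b \<Rightarrow> C x $ a $ b | Inr b \<Rightarrow> D x $ a $ b))"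
    using assms by (cases i; cases j) (auto intro!: continuous_intros)
qed

section \<open>Unitary matrices and their real form\<close>

definition adjoint_matrix :: "complex^'n^'m \<Rightarrow> complex^'m^'n" where
  "adjoint_matrix U = transpose (map_matrix cnj U)"

definition unitary_matrices :: "(complex^'n^'n::finite) set" where
  "unitary_matrices = {U. adjoint_matrix U ** U = mat 1}"

lemma special_unitary_eq: "special_unitary = {U \<in> unitary_matrices. det U = 1}"
  by (simp add: special_unitary_def unitary_matrices_def adjoint_matrix_def)

lemma adjoint_matrix_nth [simp]: "adjoint_matrix U $ i $ j = cnj (U $ j $ i)"
  by (simp add: adjoint_matrix_def transpose_def)

lemma adjoint_matrix_mult: "adjoint_matrix (U ** V) = adjoint_matrix V ** adjoint_matrix U"
  by (simp add: vec_eq_iff matrix_matrix_mult_def mult.commute)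

lemma adjoint_adjoint [simp]: "adjoint_matrix (adjoint_matrix U) = U"
  by (simp add: vec_eq_iff)

lemma unitary_matricesD:
  assumes "U \<in> unitary_matrices"
  shows "adjoint_matrix U ** U = mat 1" "U ** adjoint_matrix U = mat 1"
  using assms matrix_left_right_inverse[of U "adjoint_matrix U"] by (auto simp: unitary_matrices_def)

lemma adjoint_unitary: "U \<in> unitary_matrices \<Longrightarrow> adjoint_matrix U \<in> unitary_matrices"
  using unitary_matricesD(2)[of U] by (simp add: unitary_matrices_def)

lemma mult_unitary:
  assumes "U \<in> unitary_matrices" "V \<in> unitary_matrices"
  shows "U ** V \<in> unitary_matrices"
proof -
  have "adjoint_matrix (U ** V) ** (U ** V) = adjoint_matrix V ** (adjoint_matrix U ** U) ** V"
    by (simp add: adjoint_matrix_mult matrix_mul_assoc)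
  then show ?thesis using assms by (simp add: unitary_matrices_def)
qed

lemma norm_det_unitary:
  assumes "U \<in> unitary_matrices"
  shows "norm (det U) = 1"
proof -
  have "det (map_matrix cnj U) = cnj (det U)"
    by (simp add: det_def)
  then have "cnj (det U) * det U = 1"
    using arg_cong[OF unitary_matricesD(1)[OF assms], of det]
    by (simp add: adjoint_matrix_def det_mul)
  then have "(norm (det U))\<^sup>2 = 1"
    by (metis complex_norm_square mult.commute of_real_eq_1_iff)
  then show ?thesis using norm_ge_zero[of "det U"] by (simp add: power2_eq_1_iff del: norm_ge_zero)
qed

lemma unitary_embed_nth [simp]:
  "unitary_embed U $ Inl i $ Inl j = Re (U $ i $ j)"
  "unitary_embed U $ Inl i $ Inr j = - Im (U $ i $ j)"
  "unitary_embed U $ Inr i $ Inl j = Im (U $ i $ j)"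
  "unitary_embed U $ Inr i $ Inr j = Re (U $ i $ j)"
  by (simp_all add: unitary_embed_def)

lemma unitary_embed_mult: "unitary_embed (U ** V) = unitary_embed U ** unitary_embed V"
  unfolding matrix_eq_Plus_iff
  by (simp add: matrix_matrix_mult_def sum_UNIV_Plus sum_subtractf sum.distrib sum_negf)

lemma unitary_embed_one: "unitary_embed (mat 1) = mat 1"
  unfolding matrix_eq_Plus_iff by (simp add: mat_def)

lemma unitary_embed_adjoint: "unitary_embed (adjoint_matrix U) = transpose (unitary_embed U)"
  unfolding matrix_eq_Plus_iff by (simp add: transpose_def)

lemma unitary_embed_eq_iff: "unitary_embed U = unitary_embed V \<longleftrightarrow> U = V"
  unfolding matrix_eq_Plus_iff by (auto simp: vec_eq_iff complex_eq_iff)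

text \<open>Under the identification of real 2n-space with complex n-space, \<open>Omega\<close> is
  multiplication by \<open>-\<i>\<close>. For embedded matrices the symplectic relation therefore
  turns into unitarity, and commuting with \<open>Omega\<close> means complex linearity.\<close>

lemma Omega_eq: "Omega = unitary_embed (mat (- \<i>))"
  unfolding matrix_eq_Plus_iff by (simp add: Omega_def mat_def)

lemma mat_mult_mat: "mat a ** mat b = (mat (a * b) :: 'a::comm_ring_1^'n^'n)"
  by (simp add: vec_eq_iff matrix_matrix_mult_def mat_def if_distrib[of "\<lambda>x. x * _"] cong: if_cong)

lemma adjoint_mat: "adjoint_matrix (mat c) = mat (cnj c)"
  by (simp add: vec_eq_iff mat_def)

lemma mat_commute: "mat c ** U = U ** mat (c :: 'a::comm_ring_1)"
  by (simp add: vec_eq_iff matrix_matrix_mult_def mat_def if_distrib[of "\<lambda>x. x * _"] if_distrib[of "\<lambda>x. _ * x"] mult.commute cong: if_cong)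

lemma continuous_on_unitary_embed [continuous_intros]:
  fixes f :: "'a::topological_space \<Rightarrow> complex^'n::finite^'n"
  assumes "continuous_on S f"
  shows "continuous_on S (\<lambda>x. unitary_embed (f x))"
  unfolding unitary_embed_def map_matrix_def using assms by (intro continuous_intros)

section \<open>Membership in the symplectic group\<close>

lemma Sp_mult: "M \<in> Sp \<Longrightarrow> N \<in> Sp \<Longrightarrow> M ** N \<in> Sp"
proof -
  assume M: "M \<in> Sp" and N: "N \<in> Sp"
  have "transpose (M ** N) ** Omega ** (M ** N) = transpose N ** (transpose M ** Omega ** M) ** N"
    by (simp add: matrix_transpose_mul matrix_mul_assoc)
  then show ?thesis using M N by (simp add: Sp_def)
qed

lemma unitary_embed_in_Sp: 
  assumes "U \<in> unitary_matrices"
  shows "unitary_embed U \<in> Sp"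
proof -
  have "adjoint_matrix U ** mat (- \<i>) ** U = mat (- \<i>)"
    using unitary_matricesD(1)[OF assms] mat_commute[of "- \<i>" U]
    by (metis matrix_mul_assoc matrix_mul_lid)
  then show ?thesis
    by (simp add: Sp_def Omega_eq unitary_embed_adjoint[symmetric] unitary_embed_mult[symmetric])
qed

lemma block_matrix_in_Sp_iff:
  "block_matrix A B C D \<in> Sp \<longleftrightarrow> transpose A ** C = transpose C ** A \<and>
     transpose B ** D = transpose D ** B \<and> transpose A ** D - transpose C ** B = mat 1"
proof -
  have "transpose (block_matrix A B C D) ** Omega ** block_matrix A B C D =
      block_matrix (transpose A ** C - transpose C ** A) (transpose A ** D - transpose C ** B)
        (transpose B ** C - transpose D ** A) (transpose B ** D - transpose D ** B)"
    by (simp add: Omega_def transpose_block_matrix block_matrix_mult matrix_algebra)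
  \<comment> \<open>The lower left block equation is the negative transpose of the upper right one,
    so three conditions remain.\<close>
  moreover have "transpose B ** C - transpose D ** A = - transpose (transpose A ** D - transpose C ** B)"
    by (simp add: matrix_algebra)
  ultimately show ?thesis by (auto simp: Sp_def Omega_def block_matrix_eq_iff transpose_minus)
qed

text \<open>A matrix commuting with \<open>Omega\<close> is complex linear, so it is the embedding
  of the complex matrix read off from its first block column; the symplectic relation then says that
  this matrix is unitary.\<close>

lemma commute_Omega_imp_unitary:
  assumes M: "M \<in> Sp" and comm: "M ** Omega = Omega ** M"
  shows "M \<in> unitary_embed ` unitary_matrices"
proof -
  let ?W = "\<chi> i j. Complex (M $ Inl i $ Inl j) (M $ Inr i $ Inl j)"
  have "M ** Omega = block_matrix (- upper_right M) (upper_left M) (- lower_right M) (lower_left M)"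
    by (subst block_matrix_blocks[of M, symmetric])
      (simp add: Omega_def block_matrix_mult matrix_algebra)
  moreover have "Omega ** M = block_matrix (lower_left M) (lower_right M) (- upper_left M) (- upper_right M)"
    by (subst block_matrix_blocks[of M, symmetric])
      (simp add: Omega_def block_matrix_mult matrix_algebra)
  ultimately have "block_matrix (lower_left M) (lower_right M) (- upper_left M) (- upper_right M) = block_matrix (- upper_right M) (upper_left M) (- lower_right M) (lower_left M)"
    using comm by simp
  then have "lower_left M = - upper_right M" "lower_right M = upper_left M" unfolding block_matrix_eq_iff by blast+
  then have MW: "M = unitary_embed ?W"
    unfolding matrix_eq_Plus_iff by (simp add: blocks_defs vec_eq_iff)
  have "unitary_embed (adjoint_matrix ?W ** mat (- \<i>) ** ?W) = unitary_embed (mat (- \<i>))"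
    using M by (simp add: Sp_def Omega_eq unitary_embed_mult unitary_embed_adjoint MW[symmetric])
  then have "adjoint_matrix ?W ** mat (- \<i>) ** ?W = mat (- \<i>)" by (simp only: unitary_embed_eq_iff)
  then have "mat (- \<i>) ** (adjoint_matrix ?W ** ?W) = mat (- \<i>)"
    by (simp add: mat_commute[symmetric] matrix_mul_assoc)
  then have "mat \<i> ** (mat (- \<i>) ** (adjoint_matrix ?W ** ?W)) = mat \<i> ** mat (- \<i>)" by simp
  then have "?W \<in> unitary_matrices" by (simp add: matrix_mul_assoc mat_mult_mat unitary_matrices_def)
  then show ?thesis using MW by blast
qed

lemma Omega_in_Sp: "Omega \<in> Sp"
proof -
  have "mat (- \<i>) \<in> unitary_matrices"
    by (simp add: unitary_matrices_def adjoint_mat mat_mult_mat)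
  then show ?thesis unfolding Omega_eq by (rule unitary_embed_in_Sp)
qed

section \<open>Deforming the symplectic group into the unitary group\<close>

text \<open>The Hermitian product, conjugate linear in the first argument. Its real part is the
  Euclidean inner product used by \<open>gram_schmidt\<close>, its imaginary part the symplectic
  form.\<close>

definition hprod :: "complex^'n::finite \<Rightarrow> complex^'n \<Rightarrow> complex" where
  "hprod x y = (\<Sum>k\<in>UNIV. cnj (x $ k) * y $ k)"

lemma Re_hprod: "Re (hprod x y) = x \<bullet> y"
  by (simp add: hprod_def inner_vec_def inner_complex_def)

lemma linear_Im_hprod_right: "linear (\<lambda>y. Im (hprod x y))"
  by (rule linearI) (simp_all add: hprod_def algebra_simps sum.distrib sum_distrib_left)

lemma linear_Im_hprod_left: "linear (\<lambda>x. Im (hprod x y))"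
  by (rule linearI) (simp_all add: hprod_def algebra_simps sum.distrib sum_distrib_left)

lemma adjoint_matrix_mult_nth: "(adjoint_matrix Z ** W) $ i $ j = hprod (column i Z) (column j W)"
  by (simp add: hprod_def matrix_matrix_mult_def column_def)

lemma adjoint_matrix_vector_nth: "(adjoint_matrix Z *v w) $ i = hprod (column i Z) w"
  by (simp add: hprod_def matrix_vector_mult_def column_def)

lemma hprod_matrix_vector: "hprod x (W *v y) = hprod (adjoint_matrix W *v x) y"
proof -
  have "hprod x (W *v y) = (\<Sum>k\<in>UNIV. \<Sum>j\<in>UNIV. cnj (x $ k) * (W $ k $ j * y $ j))"
    by (simp add: hprod_def matrix_vector_mult_def sum_distrib_left)
  also have "\<dots> = (\<Sum>j\<in>UNIV. \<Sum>k\<in>UNIV. cnj (x $ k) * (W $ k $ j * y $ j))" by (rule sum.swap)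
  also have "\<dots> = hprod (adjoint_matrix W *v x) y"
    by (simp add: hprod_def matrix_vector_mult_def sum_distrib_left sum_distrib_right mult_ac)
  finally show ?thesis .
qed

lemma unitary_inner:
  assumes "W \<in> unitary_matrices"
  shows "(W *v x) \<bullet> (W *v y) = x \<bullet> y"
  using unitary_matricesD(1)[OF assms]
  by (simp flip: Re_hprod add: hprod_matrix_vector matrix_vector_mul_assoc)

lemma hprod_columns_unitary:
  assumes "W \<in> unitary_matrices"
  shows "hprod (column i W) (column j W) = (if i = j then 1 else 0)"
  using unitary_matricesD(1)[OF assms] by (simp flip: adjoint_matrix_mult_nth add: mat_def)

text \<open>Gram--Schmidt needs an order on the columns, which an arbitrary finite index type does
  not provide; one enumeration is fixed for the whole proof.\<close>

definition index_nat :: "'n::finite \<Rightarrow> nat" where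
  "index_nat = (SOME f. bij_betw f UNIV {..<CARD('n)})"

definition nat_index :: "nat \<Rightarrow> 'n::finite" where
  "nat_index = inv_into UNIV index_nat"

lemma index_nat_bij: "bij_betw (index_nat :: 'n::finite \<Rightarrow> nat) UNIV {..<CARD('n)}"
proof -
  have "\<exists>f :: 'n \<Rightarrow> nat. bij_betw f UNIV {..<CARD('n)}"
    using ex_bij_betw_finite_nat[of "UNIV :: 'n set"] by (simp add: atLeast0LessThan)
  then show ?thesis unfolding index_nat_def by (rule someI_ex)
qed

lemma index_nat_less [simp]: "index_nat (i :: 'n::finite) < CARD('n)"
  using bij_betwE[OF index_nat_bij] by blast

lemma nat_index_index_nat [simp]: "nat_index (index_nat i) = (i :: 'n::finite)"
  unfolding nat_index_def using index_nat_bij[where ?'n = 'n] by (auto simp: bij_betw_def inv_into_f_f)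

lemma index_nat_nat_index [simp]: "k < CARD('n) \<Longrightarrow> index_nat (nat_index k :: 'n::finite) = k"
  unfolding nat_index_def using index_nat_bij[where ?'n = 'n] by (auto simp: bij_betw_def intro!: f_inv_into_f)

lemma nat_index_eq_iff: "k < CARD('n) \<Longrightarrow> l < CARD('n) \<Longrightarrow> (nat_index k :: 'n::finite) = nat_index l \<longleftrightarrow> k = l"
  by (metis index_nat_nat_index)

lemma sum_nat_index: "(\<Sum>k<CARD('n). f (nat_index k :: 'n::finite)) = (\<Sum>i\<in>UNIV. f i)"
  using sum.reindex_bij_betw[OF index_nat_bij[where ?'n = 'n], of "\<lambda>k. f (nat_index k)"] by simp

definition frame :: "complex^'n^'n \<Rightarrow> nat \<Rightarrow> complex^'n::finite" where
  "frame Z k = column (nat_index k) Z"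

definition orthonormalize :: "complex^'n^'n \<Rightarrow> complex^'n^'n::finite" where
  "orthonormalize Z = (\<chi> i j. gram_schmidt (frame Z) (index_nat j) $ i)"

lemma column_orthonormalize: "column j (orthonormalize Z) = gram_schmidt (frame Z) (index_nat j)"
  by (simp add: column_def orthonormalize_def)

text \<open>The columns are a real basis of a subspace of real dimension n on which the symplectic
  form vanishes.\<close>

definition lagrangian :: "complex^'n^'n::finite \<Rightarrow> bool" where
  "lagrangian Z \<longleftrightarrow> (\<forall>i j. Im (hprod (column i Z) (column j Z)) = 0) \<and>
     independent_family (frame Z) CARD('n)"

abbreviation "frame_span Z \<equiv> span (range (\<lambda>j. column j Z))"

lemma frame_image: "frame (Z :: complex^'n^'n::finite) ` A \<subseteq> range (\<lambda>j. column j Z)"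
  by (auto simp: frame_def)

lemma lagrangian_span:
  assumes "lagrangian Z" "x \<in> frame_span Z" "y \<in> frame_span Z"
  shows "Im (hprod x y) = 0"
proof -
  have "Im (hprod (column i Z) y) = 0" for i
    by (rule linear_eq_0_on_span[OF linear_Im_hprod_right _ assms(3)])
      (use assms(1) in \<open>auto simp: lagrangian_def\<close>)
  then show ?thesis by (intro linear_eq_0_on_span[OF linear_Im_hprod_left _ assms(2)]) auto
qed

lemma gram_schmidt_frame_in_span: "gram_schmidt (frame Z) k \<in> frame_span Z"
  using gram_schmidt_in_span[of "frame Z" k] span_mono[OF frame_image[of Z "{..k}"]] by blast

text \<open>Gram--Schmidt forms only real combinations and so stays inside the Lagrangian span,
  where imaginary parts of Hermitian products vanish. Real orthonormality thus becomes Hermitian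
  orthonormality.\<close>

lemma orthonormalize_unitary:
  fixes Z :: "complex^'n^'n::finite"
  assumes "lagrangian Z"
  shows "orthonormalize Z \<in> unitary_matrices"
proof -
  have ind: "independent_family (frame Z) CARD('n)" using assms by (simp add: lagrangian_def)
  have "hprod (gram_schmidt (frame Z) (index_nat i)) (gram_schmidt (frame Z) (index_nat j)) = (if i = j then 1 else 0)" for i j :: 'n
  proof -
    have "index_nat i = index_nat j \<longleftrightarrow> i = j" using nat_index_index_nat by metis
    then have "Re (hprod (gram_schmidt (frame Z) (index_nat i)) (gram_schmidt (frame Z) (index_nat j))) = (if i = j then 1 else 0)"
      unfolding Re_hprod using gram_schmidt_orthonormal[OF ind index_nat_less index_nat_less, of i j] by simp
    moreover have "Im (hprod (gram_schmidt (frame Z) (index_nat i)) (gram_schmidt (frame Z) (index_nat j))) = 0"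
      by (rule lagrangian_span[OF assms gram_schmidt_frame_in_span gram_schmidt_frame_in_span])
    ultimately show ?thesis by (simp add: complex_eq_iff)
  qed
  then show ?thesis
    by (simp add: unitary_matrices_def vec_eq_iff adjoint_matrix_mult_nth column_orthonormalize mat_def)
qed

lemma orthonormalize_of_unitary:
  fixes W :: "complex^'n^'n::finite"
  assumes "W \<in> unitary_matrices"
  shows "orthonormalize W = W"
proof -
  have "frame W i \<bullet> frame W j = (if i = j then 1 else 0)" if "i < CARD('n)" "j < CARD('n)" for i j
    using that by (simp flip: Re_hprod add: frame_def hprod_columns_unitary[OF assms] nat_index_eq_iff)
  then have "gram_schmidt (frame W) (index_nat j) = frame W (index_nat j)" for j :: 'n
    by (rule gram_schmidt_of_orthonormal[where n = "CARD('n)"]) simp_all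
  then show ?thesis by (simp add: vec_eq_iff orthonormalize_def frame_def column_def)
qed

lemma column_matrix_mult: "column j (A ** B) = A *v column j B"
  by (simp add: vec_eq_iff column_def matrix_matrix_mult_def matrix_vector_mult_def)

lemma orthonormalize_equivariant:
  assumes "W \<in> unitary_matrices"
  shows "orthonormalize (W ** Z) = W ** orthonormalize Z"
proof -
  have "linear ((*v) W)"
    by (rule linearI) (simp_all add: vec_eq_iff matrix_vector_mult_def distrib_left sum.distrib scaleR_sum_right)
  from gram_schmidt_linear_isometry[OF this unitary_inner[OF assms], of "frame Z"]
  have "gram_schmidt (frame (W ** Z)) k = W *v gram_schmidt (frame Z) k" for k
    by (simp add: frame_def[abs_def] column_matrix_mult)
  then have "column j (orthonormalize (W ** Z)) = column j (W ** orthonormalize Z)" for j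
    by (simp add: column_orthonormalize column_matrix_mult)
  then show ?thesis by (simp add: vec_eq_iff column_def)
qed

lemma continuous_on_orthonormalize:
  fixes f :: "'a::topological_space \<Rightarrow> complex^'n^'n::finite"
  assumes f: "continuous_on S f" and "\<And>x. x \<in> S \<Longrightarrow> lagrangian (f x)"
  shows "continuous_on S (\<lambda>x. orthonormalize (f x))"
proof -
  have "continuous_on S (\<lambda>x. gram_schmidt (frame (f x)) (index_nat j))" for j :: 'n
  proof (rule continuous_on_gram_schmidt[where n = "CARD('n)"])
    show "continuous_on S (\<lambda>x. frame (f x) k)" for k
      unfolding frame_def column_def by (intro continuous_intros f)
    show "independent_family (frame (f x)) CARD('n)" if "x \<in> S" for x
      using assms(2)[OF that] by (simp add: lagrangian_def)
  qed simp
  then show ?thesis unfolding orthonormalize_def by (intro continuous_intros)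
qed

text \<open>The first n columns of \<open>M\<close>, with blocks A and C, read as the complex matrix
  A + iC. In this form left multiplication by an embedded unitary matrix is complex matrix
  multiplication.\<close>

definition complex_frame :: "real^('n::finite + 'n)^('n + 'n) \<Rightarrow> complex^'n^'n" where
  "complex_frame M = (\<chi> i j. Complex (M $ Inl i $ Inl j) (M $ Inr i $ Inl j))"

lemma complex_frame_embed_mult: "complex_frame (unitary_embed W ** M) = W ** complex_frame M"
  by (simp add: vec_eq_iff complex_frame_def matrix_matrix_mult_def sum_UNIV_Plus complex_eq_iff
      sum_subtractf sum.distrib sum_negf)

lemma complex_frame_embed: "complex_frame (unitary_embed W) = W"
  by (simp add: vec_eq_iff complex_frame_def complex_eq_iff)

lemma sum_frame_eq:
  fixes \<xi> :: "real^'n::finite"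
  shows "(\<Sum>k<CARD('n). (\<xi> $ nat_index k) *\<^sub>R column (nat_index k) Z) = (\<Sum>j\<in>UNIV. (\<xi> $ j) *\<^sub>R column j Z)"
  by (rule sum_nat_index)

text \<open>Of the symplectic block relations, the symmetry of \<open>transpose A ** C\<close> gives
  isotropy. The transposed relation \<open>transpose D ** A - transpose B ** C = mat 1\<close> gives
  independence, since a real relation among the columns is a common kernel vector of
  \<open>A\<close> and \<open>C\<close>.\<close>

lemma lagrangian_complex_frame:
  fixes M :: "real^('n::finite + 'n)^('n + 'n)"
  assumes "M \<in> Sp"
  shows "lagrangian (complex_frame M)"
  unfolding lagrangian_def
proof
  define A B C D where "A = upper_left M" and "B = upper_right M" and "C = lower_left M" and "D = lower_right M"
  have sp: "transpose A ** C = transpose C ** A" "transpose A ** D - transpose C ** B = mat 1"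
    using assms block_matrix_blocks[of M] block_matrix_in_Sp_iff[of A B C D]
    by (auto simp: A_def B_def C_def D_def)
  have Z: "complex_frame M $ i $ j = Complex (A $ i $ j) (C $ i $ j)" for i j
    by (simp add: complex_frame_def A_def C_def blocks_defs)
  show "\<forall>i j. Im (hprod (column i (complex_frame M)) (column j (complex_frame M))) = 0"
  proof (intro allI)
    fix i j
    have "Im (hprod (column i (complex_frame M)) (column j (complex_frame M))) =
        (transpose A ** C) $ i $ j - (transpose C ** A) $ i $ j"
      by (simp add: hprod_def column_def Z matrix_matrix_mult_def transpose_def sum.distrib sum_subtractf)
    then show "Im (hprod (column i (complex_frame M)) (column j (complex_frame M))) = 0"
      using sp by simp
  qed
  show "independent_family (frame (complex_frame M)) CARD('n)"
  proof (rule independent_familyI)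
    fix x assume x: "(\<Sum>k<CARD('n). x k *\<^sub>R frame (complex_frame M) k) = 0"
    define \<xi> :: "real^'n" where "\<xi> = (\<chi> j. x (index_nat j))"
    have "(\<Sum>k<CARD('n). x k *\<^sub>R frame (complex_frame M) k) =
        (\<Sum>k<CARD('n). (\<xi> $ nat_index k) *\<^sub>R column (nat_index k) (complex_frame M))"
      by (rule sum.cong) (auto simp: \<xi>_def frame_def)
    then have 0: "(\<Sum>j\<in>UNIV. (\<xi> $ j) *\<^sub>R column j (complex_frame M)) = 0"
      using x unfolding sum_frame_eq by simp
    have "(\<Sum>j\<in>UNIV. \<xi> $ j * A $ i $ j) = 0 \<and> (\<Sum>j\<in>UNIV. \<xi> $ j * C $ i $ j) = 0" for i
      using arg_cong[OF 0, of "\<lambda>v. v $ i"] by (simp add: complex_eq_iff column_def Z)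
    then have "A *v \<xi> = 0" "C *v \<xi> = 0"
      by (simp_all add: vec_eq_iff matrix_vector_mult_def mult.commute)
    then have "(transpose D ** A - transpose B ** C) *v \<xi> = 0"
      by (simp add: matrix_vector_mult_diff_rdistrib flip: matrix_vector_mul_assoc)
    moreover have "transpose D ** A - transpose B ** C = mat 1"
      using arg_cong[OF sp(2), of transpose] by (simp add: matrix_algebra)
    ultimately have "\<xi> = 0" by simp
    show "\<forall>k<CARD('n). x k = 0"
    proof (intro allI impI)
      fix k assume "k < CARD('n)"
      then have "x k = \<xi> $ nat_index k" by (simp add: \<xi>_def)
      then show "x k = 0" using \<open>\<xi> = 0\<close> by simp
    qed
  qed
qed

section \<open>The unitary and the triangular factor of a symplectic matrix\<close>

definition unitary_part :: "real^('n::finite + 'n)^('n + 'n) \<Rightarrow> complex^'n^'n" where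
  "unitary_part M = orthonormalize (complex_frame M)"

lemma unitary_part_unitary: "M \<in> Sp \<Longrightarrow> unitary_part M \<in> unitary_matrices"
  unfolding unitary_part_def by (intro orthonormalize_unitary lagrangian_complex_frame)

lemma unitary_part_embed: "W \<in> unitary_matrices \<Longrightarrow> unitary_part (unitary_embed W) = W"
  by (simp add: unitary_part_def complex_frame_embed orthonormalize_of_unitary)

lemma unitary_part_embed_mult:
  "W \<in> unitary_matrices \<Longrightarrow> unitary_part (unitary_embed W ** M) = W ** unitary_part M"
  by (simp add: unitary_part_def complex_frame_embed_mult orthonormalize_equivariant)

lemma continuous_on_unitary_part: "continuous_on Sp unitary_part"
  unfolding unitary_part_def[abs_def]
proof (rule continuous_on_orthonormalize)
  show "continuous_on Sp complex_frame"
    unfolding complex_frame_def[abs_def] Complex_eq by (intro continuous_intros)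
qed (rule lagrangian_complex_frame)

definition "triangular_part M = unitary_embed (adjoint_matrix (unitary_part M)) ** M"

definition "triangular_diagonal s M = (1 - s) *\<^sub>R upper_left (triangular_part M) + s *\<^sub>R mat 1"

text \<open>An upper block triangular symplectic matrix has blocks R, R S, 0 and the inverse
  transpose of R, with S symmetric. For the triangular factor of \<open>M\<close>, S is the
  transposed lower right block times the upper right block. The deformation moves R along a straight
  line to the identity and replaces S by (1 - s) S; the last block is forced.\<close>

definition deform :: "real \<Rightarrow> real^('n::finite + 'n)^('n + 'n) \<Rightarrow> real^('n + 'n)^('n + 'n)" where
  "deform s M = unitary_embed (unitary_part M) ** block_matrix (triangular_diagonal s M)
     ((1 - s) *\<^sub>R (triangular_diagonal s M ** transpose (lower_right (triangular_part M)) ** upper_right (triangular_part M)))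
     0 (transpose (matrix_inv (triangular_diagonal s M)))"

lemma complex_frame_triangular_part:
  "complex_frame (triangular_part M) = adjoint_matrix (unitary_part M) ** complex_frame M"
  by (simp add: triangular_part_def complex_frame_embed_mult)

text \<open>Its entries are imaginary parts of Hermitian products between two frames of the same
  Lagrangian subspace.\<close>

lemma lower_left_triangular_part:
  assumes "M \<in> Sp"
  shows "lower_left (triangular_part M) = 0"
proof -
  have "lower_left (triangular_part M) $ i $ j = 0" for i j
  proof -
    have "lower_left (triangular_part M) $ i $ j = Im (complex_frame (triangular_part M) $ i $ j)"
      by (simp add: complex_frame_def lower_left_def)
    also have "\<dots> = Im (hprod (column i (unitary_part M)) (column j (complex_frame M)))"
      by (simp add: complex_frame_triangular_part adjoint_matrix_mult_nth)
    also have "\<dots> = 0"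
      unfolding unitary_part_def column_orthonormalize
      by (rule lagrangian_span[OF lagrangian_complex_frame[OF assms] gram_schmidt_frame_in_span]) (simp add: span_base)
    finally show ?thesis .
  qed
  then show ?thesis by (simp add: vec_eq_iff)
qed

lemma upper_left_triangular_part:
  "upper_left (triangular_part M) $ i $ j = column i (unitary_part M) \<bullet> column j (complex_frame M)"
proof -
  have "upper_left (triangular_part M) $ i $ j = Re (complex_frame (triangular_part M) $ i $ j)"
    by (simp add: complex_frame_def upper_left_def)
  then show ?thesis by (simp add: complex_frame_triangular_part adjoint_matrix_mult_nth Re_hprod)
qed

text \<open>This matrix expresses the interpolation between the frame and its orthonormalization in
  the orthonormal basis; it is invertible because the interpolated frame is independent.\<close>

lemma invertible_triangular_diagonal:
  fixes M :: "real^('n::finite + 'n)^('n + 'n)"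
  assumes M: "M \<in> Sp" and s: "0 \<le> s" "s \<le> 1"
  shows "invertible (triangular_diagonal s M)"
  unfolding invertible_left_inverse matrix_left_invertible_ker
proof (intro allI impI)
  fix \<xi> :: "real^'n" assume 0: "triangular_diagonal s M *v \<xi> = 0"
  let ?Z = "complex_frame M" and ?U = "unitary_part M"
  have Z: "lagrangian ?Z" by (rule lagrangian_complex_frame[OF M])
  have U: "?U \<in> unitary_matrices" by (rule unitary_part_unitary[OF M])
  have colU: "column j ?U = gram_schmidt (frame ?Z) (index_nat j)" for j by (simp add: unitary_part_def column_orthonormalize)
  \<comment> \<open>\<open>w\<close> combines the interpolated frame with the coefficients
    \<open>\<xi>\<close>. Its coordinates with respect to the unitary part form the vector
    \<open>triangular_diagonal s M *v \<xi>\<close>, which vanishes.\<close>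
  define w where "w = (\<Sum>j\<in>UNIV. (\<xi> $ j) *\<^sub>R ((1 - s) *\<^sub>R column j ?Z + s *\<^sub>R column j ?U))"
  have "hprod (column i ?U) w = 0" for i
  proof -
    have "column i ?U \<bullet> w = (\<Sum>j\<in>UNIV. triangular_diagonal s M $ i $ j * \<xi> $ j)"
      unfolding w_def inner_sum_right
    proof (rule sum.cong[OF refl])
      fix j
      have "column i ?U \<bullet> column j ?U = mat 1 $ i $ j"
        by (simp flip: Re_hprod add: hprod_columns_unitary[OF U] mat_def)
      then show "column i ?U \<bullet> ((\<xi> $ j) *\<^sub>R ((1 - s) *\<^sub>R column j ?Z + s *\<^sub>R column j ?U)) =
          triangular_diagonal s M $ i $ j * \<xi> $ j"
        by (simp add: triangular_diagonal_def upper_left_triangular_part inner_add_right algebra_simps)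
    qed
    also have "\<dots> = (triangular_diagonal s M *v \<xi>) $ i" by (simp add: matrix_vector_mult_def)
    finally have "Re (hprod (column i ?U) w) = 0" using 0 by (simp add: Re_hprod)
    moreover have "w \<in> frame_span ?Z"
      unfolding w_def colU
      by (intro span_sum span_scale span_add gram_schmidt_frame_in_span) (simp add: span_base)
    then have "Im (hprod (column i ?U) w) = 0"
      unfolding colU by (rule lagrangian_span[OF Z gram_schmidt_frame_in_span])
    ultimately show ?thesis by (simp add: complex_eq_iff)
  qed
  then have "adjoint_matrix ?U *v w = 0" by (simp add: vec_eq_iff adjoint_matrix_vector_nth)
  then have "?U *v (adjoint_matrix ?U *v w) = 0" by simp
  then have "w = 0" using unitary_matricesD(2)[OF U] by (simp add: matrix_vector_mul_assoc)
  let ?f = "\<lambda>k. (1 - s) *\<^sub>R frame ?Z k + s *\<^sub>R gram_schmidt (frame ?Z) k"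
  have "(\<Sum>k<CARD('n). (\<xi> $ nat_index k) *\<^sub>R ?f k) =
      (\<Sum>k<CARD('n). (\<lambda>j. (\<xi> $ j) *\<^sub>R ((1 - s) *\<^sub>R column j ?Z + s *\<^sub>R column j ?U)) (nat_index k))"
    by (rule sum.cong) (auto simp: frame_def[of ?Z] colU)
  also have "\<dots> = w" unfolding w_def by (rule sum_nat_index)
  finally have sum0: "(\<Sum>k<CARD('n). (\<xi> $ nat_index k) *\<^sub>R ?f k) = 0" using \<open>w = 0\<close> by simp
  have ind: "independent_family ?f CARD('n)"
    using Z s by (intro independent_family_interpolate) (simp_all add: lagrangian_def)
  have "\<xi> $ j = 0" for j
    using independent_family_sum_zero[OF ind sum0 index_nat_less[of j]] by simp
  then show "\<xi> = 0" by (simp add: vec_eq_iff)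
qed

lemma triangular_part_in_Sp:
  assumes "M \<in> Sp"
  shows "triangular_part M \<in> Sp"
  unfolding triangular_part_def
  by (intro Sp_mult unitary_embed_in_Sp adjoint_unitary unitary_part_unitary assms)

lemma triangular_part_relations:
  assumes "M \<in> Sp"
  shows "transpose (upper_right (triangular_part M)) ** lower_right (triangular_part M) =
      transpose (lower_right (triangular_part M)) ** upper_right (triangular_part M)"
    and "transpose (upper_left (triangular_part M)) ** lower_right (triangular_part M) = mat 1"
  using triangular_part_in_Sp[OF assms] lower_left_triangular_part[OF assms]
    block_matrix_in_Sp_iff[of "upper_left (triangular_part M)" "upper_right (triangular_part M)" 0 "lower_right (triangular_part M)"]
    block_matrix_blocks[of "triangular_part M"]
  by (simp_all add: transpose_zero matrix_zero_left)

lemma deform_in_Sp: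
  assumes M: "M \<in> Sp" and s: "0 \<le> s" "s \<le> 1"
  shows "deform s M \<in> Sp"
  unfolding deform_def
proof (rule Sp_mult[OF unitary_embed_in_Sp[OF unitary_part_unitary[OF M]]])
  let ?R = "triangular_diagonal s M"
  let ?X = "upper_right (triangular_part M)" and ?Y = "lower_right (triangular_part M)"
  have inv: "?R ** matrix_inv ?R = mat 1" "matrix_inv ?R ** ?R = mat 1"
    using matrix_inv_inverse[OF invertible_triangular_diagonal[OF M s]] by auto
  have RD: "transpose ?R ** transpose (matrix_inv ?R) = mat 1"
    by (simp add: inv flip: matrix_transpose_mul)
  have "transpose (?R ** transpose ?Y ** ?X) ** transpose (matrix_inv ?R) =
      transpose ?X ** ?Y ** (transpose ?R ** transpose (matrix_inv ?R))"
    by (simp add: matrix_transpose_mul matrix_mul_assoc)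
  then have 1: "transpose (?R ** transpose ?Y ** ?X) ** transpose (matrix_inv ?R) = transpose ?X ** ?Y"
    by (simp add: RD)
  have "matrix_inv ?R ** (?R ** transpose ?Y ** ?X) = transpose ?Y ** ?X"
    by (simp add: inv matrix_mul_assoc)
  then have "transpose (?R ** transpose ?Y ** ?X) ** transpose (matrix_inv ?R) =
      transpose (transpose (matrix_inv ?R)) ** (?R ** transpose ?Y ** ?X)"
    using triangular_part_relations(1)[OF M] by (simp add: 1)
  then show "block_matrix ?R ((1 - s) *\<^sub>R (?R ** transpose ?Y ** ?X)) 0 (transpose (matrix_inv ?R)) \<in> Sp"
    unfolding block_matrix_in_Sp_iff
    by (simp add: RD transpose_zero matrix_zero_left matrix_zero_right transpose_scalar
      matrix_scaleR_left matrix_scaleR_right)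
qed

lemma deform_0:
  assumes M: "M \<in> Sp"
  shows "deform 0 M = M"
proof -
  let ?b = "triangular_part M"
  have R: "triangular_diagonal 0 M = upper_left ?b" by (simp add: triangular_diagonal_def)
  have "transpose (lower_right ?b) ** upper_left ?b = mat 1"
    using arg_cong[OF triangular_part_relations(2)[OF M], of transpose] by (simp add: matrix_transpose_mul)
  then have RY: "upper_left ?b ** transpose (lower_right ?b) = mat 1" using matrix_left_right_inverse by blast
  then have inv: "matrix_inv (upper_left ?b) = transpose (lower_right ?b)" by (rule matrix_inv_eqI)
  have "deform 0 M = unitary_embed (unitary_part M) ** block_matrix (upper_left ?b) (upper_right ?b) (lower_left ?b) (lower_right ?b)"
    by (simp add: deform_def R RY inv lower_left_triangular_part[OF M])
  also have "\<dots> = unitary_embed (unitary_part M ** adjoint_matrix (unitary_part M)) ** M"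
    unfolding block_matrix_blocks by (simp add: triangular_part_def unitary_embed_mult matrix_mul_assoc)
  also have "\<dots> = M"
    by (simp add: unitary_matricesD(2)[OF unitary_part_unitary[OF M]] unitary_embed_one)
  finally show ?thesis .
qed

lemma deform_1: "deform 1 M = unitary_embed (unitary_part M)"
proof -
  have "matrix_inv (mat 1 :: real^'a^'a) = mat 1" by (rule matrix_inv_eqI) simp
  then show ?thesis by (simp add: deform_def triangular_diagonal_def block_matrix_one)
qed

text \<open>A unitary matrix has trivial triangular factor, so the deformation does not move it.
  This later keeps the endpoints of a path fixed when they lie over U(n).\<close>

lemma deform_unitary:
  assumes W: "W \<in> unitary_matrices"
  shows "deform s (unitary_embed W) = unitary_embed W"
proof -
  have b: "triangular_part (unitary_embed W) = block_matrix (mat 1) 0 0 (mat 1)"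
    using unitary_matricesD(1)[OF W]
    by (simp add: triangular_part_def unitary_part_embed[OF W] unitary_embed_one block_matrix_one
      flip: unitary_embed_mult)
  have "matrix_inv (mat 1 :: real^'a^'a) = mat 1" by (rule matrix_inv_eqI) simp
  moreover note blocks_block_matrix[of "mat 1 :: real^'a^'a" 0 0 "mat 1", unfolded block_matrix_one]
  moreover have "triangular_diagonal s (unitary_embed W) = mat 1"
    by (simp add: triangular_diagonal_def b scaleR_left_distrib[symmetric])
  ultimately show ?thesis
    by (simp add: deform_def b unitary_part_embed[OF W] matrix_zero_right block_matrix_one)
qed

lemma continuous_on_adjoint_matrix [continuous_intros]:
  fixes f :: "'a::topological_space \<Rightarrow> complex^'n^'m"
  assumes "continuous_on S f"
  shows "continuous_on S (\<lambda>x. adjoint_matrix (f x))"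
  unfolding adjoint_matrix_def map_matrix_def using assms by (intro continuous_intros)

lemma continuous_on_deform:
  fixes S :: "(real \<times> (real^('n::finite + 'n)^('n + 'n))) set"
  assumes "S \<subseteq> {0..1} \<times> Sp"
  shows "continuous_on S (\<lambda>(s, M). deform s M)"
proof -
  have U: "continuous_on S (\<lambda>x. unitary_part (snd x))"
    by (rule continuous_on_compose2[OF continuous_on_unitary_part]) (use assms in \<open>auto intro: continuous_intros\<close>)
  have b: "continuous_on S (\<lambda>x. triangular_part (snd x))"
    unfolding triangular_part_def by (intro continuous_intros U)
  have R: "continuous_on S (\<lambda>x. triangular_diagonal (fst x) (snd x))"
    unfolding triangular_diagonal_def by (intro continuous_intros b)
  have inv: "invertible (triangular_diagonal (fst x) (snd x))" if "x \<in> S" for x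
    using that assms by (intro invertible_triangular_diagonal) auto
  show ?thesis
    unfolding deform_def case_prod_unfold by (intro continuous_intros U b R inv)
qed

section \<open>Short paths in the symplectic group\<close>

text \<open>
  With \<open>X = (M - 1) (M + 1)\<^sup>-\<^sup>1\<close>, the Cayley transform of \<open>M\<close>, \<open>cayley_path s M\<close> is
  \<open>(1 + s X) (1 - s X)\<^sup>-\<^sup>1\<close>, a path from \<open>1\<close> to \<open>M\<close>.
\<close>

definition segment :: "real \<Rightarrow> real^'n^'n \<Rightarrow> real^'n::finite^'n" where
  "segment s M = (1 - s) *\<^sub>R mat 1 + (1 + s) *\<^sub>R M"

definition cayley_path :: "real \<Rightarrow> real^'n^'n \<Rightarrow> real^'n::finite^'n" where
  "cayley_path s M = segment s M ** matrix_inv (segment (- s) M)"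

text \<open>Because \<open>M\<close> preserves \<open>Omega\<close>, the pullback of
  \<open>Omega\<close> under \<open>segment s M\<close> is an even function of \<open>s\<close>.
  Numerator and denominator of the Cayley path thus change \<open>Omega\<close> in the same
  way.\<close>

lemma cayley_path_in_Sp:
  assumes M: "M \<in> Sp" and inv: "invertible (segment (- s) M)"
  shows "cayley_path s M \<in> Sp"
proof -
  have form: "transpose (segment s M) ** Omega ** segment s M =
      ((1 - s)\<^sup>2 + (1 + s)\<^sup>2) *\<^sub>R Omega + ((1 - s) * (1 + s)) *\<^sub>R (transpose M ** Omega + Omega ** M)" for s
  proof -
    have "transpose M ** Omega ** M = Omega" using M by (simp add: Sp_def)
    then show ?thesis
      by (simp add: segment_def matrix_algebra) (simp add: vec_eq_iff power2_eq_square algebra_simps)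
  qed
  let ?I = "matrix_inv (segment (- s) M)"
  have "transpose (cayley_path s M) ** Omega ** cayley_path s M =
      transpose ?I ** (transpose (segment s M) ** Omega ** segment s M) ** ?I"
    by (simp add: cayley_path_def matrix_transpose_mul matrix_mul_assoc)
  also have "transpose (segment s M) ** Omega ** segment s M =
      transpose (segment (- s) M) ** Omega ** segment (- s) M"
    unfolding form by (simp add: add.commute mult.commute)
  also have "transpose ?I ** (transpose (segment (- s) M) ** Omega ** segment (- s) M) ** ?I =
      transpose (segment (- s) M ** ?I) ** Omega ** (segment (- s) M ** ?I)"
    by (simp add: matrix_transpose_mul matrix_mul_assoc)
  also have "\<dots> = Omega" by (simp add: matrix_inv_inverse[OF inv])
  finally show ?thesis by (simp add: Sp_def)
qed

lemma invertible_scaleR_mat_1: "c \<noteq> 0 \<Longrightarrow> invertible (c *\<^sub>R mat 1 :: real^'n::finite^'n)"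
  unfolding invertible_def
  by (intro exI[of _ "(1 / c) *\<^sub>R mat 1"]) (simp add: matrix_scaleR_left matrix_scaleR_right)

text \<open>The Cayley path of the identity matrix is constant. By the tube lemma over the compact
  parameter interval, for all \<open>M\<close> close to the identity it is defined and stays inside
  \<open>N\<close>.\<close>

lemma Sp_locally_path_connected:
  fixes N :: "(real^('n::finite + 'n)^('n + 'n)) set"
  assumes N: "openin (top_of_set Sp) N" "mat 1 \<in> N"
  shows "\<exists>N'. openin (top_of_set Sp) N' \<and> mat 1 \<in> N' \<and>
    (\<forall>M\<in>N'. \<exists>q. pathin (top_of_set Sp) q \<and> q 0 = mat 1 \<and> q 1 = M \<and> q ` {0..1} \<subseteq> N)"
proof -
  let ?J = "{0..1::real} \<times> (Sp :: (real^('n + 'n)^('n + 'n)) set)"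
  obtain O' where O': "open O'" "N = Sp \<inter> O'" using N(1) by (auto simp: openin_open)
  have one: "(mat 1 :: real^('n + 'n)^('n + 'n)) \<in> Sp" using N O'(2) by auto
  define A where "A = {x \<in> ?J. det (segment (- fst x) (snd x)) \<noteq> 0}"
  define W where "W = A \<inter> (\<lambda>x. cayley_path (fst x) (snd x)) -` O'"
  have seg: "continuous_on S (\<lambda>x. segment (fst x) (snd x))" "continuous_on S (\<lambda>x. segment (- fst x) (snd x))"
    for S :: "(real \<times> (real^('n + 'n)^('n + 'n))) set"
    unfolding segment_def by (intro continuous_intros)+
  have "openin (top_of_set ?J) (?J \<inter> (\<lambda>x. det (segment (- fst x) (snd x))) -` (- {0}))"
    by (rule continuous_openin_preimage_gen) (auto intro!: continuous_intros seg)
  moreover have "?J \<inter> (\<lambda>x. det (segment (- fst x) (snd x))) -` (- {0}) = A" by (auto simp: A_def)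
  ultimately have A: "openin (top_of_set ?J) A" by simp
  have inv: "invertible (segment (- s) M)" if "(s, M) \<in> A" for s M
    using that invertible_det_nz[of "segment (- s) M"] by (simp add: A_def)
  have cont: "continuous_on A (\<lambda>x. cayley_path (fst x) (snd x))"
    unfolding cayley_path_def by (intro continuous_intros seg inv) auto
  have "openin (top_of_set A) W"
    unfolding W_def by (rule continuous_openin_preimage_gen[OF cont O'(1)])
  then have "openin (top_of_set ?J) W" using A openin_trans by blast
  moreover have "{0..1} \<times> {mat 1} \<subseteq> W"
  proof
    fix x :: "real \<times> (real^('n + 'n)^('n + 'n))" assume "x \<in> {0..1} \<times> {mat 1}"
    then obtain s where s: "s \<in> {0..1}" "x = (s, mat 1)" by auto
    have seg1: "segment t (mat 1 :: real^('n + 'n)^('n + 'n)) = 2 *\<^sub>R mat 1" for t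
      unfolding segment_def scaleR_left_distrib[symmetric] by simp
    have inv1: "invertible (2 *\<^sub>R mat 1 :: real^('n + 'n)^('n + 'n))" by (rule invertible_scaleR_mat_1) simp
    then have "x \<in> A" using s one by (simp add: A_def seg1 flip: invertible_det_nz)
    moreover have "cayley_path s (mat 1 :: real^('n + 'n)^('n + 'n)) = mat 1"
      by (simp add: cayley_path_def seg1 matrix_inv_inverse[OF inv1])
    ultimately show "x \<in> W" using s N(2) O'(2) by (simp add: W_def)
  qed
  moreover have "compactin (top_of_set {0..1::real}) {0..1}" by (simp add: compactin_subtopology)
  ultimately obtain V where V: "openin (top_of_set Sp) V" "mat 1 \<in> V" "{0..1} \<times> V \<subseteq> W"
    using tube_lemma_left[of "top_of_set {0..1::real}" "top_of_set Sp" W "{0..1}" "mat 1"] one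
    by (auto simp: subset_iff)
  show ?thesis
  proof (intro exI[of _ V] conjI ballI V(1,2))
    fix M assume M: "M \<in> V"
    have W: "(s, M) \<in> W" if "s \<in> {0..1}" for s using V(3) M that by blast
    then have invM: "invertible (segment (- s) M)" if "s \<in> {0..1}" for s
      using inv that by (simp add: W_def)
    have MSp: "M \<in> Sp" using V(1) M openin_imp_subset by blast
    have Sp: "cayley_path s M \<in> Sp" if "s \<in> {0..1}" for s by (rule cayley_path_in_Sp[OF MSp invM[OF that]])
    show "\<exists>q. pathin (top_of_set Sp) q \<and> q 0 = mat 1 \<and> q 1 = M \<and> q ` {0..1} \<subseteq> N"
    proof (intro exI[of _ "\<lambda>s. cayley_path s M"] conjI)
      have "continuous_on {0..1} (\<lambda>s. cayley_path s M)"
        by (rule continuous_on_compose2[OF cont, of _ "\<lambda>s. (s, M)", simplified])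
          (use W in \<open>auto simp: W_def intro!: continuous_intros\<close>)
      then show "pathin (top_of_set Sp) (\<lambda>s. cayley_path s M)"
        using Sp by (auto simp: pathin_def)
      show "cayley_path 0 M = mat 1"
        using matrix_inv_inverse(1)[OF invM[of 0]] by (simp add: cayley_path_def)
      have "matrix_inv (2 *\<^sub>R mat 1 :: real^('n + 'n)^('n + 'n)) = (1 / 2) *\<^sub>R mat 1"
        by (rule matrix_inv_eqI) (simp add: matrix_scaleR_left matrix_scaleR_right)
      then show "cayley_path 1 M = M"
        by (simp add: cayley_path_def segment_def matrix_scaleR_left matrix_scaleR_right)
      show "(\<lambda>s. cayley_path s M) ` {0..1} \<subseteq> N" using W Sp O'(2) by (auto simp: W_def)
    qed
  qed
qed

section \<open>The universal covering group of the symplectic group\<close>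

lemma Sp_group_simps [simp]:
  "carrier Sp_group = Sp" "M \<otimes>\<^bsub>Sp_group\<^esub> N = M ** N" "\<one>\<^bsub>Sp_group\<^esub> = mat 1"
  by (simp_all add: Sp_group_def)

text \<open>The angle \<open>\<theta>\<close> is a parameter here, normalised at
  \<open>\<one>\<close>; its existence comes from \<open>angle_lift\<close>.\<close>

locale Sp_cover = covering_hom G T Sp_group Sp \<pi> + simply_connected_top_group G T
  for G :: "('g, 'm) monoid_scheme" (structure) and T
    and \<pi> :: "'g \<Rightarrow> real^('n::finite + 'n)^('n + 'n)" +
  fixes \<theta> :: "'g \<Rightarrow> real"
  assumes \<theta>_cont: "continuous_map T euclideanreal \<theta>"
    and cis_\<theta>: "\<And>g. g \<in> carrier G \<Longrightarrow> cis (\<theta> g) = det (unitary_part (\<pi> g))"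
    and \<theta>_one: "\<theta> \<one> = 0"
begin

section \<open>Elements over U(n) and SU(n)\<close>

lemma \<pi>_mult: "x \<in> carrier G \<Longrightarrow> y \<in> carrier G \<Longrightarrow> \<pi> (x \<otimes> y) = \<pi> x ** \<pi> y"
  using p.hom_mult by simp

lemma \<pi>_one: "\<pi> \<one> = mat 1" using p.hom_one by simp

lemma \<pi>_in_Sp: "x \<in> carrier G \<Longrightarrow> \<pi> x \<in> Sp" using p.hom_closed by simp

lemma \<pi>_inv:
  assumes "x \<in> carrier G" "\<pi> x = unitary_embed W" "W \<in> unitary_matrices"
  shows "\<pi> (inv x) = unitary_embed (adjoint_matrix W)"
proof -
  have "unitary_embed (adjoint_matrix W) ** \<pi> x = mat 1"
    using assms unitary_matricesD(1)[OF assms(3)] by (simp add: unitary_embed_one flip: unitary_embed_mult)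
  then have "inv\<^bsub>Sp_group\<^esub> (\<pi> x) = unitary_embed (adjoint_matrix W)"
    using \<pi>_in_Sp[OF assms(1)] unitary_embed_in_Sp[OF adjoint_unitary[OF assms(3)]]
    by (intro B.inv_equality) simp_all
  then show ?thesis using assms(1) by simp
qed

definition "lift_unitary = {x \<in> carrier G. \<pi> x \<in> unitary_embed ` unitary_matrices}"

lemma lift_unitary_carrier: "x \<in> lift_unitary \<Longrightarrow> x \<in> carrier G"
  by (simp add: lift_unitary_def)

lemma lift_unitaryE:
  assumes "x \<in> lift_unitary"
  obtains W where "W \<in> unitary_matrices" "\<pi> x = unitary_embed W" "cis (\<theta> x) = det W"
proof -
  obtain W where "W \<in> unitary_matrices" "\<pi> x = unitary_embed W" using assms by (auto simp: lift_unitary_def)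
  moreover have "x \<in> carrier G" by (rule lift_unitary_carrier[OF assms])
  ultimately show thesis using cis_\<theta>[of x] unitary_part_embed[of W] by (intro that[of W]) simp_all
qed

text \<open>Equivariance of the unitary part and multiplicativity of the determinant show that both
  sides agree modulo \<open>2 * pi\<close>. They agree at \<open>y = \<one>\<close>, and
  \<open>y\<close> ranges over a connected group.\<close>

lemma \<theta>_mult:
  assumes x: "x \<in> lift_unitary" and y: "y \<in> carrier G"
  shows "\<theta> (x \<otimes> y) = \<theta> x + \<theta> y"
proof (rule cis_eq_imp_constant_difference[OF connected, of "\<lambda>y. \<theta> (x \<otimes> y)" "\<lambda>y. \<theta> x + \<theta> y" \<one>])
  have xG: "x \<in> carrier G" by (rule lift_unitary_carrier[OF x])
  obtain W where W: "W \<in> unitary_matrices" "\<pi> x = unitary_embed W" "cis (\<theta> x) = det W"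
    by (rule lift_unitaryE[OF x])
  have "continuous_map T T (\<lambda>y. x \<otimes> y)"
    using continuous_map_mult[OF continuous_map_const_carrier continuous_map_id, of x] xG by (simp add: id_def)
  from continuous_map_compose[OF this \<theta>_cont] show "continuous_map T euclideanreal (\<lambda>y. \<theta> (x \<otimes> y))"
    by (simp add: o_def)
  show "continuous_map T euclideanreal (\<lambda>y. \<theta> x + \<theta> y)"
    by (intro continuous_map_add \<theta>_cont) simp
  show "cis (\<theta> (x \<otimes> y)) = cis (\<theta> x + \<theta> y)" if "y \<in> topspace T" for y
    using that xG W by (simp add: cis_\<theta> \<pi>_mult unitary_part_embed_mult det_mul flip: cis_mult)
  show "\<theta> (x \<otimes> \<one>) = \<theta> x + \<theta> \<one>" using xG \<theta>_one by simp
qed (use y in simp_all)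

lemma lift_unitary_subgroup: "subgroup lift_unitary G"
proof
  show "\<one> \<in> lift_unitary"
    by (auto simp: lift_unitary_def \<pi>_one unitary_matrices_def adjoint_mat intro!: image_eqI[of _ _ "mat 1"] unitary_embed_one[symmetric])
  fix x assume x: "x \<in> lift_unitary"
  then have xG: "x \<in> carrier G" by (rule lift_unitary_carrier)
  obtain W where W: "W \<in> unitary_matrices" "\<pi> x = unitary_embed W" by (rule lift_unitaryE[OF x])
  show "inv x \<in> lift_unitary"
    using xG \<pi>_inv[OF xG W(2,1)] adjoint_unitary[OF W(1)] by (simp add: lift_unitary_def)
  fix y assume y: "y \<in> lift_unitary"
  then have yG: "y \<in> carrier G" by (rule lift_unitary_carrier)
  obtain V where V: "V \<in> unitary_matrices" "\<pi> y = unitary_embed V" by (rule lift_unitaryE[OF y])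
  have "\<pi> (x \<otimes> y) = unitary_embed (W ** V)" using xG yG V W by (simp add: \<pi>_mult unitary_embed_mult)
  then show "x \<otimes> y \<in> lift_unitary"
    using xG yG mult_unitary[OF W(1) V(1)] by (simp add: lift_unitary_def)
qed (auto dest: lift_unitary_carrier)

lemma \<theta>_inv: "x \<in> lift_unitary \<Longrightarrow> \<theta> (inv x) = - \<theta> x"
  using \<theta>_mult[of x "inv x"] lift_unitary_carrier[of x] \<theta>_one by simp

definition "lift_special_unitary = {x \<in> carrier G. \<pi> x \<in> unitary_embed ` special_unitary}"

text \<open>Replaces the determinant condition by one on \<open>\<theta>\<close>, so that products,
  inverses and conjugates are handled by additivity.\<close>

lemma lift_special_unitary_iff:
  "x \<in> lift_special_unitary \<longleftrightarrow> x \<in> lift_unitary \<and> cis (\<theta> x) = 1"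
proof
  assume "x \<in> lift_special_unitary"
  then obtain W where "x \<in> carrier G" "\<pi> x = unitary_embed W" "W \<in> unitary_matrices" "det W = 1"
    by (auto simp: lift_special_unitary_def special_unitary_eq)
  then show "x \<in> lift_unitary \<and> cis (\<theta> x) = 1"
    using cis_\<theta>[of x] unitary_part_embed[of W] by (auto simp: lift_unitary_def)
next
  assume x: "x \<in> lift_unitary \<and> cis (\<theta> x) = 1"
  then obtain W where "W \<in> unitary_matrices" "\<pi> x = unitary_embed W" "cis (\<theta> x) = det W"
    by (blast elim: lift_unitaryE)
  then show "x \<in> lift_special_unitary"
    using x by (auto simp: lift_special_unitary_def special_unitary_eq lift_unitary_def)
qed

lemma lift_special_unitary_subgroup: "subgroup lift_special_unitary G"
proof -
  interpret U: subgroup lift_unitary G by (rule lift_unitary_subgroup)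
  show ?thesis
  proof
    show "lift_special_unitary \<subseteq> carrier G" by (auto simp: lift_special_unitary_def)
    show "\<one> \<in> lift_special_unitary" by (simp add: lift_special_unitary_iff \<theta>_one)
    show "x \<otimes> y \<in> lift_special_unitary" if "x \<in> lift_special_unitary" "y \<in> lift_special_unitary" for x y
      using that by (simp add: lift_special_unitary_iff \<theta>_mult flip: cis_mult)
    show "inv x \<in> lift_special_unitary" if "x \<in> lift_special_unitary" for x
      using that cis_inverse[of "\<theta> x"] by (simp add: lift_special_unitary_iff \<theta>_inv)
  qed
qed

abbreviation "H \<equiv> identity_component lift_special_unitary"

lemma lift_SU_eq: "lift_SU G T \<pi> = H"
  by (simp add: lift_SU_def lifted_identity_component_def lift_special_unitary_def)

lemma H_subgroup: "subgroup H G" by (rule identity_component_subgroup[OF lift_special_unitary_subgroup])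

lemma H_lift_unitary: "h \<in> H \<Longrightarrow> h \<in> lift_unitary"
  using identity_component_subset[of lift_special_unitary] lift_special_unitary_iff by blast

text \<open>Over SU(n) the angle is a multiple of \<open>2 * pi\<close>; on the identity component
  it keeps its value at \<open>\<one>\<close>.\<close>

lemma \<theta>_H: assumes "h \<in> H" shows "\<theta> h = 0"
proof (rule cis_one_imp_constant[of "subtopology T H" \<theta> \<one>])
  show "connected_space (subtopology T H)"
    using connectedin_identity_component by (simp add: connectedin_def)
  show "continuous_map (subtopology T H) euclideanreal \<theta>"
    by (rule continuous_map_from_subtopology[OF \<theta>_cont])
  show "cis (\<theta> x) = 1" if "x \<in> topspace (subtopology T H)" for x
    using that identity_component_subset[of lift_special_unitary] lift_special_unitary_iff by auto
qed (use assms \<theta>_one H_lift_unitary lift_unitary_carrier subgroup.one_closed[OF H_subgroup] in auto)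

section \<open>The one-parameter group over the unit scalars\<close>

abbreviation "scalar a \<equiv> (mat (cis a) :: complex^'n^'n)"

lemma scalar_unitary: "scalar a \<in> unitary_matrices"
  by (simp add: unitary_matrices_def adjoint_mat mat_mult_mat cis_cnj cis_mult)

lemma scalar_mult: "scalar a ** scalar b = scalar (a + b)"
  by (simp add: mat_mult_mat cis_mult)

lemma det_scalar: "det (scalar a) = cis (real CARD('n) * a)"
proof -
  have "det (mat c :: complex^'n^'n) = c ^ CARD('n)" for c
    by (subst det_diagonal) (simp_all add: mat_def)
  then show ?thesis by (simp only: Complex.DeMoivre)
qed

lemma continuous_scalar: "continuous_on S (\<lambda>a. unitary_embed (scalar a))"
proof -
  have "continuous_on S (\<lambda>a. if i = j then cis a else 0)" for i j :: 'n
    by (cases "i = j") (auto intro!: continuous_intros)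
  then show ?thesis unfolding mat_def by (intro continuous_intros)
qed

text \<open>\<open>lift_exists\<close> works over compact convex sets. The lifts over the intervals
  from -N to N agree where they overlap, by uniqueness, and are glued.\<close>

lemma one_parameter_lift:
  obtains r where "continuous_map euclideanreal T r" "\<And>a. \<pi> (r a) = unitary_embed (scalar a)" "r 0 = \<one>"
proof -
  let ?I = "\<lambda>N::nat. {- real N .. real N}"
  have "\<exists>\<Phi>. continuous_map (top_of_set (?I N)) T \<Phi> \<and> (\<forall>a\<in>?I N. \<pi> (\<Phi> a) = unitary_embed (scalar a)) \<and> \<Phi> 0 = \<one>" for N
  proof -
    have "\<pi> \<one> = unitary_embed (scalar 0)" by (simp add: \<pi>_one unitary_embed_one)
    then obtain \<Phi> where "continuous_map (top_of_set (?I N)) T \<Phi>"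
        "\<And>a. a \<in> ?I N \<Longrightarrow> \<pi> (\<Phi> a) = unitary_embed (scalar a)" "\<Phi> 0 = \<one>"
      using lift_exists[of "?I N" "\<lambda>a. unitary_embed (scalar a)" \<one>] continuous_scalar
        unitary_embed_in_Sp[OF scalar_unitary] by force
    then show ?thesis by blast
  qed
  then obtain \<Phi> where \<Phi>: "\<And>N. continuous_map (top_of_set (?I N)) T (\<Phi> N)"
      "\<And>N a. a \<in> ?I N \<Longrightarrow> \<pi> (\<Phi> N a) = unitary_embed (scalar a)" "\<And>N. \<Phi> N 0 = \<one>"
    by metis
  have agree: "\<Phi> N a = \<Phi> M a" if "a \<in> ?I N" "N \<le> M" for N M a
  proof (rule lift_unique[of "top_of_set (?I N)" "\<Phi> N" "\<Phi> M" 0 a])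
    have sub: "?I N \<subseteq> ?I M" using that by auto
    show "connected_space (top_of_set (?I N))" by (rule connected_space_convex) simp
    show "continuous_map (top_of_set (?I N)) T (\<Phi> M)"
      using continuous_map_from_subtopology_mono[OF \<Phi>(1) sub] .
    show "\<pi> (\<Phi> N x) = \<pi> (\<Phi> M x)" if "x \<in> topspace (top_of_set (?I N))" for x
      using \<Phi>(2)[of x N] \<Phi>(2)[of x M] that sub by auto
  qed (use \<Phi> that in auto)
  define r where "r a = \<Phi> (nat \<lceil>\<bar>a\<bar>\<rceil>) a" for a
  have r: "r a = \<Phi> N a" if "a \<in> ?I N" for a N
    unfolding r_def
  proof (rule agree)
    show "a \<in> ?I (nat \<lceil>\<bar>a\<bar>\<rceil>)" by (simp, linarith)
    show "nat \<lceil>\<bar>a\<bar>\<rceil> \<le> N" using that by (simp add: ceiling_le_iff, linarith)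
  qed
  show thesis
  proof
    show "continuous_map euclideanreal T r"
    proof (rule continuous_map_locally)
      fix a :: real
      obtain N :: nat where N: "\<bar>a\<bar> < N" using reals_Archimedean2 by blast
      have "continuous_map (top_of_set {- real N<..<real N}) T (\<Phi> N)"
        by (rule continuous_map_from_subtopology_mono[OF \<Phi>(1)]) auto
      then have "continuous_map (top_of_set {- real N<..<real N}) T r"
        by (rule continuous_map_eq) (simp add: r[of _ N])
      then show "\<exists>U. openin euclideanreal U \<and> a \<in> U \<and> continuous_map (top_of_set U) T r"
        using N by (intro exI[of _ "{- real N<..<real N}"]) (auto simp: open_openin[symmetric])
    qed
    show "\<pi> (r a) = unitary_embed (scalar a)" for a
      unfolding r_def by (rule \<Phi>(2)) (simp, linarith)
    show "r 0 = \<one>" by (simp add: r_def \<Phi>(3))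
  qed
qed

definition "r = (SOME r. continuous_map euclideanreal T r \<and> (\<forall>a. \<pi> (r a) = unitary_embed (scalar a)) \<and> r 0 = \<one>)"

lemma r_cont: "continuous_map euclideanreal T r"
  and \<pi>_r: "\<pi> (r a) = unitary_embed (scalar a)"
  and r_0: "r 0 = \<one>"
proof -
  have "\<exists>r. continuous_map euclideanreal T r \<and> (\<forall>a. \<pi> (r a) = unitary_embed (scalar a)) \<and> r 0 = \<one>"
    using one_parameter_lift by metis
  from someI_ex[OF this] show "continuous_map euclideanreal T r" "\<pi> (r a) = unitary_embed (scalar a)" "r 0 = \<one>"
    unfolding r_def by blast+
qed

lemma r_carrier: "r a \<in> carrier G" using continuous_map_in_carrier[OF r_cont] by simp

lemma r_lift_unitary: "r a \<in> lift_unitary"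
  using r_carrier \<pi>_r scalar_unitary by (simp add: lift_unitary_def)

text \<open>As functions of \<open>a\<close>, both sides lift the same path, and they coincide at
  \<open>a = 0\<close>.\<close>

lemma r_add: "r (a + b) = r a \<otimes> r b"
proof (rule lift_unique[of euclideanreal "\<lambda>a. r (a + b)" "\<lambda>a. r a \<otimes> r b" 0 a])
  show "connected_space euclideanreal" using connected_space_convex[of "UNIV :: real set"] by simp
  have "continuous_map euclideanreal euclideanreal (\<lambda>a. a + b)" by (auto intro!: continuous_intros)
  from continuous_map_compose[OF this r_cont] show "continuous_map euclideanreal T (\<lambda>a. r (a + b))"
    by (simp add: o_def)
  show "continuous_map euclideanreal T (\<lambda>a. r a \<otimes> r b)"
    by (intro continuous_map_mult r_cont continuous_map_const_carrier r_carrier)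
  show "\<pi> (r (x + b)) = \<pi> (r x \<otimes> r b)" for x
    by (simp add: \<pi>_mult r_carrier \<pi>_r scalar_mult flip: unitary_embed_mult)
qed (simp_all add: r_0 r_carrier)

lemma r_minus: "r (- a) = inv (r a)"
  using r_add[of "- a" a] r_carrier by (intro inv_equality[symmetric]) (simp_all add: r_0)

text \<open>The factor is the degree of the determinant on scalar matrices.\<close>

lemma \<theta>_r: "\<theta> (r a) = real CARD('n) * a"
proof (rule cis_eq_imp_constant_difference[of euclideanreal "\<lambda>a. \<theta> (r a)" "\<lambda>a. real CARD('n) * a" 0])
  show "connected_space euclideanreal" using connected_space_convex[of "UNIV :: real set"] by simp
  show "continuous_map euclideanreal euclideanreal (\<lambda>a. \<theta> (r a))"
    using continuous_map_compose[OF r_cont \<theta>_cont] by (simp add: o_def)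
  show "continuous_map euclideanreal euclideanreal (\<lambda>a. real CARD('n) * a)" by (auto intro!: continuous_intros)
  show "cis (\<theta> (r x)) = cis (real CARD('n) * x)" for x
    by (simp add: cis_\<theta> r_carrier \<pi>_r unitary_part_embed[OF scalar_unitary] det_scalar)
qed (simp_all add: r_0 \<theta>_one)

lemma unit_scalars_eq: "unit_scalars = range scalar" by (simp add: unit_scalars_def)

text \<open>The image of \<open>r\<close> is connected, which gives one inclusion. For the other, an
  element of the component is compared with the point of the image of \<open>r\<close> that has the
  same angle; the quotient is discrete-valued and hence trivial.\<close>

lemma lift_scalars_eq: "lift_scalars G T \<pi> = range r"
proof -
  let ?S = "{x \<in> carrier G. \<pi> x \<in> unitary_embed ` unit_scalars}"
  have R: "lift_scalars G T \<pi> = identity_component ?S"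
    by (simp add: lift_scalars_def lifted_identity_component_def)
  show ?thesis unfolding R
  proof
    have "connectedin T (r ` UNIV)"
      using connectedin_continuous_map_image[OF r_cont, of UNIV] connected_space_convex[of "UNIV :: real set"]
      by (simp add: connectedin_def)
    moreover have "\<one> \<in> range r" by (metis r_0 rangeI)
    moreover have "range r \<subseteq> ?S" by (auto simp: r_carrier \<pi>_r unit_scalars_eq)
    ultimately show "range r \<subseteq> identity_component ?S" by (rule identity_component_maximal)
  next
    let ?R = "identity_component ?S"
    have RS: "?R \<subseteq> ?S" using identity_component_subset[of ?S] by blast
    have conn: "connected_space (subtopology T ?R)"
      using connectedin_identity_component[of ?S] by (simp add: connectedin_def)
    have top: "topspace (subtopology T ?R) = ?R" using RS by auto
    have "\<pi> \<one> \<in> unitary_embed ` unit_scalars"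
      unfolding unit_scalars_eq by (metis \<pi>_r imageI r_0 rangeI)
    then have one: "\<one> \<in> ?R" by (intro one_in_identity_component) simp
    have n: "real CARD('n) > 0" by simp
    \<comment> \<open>This factor cancels the angle, so \<open>h x\<close> lies over a scalar n-th
      root of unity. There are finitely many of these, so \<open>\<pi> (h x)\<close> is constant;
      then \<open>h\<close> takes values in the discrete kernel and is constant too.\<close>
    define h where "h x = x \<otimes> r (- \<theta> x / CARD('n))" for x
    have RG: "x \<in> carrier G" if "x \<in> ?R" for x using RS that by blast
    have h_cont: "continuous_map (subtopology T ?R) T h"
    proof -
      have "continuous_map (subtopology T ?R) euclideanreal (\<lambda>x. - \<theta> x / CARD('n))"
        using continuous_map_from_subtopology[OF \<theta>_cont, of ?R]
        by (intro continuous_map_real_divide continuous_map_minus) auto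
      from continuous_map_compose[OF this r_cont]
      show ?thesis unfolding h_def
        by (intro continuous_map_mult continuous_map_from_subtopology[OF continuous_map_id, unfolded id_def])
          (simp add: o_def)
    qed
    let ?F = "unitary_embed ` mat ` {z. z ^ CARD('n) = 1}"
    have \<pi>h: "\<pi> (h x) \<in> ?F" if x: "x \<in> ?R" for x
    proof -
      obtain a where a: "\<pi> x = unitary_embed (scalar a)" using RS x by (auto simp: unit_scalars_eq)
      have "cis (\<theta> x) = cis (real CARD('n) * a)"
        using cis_\<theta>[OF RG[OF x]] a by (simp add: unitary_part_embed[OF scalar_unitary] det_scalar)
      then have "cis (real CARD('n) * a - \<theta> x) = 1" by (simp flip: cis_divide)
      then have "cis (a - \<theta> x / CARD('n)) ^ CARD('n) = 1"
        by (simp add: Complex.DeMoivre right_diff_distrib)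
      moreover have "\<pi> (h x) = unitary_embed (scalar (a - \<theta> x / CARD('n)))"
        by (simp add: h_def \<pi>_mult RG[OF x] r_carrier a \<pi>_r scalar_mult flip: unitary_embed_mult)
      ultimately show ?thesis by blast
    qed
    have "finite ?F" by (intro finite_imageI finite_roots_unity) simp
    have h1: "h \<one> = \<one>" by (simp add: h_def \<theta>_one r_0)
    have \<pi>h_one: "\<pi> (h x) = mat 1" if x: "x \<in> ?R" for x
    proof -
      have "continuous_map (subtopology T ?R) euclidean (\<lambda>x. \<pi> (h x))"
        using continuous_map_compose[OF h_cont p_cont] by (auto simp: o_def continuous_map_in_subtopology)
      then have "\<pi> (h x) = \<pi> (h \<one>)"
        by (rule connected_countable_range_constant[OF conn _ countable_finite[OF \<open>finite ?F\<close>]])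
          (unfold top, use \<pi>h x one in auto)
      then show ?thesis by (simp add: h1 \<pi>_one)
    qed
    have h_one: "h x = \<one>" if x: "x \<in> ?R" for x
    proof (rule kernel_valued_constant[OF conn h_cont _ _ h1, unfolded top])
      show "\<pi> (h y) = \<one>\<^bsub>Sp_group\<^esub>" if "y \<in> ?R" for y
        unfolding Sp_group_simps by (rule \<pi>h_one[OF that])
    qed (rule one x)+
    show "?R \<subseteq> range r"
    proof
      fix x assume x: "x \<in> ?R"
      have "x \<otimes> inv (r (\<theta> x / CARD('n))) = \<one>" using h_one[OF x] by (simp add: h_def flip: r_minus)
      then have "x = r (\<theta> x / CARD('n))"
        using RG[OF x] r_carrier inv_solve_right'[of \<one> x] by simp
      then show "x \<in> range r" by (rule range_eqI)
    qed
  qed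
qed

section \<open>The group HR and the preimage of U(n)\<close>

abbreviation "K \<equiv> H <#> range r"

lemma HR_eq: "HR G T \<pi> = K" by (simp add: HR_def lift_SU_eq lift_scalars_eq)

lemma K_iff: "x \<in> K \<longleftrightarrow> (\<exists>h\<in>H. \<exists>a. x = h \<otimes> r a)" by (auto simp: set_mult_def)

lemma K_lift_unitary: "x \<in> K \<Longrightarrow> x \<in> lift_unitary"
  using H_lift_unitary r_lift_unitary subgroup.m_closed[OF lift_unitary_subgroup] by (auto simp: K_iff)

text \<open>Conjugation by an element over U(n) leaves \<open>\<theta>\<close> unchanged on the
  group over SU(n), by additivity. This normalisation of \<open>H\<close> is what makes
  \<open>K\<close> a subgroup.\<close>

lemma H_conjugate: "h \<in> H \<Longrightarrow> r a \<otimes> h \<otimes> r (- a) \<in> H"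
  unfolding r_minus
proof (rule identity_component_conjugate[OF r_carrier])
  interpret U: subgroup lift_unitary G by (rule lift_unitary_subgroup)
  show "\<one> \<in> lift_special_unitary" by (rule subgroup.one_closed[OF lift_special_unitary_subgroup])
  show "r a \<otimes> y \<otimes> inv (r a) \<in> lift_special_unitary" if "y \<in> lift_special_unitary" for y
    using that r_lift_unitary[of a]
    by (simp add: lift_special_unitary_iff \<theta>_mult \<theta>_inv)
qed

lemma H_carrier: "h \<in> H \<Longrightarrow> h \<in> carrier G" by (rule subgroup.mem_carrier[OF H_subgroup])

lemma K_subgroup: "subgroup K G"
proof
  show "K \<subseteq> carrier G" using K_lift_unitary lift_unitary_carrier by blast
  show "\<one> \<in> K" using subgroup.one_closed[OF H_subgroup] by (auto simp: K_iff intro!: bexI[of _ \<one>] exI[of _ 0] simp: r_0)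
next
  fix x y assume "x \<in> K" "y \<in> K"
  then obtain h k a b where h: "h \<in> H" "x = h \<otimes> r a" and k: "k \<in> H" "y = k \<otimes> r b" by (auto simp: K_iff)
  have "x \<otimes> y = h \<otimes> (r a \<otimes> k \<otimes> r (- a)) \<otimes> r (a + b)"
    using h k by (simp add: r_add r_minus m_assoc H_carrier r_carrier inv_solve_left)
  moreover have "h \<otimes> (r a \<otimes> k \<otimes> r (- a)) \<in> H"
    using subgroup.m_closed[OF H_subgroup h(1) H_conjugate[OF k(1)]] .
  ultimately show "x \<otimes> y \<in> K" unfolding K_iff by blast
next
  fix x assume "x \<in> K"
  then obtain h a where h: "h \<in> H" "x = h \<otimes> r a" by (auto simp: K_iff)
  have ih: "inv h \<in> H" by (rule subgroup.m_inv_closed[OF H_subgroup h(1)])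
  have "inv x = (r (- a) \<otimes> inv h \<otimes> r (- (- a))) \<otimes> r (- a)"
    using h by (simp add: inv_mult_group r_minus m_assoc H_carrier r_carrier)
  then show "inv x \<in> K" using H_conjugate[OF ih] unfolding K_iff by blast
qed

lemma \<theta>_K: "h \<in> H \<Longrightarrow> \<theta> (h \<otimes> r a) = real CARD('n) * a"
  by (simp add: \<theta>_mult H_lift_unitary r_carrier \<theta>_H \<theta>_r)

text \<open>On \<open>K\<close> the angle is n times the scalar parameter, so it vanishes only for
  the trivial scalar factor. On the whole preimage of SU(n) the angle is known only modulo
  \<open>2 * pi\<close>.\<close>

lemma H_eq: "H = {x \<in> K. \<theta> x = 0}"
proof (intro equalityI subsetI)
  fix x assume x: "x \<in> H"
  then have "x = x \<otimes> r 0" using H_carrier by (simp add: r_0)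
  then show "x \<in> {x \<in> K. \<theta> x = 0}" using x \<theta>_H K_iff by blast
next
  fix x assume "x \<in> {x \<in> K. \<theta> x = 0}"
  then obtain h a where h: "h \<in> H" "x = h \<otimes> r a" "\<theta> x = 0" by (auto simp: K_iff)
  then have "a = 0" using \<theta>_K by simp
  then show "x \<in> H" using h H_carrier by (simp add: r_0)
qed

text \<open>
  A path from \<open>\<one>\<close> to an element over the unitary group is deformed, relative to its endpoints, into
  a path \<open>p\<close> over the unitary group; then \<open>p t \<otimes> r (- \<theta> (p t) / n)\<close> is a path over the special unitary group.
\<close>

lemma lift_unitary_subset_K: "lift_unitary \<subseteq> K"
proof
  fix z assume z: "z \<in> lift_unitary"
  obtain W where W: "W \<in> unitary_matrices" "\<pi> z = unitary_embed W" by (rule lift_unitaryE[OF z])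
  obtain q where q: "pathin T q" "q 0 = \<one>" "q 1 = z" by (rule path_from_one[OF lift_unitary_carrier[OF z]])
  let ?I = "top_of_set {0..1::real}"
  have qc: "continuous_map ?I T q" using q by (simp add: pathin_def)
  have qG: "q t \<in> carrier G" if "t \<in> {0..1}" for t using continuous_map_in_carrier[OF qc] that by simp
  have \<pi>q: "continuous_on {0..1} (\<lambda>t. \<pi> (q t))"
    using continuous_map_compose[OF qc p_cont] by (simp add: o_def)
  let ?J = "{0..1::real} \<times> {0..1::real}"
  \<comment> \<open>The first coordinate deforms, the second runs along the path.\<close>
  define F where "F x = deform (fst x) (\<pi> (q (snd x)))" for x
  have "continuous_on ?J (\<lambda>x. \<pi> (q (snd x)))"
    by (rule continuous_on_compose2[OF \<pi>q]) (auto intro!: continuous_intros)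
  then have "continuous_on ?J (\<lambda>x. (fst x, \<pi> (q (snd x))))" by (intro continuous_intros)
  then have F_cont: "continuous_on ?J F"
    using continuous_on_compose2[OF continuous_on_deform[OF order_refl], of ?J "\<lambda>x. (fst x, \<pi> (q (snd x)))"]
      qG \<pi>_in_Sp by (force simp: F_def[abs_def])
  have one: "mat 1 = unitary_embed (mat 1)" "mat 1 \<in> unitary_matrices"
    by (simp_all add: unitary_embed_one unitary_matrices_def adjoint_mat)
  have F_one: "F (s, 0) = mat 1" for s using deform_unitary[OF one(2)] by (simp add: F_def q \<pi>_one flip: one(1))
  have F_z: "F (s, 1) = \<pi> z" for s using deform_unitary[OF W(1)] by (simp add: F_def q W(2))
  obtain \<Phi> where \<Phi>: "continuous_map (top_of_set ?J) T \<Phi>" "\<And>x. x \<in> ?J \<Longrightarrow> \<pi> (\<Phi> x) = F x" "\<Phi> 0 = \<one>"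
  proof (rule lift_exists[of ?J F \<one>])
    show "F ` ?J \<subseteq> Sp" using qG \<pi>_in_Sp by (auto simp: F_def intro!: deform_in_Sp)
    show "\<pi> \<one> = F 0" using F_one[of 0] by (simp add: zero_prod_def \<pi>_one)
  qed (use F_cont in \<open>auto simp: zero_prod_def intro: compact_Times convex_Times\<close>)
  have edge: "continuous_map ?I T (\<lambda>t. \<Phi> (c t))" if "continuous_on {0..1} c" "c ` {0..1} \<subseteq> ?J" for c
    using continuous_map_compose[OF _ \<Phi>(1), of ?I c] that by (auto simp: o_def)
  have conn: "connected_space ?I" by (rule connected_space_convex) simp
  \<comment> \<open>Uniqueness of lifts identifies three edges of the lifted square: the given path
    \<open>q\<close>, and constant paths at \<open>\<one>\<close> and at \<open>z\<close>. The
    fourth edge is then a path from \<open>\<one>\<close> to \<open>z\<close> lying over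
    U(n).\<close>
  have left: "\<Phi> (0, t) = q t" if "t \<in> {0..1}" for t
  proof (rule lift_unique[OF conn, of "\<lambda>t. \<Phi> (0, t)" q 0])
    show "continuous_map ?I T (\<lambda>t. \<Phi> (0, t))" by (rule edge) (auto intro!: continuous_intros)
    show "\<pi> (\<Phi> (0, x)) = \<pi> (q x)" if "x \<in> topspace ?I" for x
      using that \<Phi>(2)[of "(0, x)"] deform_0[OF \<pi>_in_Sp[OF qG[of x]]] by (simp add: F_def)
    show "\<Phi> (0, 0) = q 0" using \<Phi>(3) by (simp add: zero_prod_def q)
  qed (use qc that in auto)
  have bottom: "\<Phi> (s, 0) = \<one>" if "s \<in> {0..1}" for s
  proof (rule lift_unique[OF conn, of "\<lambda>s. \<Phi> (s, 0)" "\<lambda>_. \<one>" 0])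
    show "continuous_map ?I T (\<lambda>s. \<Phi> (s, 0))" by (rule edge) (auto intro!: continuous_intros)
    show "\<pi> (\<Phi> (x, 0)) = \<pi> \<one>" if "x \<in> topspace ?I" for x
      using that \<Phi>(2)[of "(x, 0)"] F_one by (simp add: \<pi>_one)
    show "\<Phi> (0, 0) = \<one>" using \<Phi>(3) by (simp add: zero_prod_def)
  qed (use that in auto)
  have top: "\<Phi> (s, 1) = z" if "s \<in> {0..1}" for s
  proof (rule lift_unique[OF conn, of "\<lambda>s. \<Phi> (s, 1)" "\<lambda>_. z" 0])
    show "continuous_map ?I T (\<lambda>s. \<Phi> (s, 1))" by (rule edge) (auto intro!: continuous_intros)
    show "\<pi> (\<Phi> (x, 1)) = \<pi> z" if "x \<in> topspace ?I" for x
      using that \<Phi>(2)[of "(x, 1)"] F_z by simp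
    show "\<Phi> (0, 1) = z" using left[of 1] q by simp
    show "continuous_map ?I T (\<lambda>_. z)" using lift_unitary_carrier[OF z] by simp
  qed (use that in auto)
  define p where "p t = \<Phi> (1, t)" for t
  have p_cont: "continuous_map ?I T p" unfolding p_def by (rule edge) (auto intro!: continuous_intros)
  have p_unitary: "p t \<in> lift_unitary" if "t \<in> {0..1}" for t
    using that \<Phi>(2)[of "(1, t)"] deform_1[of "\<pi> (q t)"] unitary_part_unitary[OF \<pi>_in_Sp[OF qG[OF that]]]
      continuous_map_in_carrier[OF p_cont]
    by (auto simp: p_def F_def lift_unitary_def)
  \<comment> \<open>Dividing by n compensates \<open>\<theta>_r\<close>, so that
    \<open>\<theta> (h t) = 0\<close>.\<close>
  define h where "h t = p t \<otimes> r (- \<theta> (p t) / CARD('n))" for t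
  have "continuous_map ?I T h"
  proof -
    have "continuous_map ?I euclideanreal (\<lambda>t. - \<theta> (p t) / CARD('n))"
      using continuous_map_compose[OF p_cont \<theta>_cont]
      by (intro continuous_map_real_divide continuous_map_minus) (auto simp: o_def)
    from continuous_map_compose[OF this r_cont] show ?thesis
      unfolding h_def by (intro continuous_map_mult p_cont) (simp add: o_def)
  qed
  then have "connectedin T (h ` {0..1})" by (intro connectedin_path_image) (simp add: pathin_def)
  moreover have "\<one> \<in> h ` {0..1}"
    using bottom[of 1] by (intro image_eqI[of _ _ 0]) (simp_all add: h_def p_def \<theta>_one r_0)
  moreover have "h ` {0..1} \<subseteq> lift_special_unitary"
  proof clarify
    fix t :: real assume "t \<in> {0..1}"
    then have "p t \<in> lift_unitary" by (rule p_unitary)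
    then show "h t \<in> lift_special_unitary"
      unfolding lift_special_unitary_iff h_def
      using subgroup.m_closed[OF lift_unitary_subgroup _ r_lift_unitary] by (simp add: \<theta>_mult r_carrier \<theta>_r)
  qed
  ultimately have "h ` {0..1} \<subseteq> H" by (rule identity_component_maximal)
  moreover have "h 1 \<in> h ` {0..1}" by (rule imageI) simp
  ultimately have h1: "h 1 \<in> H" by blast
  have "p 1 = z" using top[of 1] by (simp add: p_def)
  then have "h 1 = z \<otimes> inv (r (\<theta> z / CARD('n)))" by (simp add: h_def flip: r_minus)
  then have "z = h 1 \<otimes> r (\<theta> z / CARD('n))"
    using inv_solve_right[of "h 1" z "r (\<theta> z / CARD('n))"] lift_unitary_carrier[OF z] r_carrier H_carrier[OF h1] by simp
  then show "z \<in> K" using h1 unfolding K_iff by blast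
qed

text \<open>A central element commutes with a lift of \<open>Omega\<close>, and commuting with
  \<open>Omega\<close> already forces its image to be unitary.\<close>

lemma center_subset_K: "group_center G \<subseteq> K"
proof
  fix z assume z: "z \<in> group_center G"
  have zG: "z \<in> carrier G" by (rule group_center_carrier[OF z])
  obtain g where g: "g \<in> carrier G" "\<pi> g = Omega" using p_surj Omega_in_Sp by (metis imageE)
  have "\<pi> (z \<otimes> g) = \<pi> (g \<otimes> z)" using group_center_comm[OF z g(1)] by simp
  then have "\<pi> z ** Omega = Omega ** \<pi> z" using zG g by (simp add: \<pi>_mult)
  then have "z \<in> lift_unitary"
    using commute_Omega_imp_unitary[OF \<pi>_in_Sp[OF zG]] zG by (simp add: lift_unitary_def)
  then show "z \<in> K" using lift_unitary_subset_K by blast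
qed

text \<open>The parameter of \<open>r\<close> is divided by n to make it a section of
  \<open>\<theta>\<close>.\<close>

sublocale real_valued_on_subgroup G T K H \<theta> "\<lambda>t. r (t / CARD('n))"
proof (intro real_valued_on_subgroup.intro real_valued_on_subgroup_axioms.intro top_group_axioms)
  show "continuous_map euclideanreal T (\<lambda>t. r (t / real CARD('n)))"
  proof -
    have "continuous_map euclideanreal euclideanreal (\<lambda>t. t / real CARD('n))"
      by (auto intro!: continuous_intros)
    from continuous_map_compose[OF this r_cont] show ?thesis by (simp add: o_def)
  qed
  have "r a = \<one> \<otimes> r a" for a using r_carrier by simp
  then show "r (t / real CARD('n)) \<in> K" for t
    using subgroup.one_closed[OF H_subgroup] unfolding K_iff by blast
  show "\<theta> (x \<otimes> y) = \<theta> x + \<theta> y" if "x \<in> K" "y \<in> carrier G" for x y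
    by (rule \<theta>_mult[OF K_lift_unitary[OF that(1)] that(2)])
qed (use K_subgroup H_eq \<theta>_cont center_subset_K closedin_one in \<open>simp_all add: \<theta>_r\<close>)

end

theorem proposition4p5:
  fixes G :: "('g, 'm) monoid_scheme"
    and T :: "'g topology"
    and \<pi> :: "'g \<Rightarrow> real^('n + 'n)^('n::finite + 'n)"
  assumes "CARD('n) \<ge> 2"
    and "universal_covering_group G T Sp_group (top_of_set Sp) \<pi>"
  shows "\<exists>\<psi>.
    topological_group_iso real_group euclideanreal
      (HR_mod_H G T \<pi>) (HR_mod_H_topology G T \<pi>) \<psi> \<and>
    topological_group_extension
      real_group euclideanreal (\<lambda>t. E_class G T \<pi> \<one>\<^bsub>G\<^esub> (\<psi> t))
      (E_group G T \<pi>) (E_topology G T \<pi>) (eta G)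
      (G Mod group_center G) (coset_topology G T (group_center G)) \<and>
    (\<exists>u. cross_section (E_topology G T \<pi>) (eta G) (coset_topology G T (group_center G)) u)"
proof -
  have univ: "top_group G T" "top_group Sp_group (top_of_set (Sp :: (real^('n + 'n)^('n + 'n)) set))"
    "\<pi> \<in> hom G Sp_group" "covering_map T (top_of_set Sp) \<pi>" "simply_connected_space T"
    using assms(2) by (simp_all add: universal_covering_group_def top_group_iff)
  interpret cover: covering_hom G T Sp_group Sp \<pi>
    by (intro covering_hom.intro covering_hom_axioms.intro univ)
  interpret sc: simply_connected_top_group G T
    by (intro simply_connected_top_group.intro simply_connected_top_group_axioms.intro univ)
  let ?f = "\<lambda>g. det (unitary_part (\<pi> g))"
  obtain \<theta> where \<theta>: "continuous_map T euclideanreal \<theta>" "\<And>g. g \<in> carrier G \<Longrightarrow> cis (\<theta> g) = ?f g"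
    "\<theta> \<one>\<^bsub>G\<^esub> = 0"
  proof (rule sc.angle_lift[of ?f])
    \<comment> \<open>Cayley paths near the identity of Sp are lifted to the covering group.\<close>
    show "\<exists>N'. openin T N' \<and> \<one>\<^bsub>G\<^esub> \<in> N' \<and>
        (\<forall>k\<in>N'. \<exists>q. pathin T q \<and> q 0 = \<one>\<^bsub>G\<^esub> \<and> q 1 = k \<and> q ` {0..1} \<subseteq> N)"
      if "openin T N" "\<one>\<^bsub>G\<^esub> \<in> N" for N
      by (rule cover.locally_path_connected_lift[OF _ that]) (simp add: Sp_locally_path_connected)
    have "continuous_on Sp (\<lambda>M. det (unitary_part M))"
      by (intro continuous_intros continuous_on_unitary_part)
    then have "continuous_map (top_of_set Sp) euclidean (\<lambda>M. det (unitary_part M))" by simp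
    from continuous_map_compose[OF cover.p_cont this] show "continuous_map T euclidean ?f"
      by (simp add: o_def)
    have "(mat 1 :: complex^'n^'n) \<in> unitary_matrices" by (simp add: unitary_matrices_def adjoint_mat)
    from unitary_part_embed[OF this] show "?f \<one>\<^bsub>G\<^esub> = 1"
      using cover.p.hom_one by (simp add: unitary_embed_one det_I)
    show "norm (?f g) = 1" if "g \<in> carrier G" for g
      using cover.p.hom_closed[OF that] by (intro norm_det_unitary unitary_part_unitary) simp
  qed blast
  interpret Sp_cover G T \<pi> \<theta>
    by unfold_locales (use \<theta> in auto)
  \<comment> \<open>Unfolding these turns the groups and topologies of the statement into the terms
    of \<open>real_valued_on_subgroup\<close>.\<close>
  note unfold = HR_mod_H_def HR_mod_H_topology_def E_group_def E_topology_def E_class_def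
    antidiagonal_center_def HR_eq lift_SU_eq
  show ?thesis
    unfolding unfold
    using \<psi>_topological_group_iso extension[unfolded j_def[abs_def]] cross_section_exists by blast
qed

end
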